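(* Let $T>0$ be given. Let $v(u)=v_{\max}/(1+u)$ with $v_{\max}$ a constant, let $V(\rho)=v\left(\int_0^1\rho(t,s)\,ds\right)$ (space dimension $N=1$), and assume $v\in C^1([0,1];\mathbb{R})$ and moreover $v\in C^2([0,1];\mathbb{R})$. Let $S$ be the semigroup generated by $\partial_t\rho+\partial_x(\rho\,V(\rho))=0$, $\rho(0,x)=\rho_o(x)$, and let $$J_1(\rho_o)=\frac12\int_0^1\bigl(d(x)-S_T\rho_o(x)\bigr)^2\,dx .$$ Let $\rho_o\in(W^{1,\infty}\cap W^{2,1})(\mathbb{R};\mathbb{R})$ be a minimizer of $J_1$, and let $\rho(t,\cdot)=S_t\rho_o$. Then, for all $r_o\in(W^{1,\infty}\cap W^{2,1})(\mathbb{R};\mathbb{R})$ we have $$\int_0^1\bigl(d(x)-\rho(T,x)\bigr)\,r(T,x)\,dx=0,$$ where $$\partial_tr+\partial_x\left(v_{\max}\,\frac{r\int_0^1\rho\,dx+\rho\int_0^1r\,dx}{\left(1+\int_0^1\rho\,dx\right)^2}\right)=0,\qquad r(0,x)=r_o(x).$$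
   Context: Here $d$ is a given real-valued target function on $[0,1]$ (a demand target). The function $V(\rho)$ is constant in $x$. Solutions $S_t\rho_o$ of the nonlinear problem are weak entropy solutions: bounded measurable maps $\rho$ which are Kružkov solutions of $\partial_t\rho+\partial_x(\rho\,w)=0$, $\rho(0)=\rho_o$, with $w(t,x)=(V(\rho(t)))(x)$. The Cauchy problem for $r$ has the form $\partial_tr+\partial_x\bigl(r\,a(t,x)+b(t,x)\bigr)=0$, $r(0,x)=r_o(x)$, with $a=v_{\max}\int_0^1\rho\,dx\,/\left(1+\int_0^1\rho\,dx\right)^2$ and $b=v_{\max}\,\rho\int_0^1r\,dx\,/\left(1+\int_0^1\rho\,dx\right)^2$. Its solution is meant in the Kružkov sense on a time interval $I=[0,T'[$ with $T'>T$: $r\in L^\infty(I;L^1(\mathbb{R};\mathbb{R}))$, bounded, measurable, right continuous in time, such that for all $k\in\mathbb{R}$ and all nonnegative $\varphi\in C_c^\infty(]0,T'[\times\mathbb{R})$ $$\int_0^{+\infty}\!\!\int_{\mathbb{R}}\bigl[(r-k)\,\partial_t\varphi+(r-k)\,a\,\partial_x\varphi-\partial_x(k\,a+b)\,\varphi\bigr]\operatorname{sgn}(r-k)\,dx\,dt\ge0$$ and $\lim_{t\to0^+}\int_{-\delta}^{\delta}|r(t,x)-r_o(x)|\,dx=0$ for all $\delta>0$. *)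

theory Defs
  imports "HOL-Analysis.Analysis"
begin

section \<open>Smooth functions, weak derivatives, Sobolev spaces\<close>

text \<open>On sets with non-unique derivatives this is weaker than the usual notion; it is only
  used for open sets and for nondegenerate intervals (with one-sided derivatives at the ends).\<close>

primrec C_k_on :: "nat \<Rightarrow> 'a::real_normed_vector set \<Rightarrow> ('a \<Rightarrow> real) \<Rightarrow> bool" where
  "C_k_on 0 S f \<longleftrightarrow> continuous_on S f"
| "C_k_on (Suc k) S f \<longleftrightarrow>
     (\<exists>f'. (\<forall>x\<in>S. (f has_derivative f' x) (at x within S)) \<and> (\<forall>h. C_k_on k S (\<lambda>x. f' x h)))"

definition test_functions :: "'a::euclidean_space set \<Rightarrow> ('a \<Rightarrow> real) set" where
  "test_functions \<Omega> =
     {\<phi>. (\<forall>k. C_k_on k UNIV \<phi>) \<and> compact (closure {x. \<phi> x \<noteq> 0}) \<and> closure {x. \<phi> x \<noteq> 0} \<subseteq> \<Omega>}"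

definition locally_integrable_on :: "('a::euclidean_space \<Rightarrow> real) \<Rightarrow> 'a set \<Rightarrow> bool"
    (infixr "locally'_integrable'_on" 46) where
  "f locally_integrable_on \<Omega> \<longleftrightarrow> (\<forall>K. compact K \<and> K \<subseteq> \<Omega> \<longrightarrow> f absolutely_integrable_on K)"

text \<open>Distributional derivative of \<open>f\<close> in direction \<open>e\<close>, represented by the function \<open>g\<close>.\<close>

definition weak_derivative_on ::
    "'a::euclidean_space set \<Rightarrow> 'a \<Rightarrow> ('a \<Rightarrow> real) \<Rightarrow> ('a \<Rightarrow> real) \<Rightarrow> bool" where
  "weak_derivative_on \<Omega> e f g \<longleftrightarrow>
     f locally_integrable_on \<Omega> \<and> g locally_integrable_on \<Omega> \<and>
     (\<forall>\<phi>\<in>test_functions \<Omega>.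
        (LINT x:\<Omega>|lebesgue. f x * frechet_derivative \<phi> (at x) e) = - (LINT x:\<Omega>|lebesgue. g x * \<phi> x))"

definition Linfty :: "(real \<Rightarrow> real) set" where
  "Linfty = {f \<in> borel_measurable lebesgue. \<exists>C. AE x in lebesgue. \<bar>f x\<bar> \<le> C}"

definition W_1_infty :: "(real \<Rightarrow> real) set" where
  "W_1_infty = {f \<in> Linfty. \<exists>g\<in>Linfty. weak_derivative_on UNIV 1 f g}"

definition W_2_1 :: "(real \<Rightarrow> real) set" where
  "W_2_1 = {f. integrable lebesgue f \<and>
     (\<exists>g h. integrable lebesgue g \<and> integrable lebesgue h \<and>
        weak_derivative_on UNIV 1 f g \<and> weak_derivative_on UNIV 1 g h)}"


section \<open>Kruzkov solutions\<close>

text \<open>Kruzkov solution \<open>u\<close> on \<open>[0,T'[\<close> of \<open>\<partial>\<^sub>t u + \<partial>\<^sub>x (u a + b) = 0\<close>, \<open>u(0) = u0\<close>. Right continuity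
  in time is that of the map \<open>t \<mapsto> u t\<close> into \<open>L\<^sup>1\<close>. The function \<open>D\<close> is the distributional
  derivative \<open>\<partial>\<^sub>x (k a + b)\<close>, unique up to null sets; that it exists for every \<open>k\<close> contains
  the local integrability of \<open>a\<close> and \<open>b\<close>, without which the Bochner integral
  below could be \<open>0\<close> by convention. The same holds for \<open>u0\<close> and the initial condition.\<close>

definition kruzkov_solution ::
    "real \<Rightarrow> (real \<Rightarrow> real \<Rightarrow> real) \<Rightarrow> (real \<Rightarrow> real \<Rightarrow> real) \<Rightarrow> (real \<Rightarrow> real) \<Rightarrow>
      (real \<Rightarrow> real \<Rightarrow> real) \<Rightarrow> bool" where
  "kruzkov_solution T' a b u0 u \<longleftrightarrow>
     \<comment> \<open>bounded, measurable, in \<open>L\<^sup>\<infinity>([0,T'[; L\<^sup>1)\<close>, right continuous in time\<close>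
     (\<exists>M. \<forall>t\<in>{0..<T'}. \<forall>x. \<bar>u t x\<bar> \<le> M) \<and>
     (\<lambda>(t, x). u t x) \<in> borel_measurable (lebesgue_on ({0..<T'} \<times> UNIV)) \<and>
     (\<forall>t\<in>{0..<T'}. integrable lebesgue (u t)) \<and>
     (\<exists>M. \<forall>t\<in>{0..<T'}. (LINT x|lebesgue. \<bar>u t x\<bar>) \<le> M) \<and>
     (\<forall>t\<in>{0..<T'}. ((\<lambda>s. LINT x|lebesgue. \<bar>u s x - u t x\<bar>) \<longlongrightarrow> 0) (at_right t)) \<and>
     \<comment> \<open>entropy inequalities\<close>
     (\<forall>k. \<exists>D. weak_derivative_on ({0<..<T'} \<times> UNIV) (0, 1) (\<lambda>(t, x). k * a t x + b t x) D \<and>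
        (\<forall>\<phi>\<in>test_functions ({0<..<T'} \<times> UNIV). (\<forall>p. 0 \<le> \<phi> p) \<longrightarrow>
           0 \<le> (LINT (t, x):({0<..<T'} \<times> UNIV)|lebesgue.
                  ((u t x - k) * frechet_derivative \<phi> (at (t, x)) (1, 0)
                   + (u t x - k) * a t x * frechet_derivative \<phi> (at (t, x)) (0, 1)
                   - D (t, x) * \<phi> (t, x)) * sgn (u t x - k)))) \<and>
     \<comment> \<open>initial condition\<close>
     u0 locally_integrable_on UNIV \<and>
     (\<forall>\<delta>>0. ((\<lambda>t. LINT x:{-\<delta>..\<delta>}|lebesgue. \<bar>u t x - u0 x\<bar>) \<longlongrightarrow> 0) (at_right 0))"


section \<open>The nonlocal problem\<close>

definition speed :: "real \<Rightarrow> real \<Rightarrow> real" where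
  "speed vmax u = vmax / (1 + u)"

definition mass01 :: "(real \<Rightarrow> real) \<Rightarrow> real" where
  "mass01 f = (LINT s:{0..1}|lebesgue. f s)"

text \<open>\<^const>\<open>speed\<close> has no meaning at \<open>-1\<close>, so \<open>V(\<rho>(t))\<close> is required to be defined at all times.\<close>

definition weak_entropy_solution ::
    "real \<Rightarrow> real \<Rightarrow> (real \<Rightarrow> real) \<Rightarrow> (real \<Rightarrow> real \<Rightarrow> real) \<Rightarrow> bool" where
  "weak_entropy_solution vmax T' \<rho>o \<rho> \<longleftrightarrow>
     (\<forall>t\<in>{0..<T'}. mass01 (\<rho> t) \<noteq> -1) \<and>
     kruzkov_solution T' (\<lambda>t x. speed vmax (mass01 (\<rho> t))) (\<lambda>t x. 0) \<rho>o \<rho>"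

text \<open>For real-valued data solutions need not be global (the mass on \<open>[0,1]\<close> may reach \<open>-1\<close>),
  so \<open>S\<close> is determined only as long as a solution exists, and is arbitrary otherwise.\<close>

definition generates_semigroup ::
    "real \<Rightarrow> (real \<Rightarrow> (real \<Rightarrow> real) \<Rightarrow> real \<Rightarrow> real) \<Rightarrow> bool" where
  "generates_semigroup vmax S \<longleftrightarrow>
     (\<forall>\<rho>o. \<forall>T'>0. (\<exists>\<rho>. weak_entropy_solution vmax T' \<rho>o \<rho>) \<longrightarrow>
        weak_entropy_solution vmax T' \<rho>o (\<lambda>t. S t \<rho>o))"

definition J1 ::
    "(real \<Rightarrow> real) \<Rightarrow> (real \<Rightarrow> (real \<Rightarrow> real) \<Rightarrow> real \<Rightarrow> real) \<Rightarrow> real \<Rightarrow> (real \<Rightarrow> real) \<Rightarrow> real" where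
  "J1 d S T \<rho>o = 1/2 * (LINT x:{0..1}|lebesgue. (d x - S T \<rho>o x)\<^sup>2)"

text \<open>The competitors are all data in \<open>W\<^sup>1\<^sup>,\<^sup>\<infinity> \<inter> W\<^sup>2\<^sup>,\<^sup>1\<close> for which \<open>S\<^sub>T\<close> is defined.\<close>

definition minimizes_J1 ::
    "real \<Rightarrow> (real \<Rightarrow> real) \<Rightarrow> (real \<Rightarrow> (real \<Rightarrow> real) \<Rightarrow> real \<Rightarrow> real) \<Rightarrow> real \<Rightarrow> (real \<Rightarrow> real) \<Rightarrow> bool" where
  "minimizes_J1 vmax d S T \<rho>o \<longleftrightarrow>
     is_arg_min (J1 d S T)
       (\<lambda>\<sigma>. \<sigma> \<in> W_1_infty \<inter> W_2_1 \<and> (\<exists>T'>T. \<exists>\<rho>. weak_entropy_solution vmax T' \<sigma> \<rho>)) \<rho>o"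

end

theory Submission
  imports Defs
begin

text \<open>
  The minimum of \<^const>\<open>J1\<close> is zero, because the profiles that the flow can produce on \<open>[0,1]\<close> at
  time \<open>T\<close> are dense in \<open>L\<^sup>2(0,1)\<close>. Hence \<open>\<rho>(T) = d\<close> almost everywhere on \<open>[0,1]\<close>, and the integrand of
  the optimality condition vanishes almost everywhere.

  Reachability rests on one observation. The speed is constant in space and depends on the solution
  only through its mass in the window \<open>[0,1]\<close>, so solutions are translated. Take a \<open>C\<^sup>2\<close> profile \<open>g\<close> that
  vanishes outside \<open>]0,1[\<close> and whose mass \<open>m\<close> is not \<open>-1\<close>, and repeat it periodically on a long
  interval. Translating this function does not change its mass in the window
  (\<open>periodization_window_mass\<close>), so it travels at the constant speed \<open>c = v\<^sub>m\<^sub>a\<^sub>x / (1 + m)\<close> and is a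
  Kruzkov solution (\<open>travelling_wave_kruzkov\<close>). Started at distance \<open>c T\<close> behind, it equals \<open>g\<close> on \<open>[0,1]\<close>
  at time \<open>T\<close>.

  The semigroup returns some weak entropy solution for this datum, so uniqueness has to be shown. A
  bounded Kruzkov solution satisfies the equation in the weak sense, by the entropy inequalities
  for constants beyond its bounds (\<open>weak_form_tensor\<close>). Testing with functions that are smooth in
  space gives, for \<open>\<langle>u(t), \<psi>\<rangle> = \<integral> u(t,x) \<psi>(x) dx\<close>, the integrated equation
  \<open>\<langle>u(t), \<psi>\<rangle> - \<langle>u(s), \<psi>\<rangle> = \<integral> a(\<tau>) \<langle>u(\<tau>), \<psi>'\<rangle> d\<tau>\<close> over \<open>[s,t]\<close> (\<open>pairing_increment\<close>). It follows that
  the mass in the window, and with it the speed \<open>a\<close>, is continuous in time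
  (\<open>interval_mass_continuous\<close>), and then that \<open>u(t,x) = u\<^sub>0(x - \<integral> a)\<close>
  (\<open>transported_along_characteristics\<close>). A first-exit argument shows that the window never leaves the
  periodic part of the datum, so \<open>a = c\<close> and the solution is the travelling wave
  (\<open>unit_profile_reachable\<close>).

  Density is elementary: the profiles \<open>max(0, x(1-x))\<^sup>3 p(x)\<close> with polynomials \<open>p\<close> are \<open>C\<^sup>2\<close> on the line,
  vanish outside \<open>]0,1[\<close> and are dense in \<open>L\<^sup>2(0,1)\<close>, even when the mass \<open>-1\<close> is excluded
  (\<open>L2_hump_polynomial_approximation_mass\<close>).
\<close>

section \<open>Smooth functions\<close>

lemma C_k_on_imp_continuous: "C_k_on k S f \<Longrightarrow> continuous_on S f"
  by (cases k) (force simp: continuous_on_eq_continuous_within dest: has_derivative_continuous)+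

lemma C_k_on_Suc_imp: "C_k_on (Suc k) S f \<Longrightarrow> C_k_on k S f"
proof (induction k arbitrary: f)
  case 0
  then show ?case using C_k_on_imp_continuous[OF 0] by simp
next
  case (Suc k)
  then show ?case by (metis C_k_on.simps(2))
qed

lemma C_k_on_const: "C_k_on k S (\<lambda>x. c)"
proof (induction k arbitrary: c)
  case (Suc k)
  show ?case unfolding C_k_on.simps
    by (rule exI[of _ "\<lambda>x h. 0"]) (auto simp: Suc)
qed auto

lemma C_k_on_add:
  "C_k_on k S f \<Longrightarrow> C_k_on k S g \<Longrightarrow> C_k_on k S (\<lambda>x. f x + g x)"
proof (induction k arbitrary: f g)
  case (Suc k)
  from Suc.prems obtain f' g' where
    "\<forall>x\<in>S. (f has_derivative f' x) (at x within S)" "\<forall>h. C_k_on k S (\<lambda>x. f' x h)"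
    "\<forall>x\<in>S. (g has_derivative g' x) (at x within S)" "\<forall>h. C_k_on k S (\<lambda>x. g' x h)"
    unfolding C_k_on.simps by blast
  then show ?case unfolding C_k_on.simps
    by (intro exI[of _ "\<lambda>x h. f' x h + g' x h"]) (auto intro!: has_derivative_add Suc.IH)
qed (auto intro: continuous_intros)

lemma C_k_on_mult:
  "C_k_on k S f \<Longrightarrow> C_k_on k S g \<Longrightarrow> C_k_on k S (\<lambda>x. f x * g x)"
proof (induction k arbitrary: f g)
  case (Suc k)
  from Suc.prems obtain f' g' where *:
    "\<forall>x\<in>S. (f has_derivative f' x) (at x within S)" "\<forall>h. C_k_on k S (\<lambda>x. f' x h)"
    "\<forall>x\<in>S. (g has_derivative g' x) (at x within S)" "\<forall>h. C_k_on k S (\<lambda>x. g' x h)"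
    unfolding C_k_on.simps by blast
  have fg: "C_k_on k S f" "C_k_on k S g" using Suc.prems C_k_on_Suc_imp by auto
  show ?case unfolding C_k_on.simps
    by (rule exI[of _ "\<lambda>x h. f x * g' x h + f' x h * g x"])
      (use * fg in \<open>auto intro!: has_derivative_mult Suc.IH C_k_on_add\<close>)
qed (auto intro: continuous_intros)

lemma C_k_on_cmult: "C_k_on k S f \<Longrightarrow> C_k_on k S (\<lambda>x. c * f x)"
  by (intro C_k_on_mult C_k_on_const)

lemma C_k_on_diff:
  "C_k_on k S f \<Longrightarrow> C_k_on k S g \<Longrightarrow> C_k_on k S (\<lambda>x. f x - g x)"
  using C_k_on_add[of k S f "\<lambda>x. -1 * g x"] C_k_on_cmult[of k S g "-1"] by simp

lemma C_k_on_inverse: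
  "C_k_on k S f \<Longrightarrow> (\<And>x. x \<in> S \<Longrightarrow> f x \<noteq> 0) \<Longrightarrow> C_k_on k S (\<lambda>x. inverse (f x))"
proof (induction k)
  case (Suc k)
  from Suc.prems obtain f' where *:
    "\<forall>x\<in>S. (f has_derivative f' x) (at x within S)" "\<forall>h. C_k_on k S (\<lambda>x. f' x h)"
    unfolding C_k_on.simps by blast
  have i: "C_k_on k S (\<lambda>x. inverse (f x))" using Suc C_k_on_Suc_imp by blast
  show ?case unfolding C_k_on.simps
  proof (rule exI[of _ "\<lambda>x h. - (inverse (f x) * f' x h * inverse (f x))"], intro conjI ballI allI)
    show "((\<lambda>x. inverse (f x)) has_derivative (\<lambda>h. - (inverse (f x) * f' x h * inverse (f x))))
        (at x within S)" if "x \<in> S" for x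
      by (intro Deriv.has_derivative_inverse) (use * that Suc.prems in auto)
    show "C_k_on k S (\<lambda>x. - (inverse (f x) * f' x h * inverse (f x)))" for h
      using C_k_on_cmult[OF C_k_on_mult[OF C_k_on_mult[OF i] i], of "\<lambda>x. f' x h" "-1"] * by simp
  qed
qed (auto intro: continuous_intros)

lemma C_k_on_affine:
  assumes "bounded_linear L" "C_k_on k UNIV f"
  shows "C_k_on k UNIV (\<lambda>x. f (L x + c))"
  using assms(2)
proof (induction k arbitrary: f)
  case 0
  have "continuous_on UNIV (\<lambda>x. L x + c)"
    by (intro continuous_on_add continuous_on_const linear_continuous_on assms(1))
  with 0 show ?case by (auto intro: continuous_on_compose2[of UNIV f])
next
  case (Suc k)
  from Suc.prems obtain f' where *:
    "\<And>x. (f has_derivative f' x) (at x)" "\<And>h. C_k_on k UNIV (\<lambda>x. f' x h)"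
    unfolding C_k_on.simps by auto
  show ?case unfolding C_k_on.simps
  proof (rule exI[of _ "\<lambda>x h. f' (L x + c) (L h)"], intro conjI ballI allI)
    show "((\<lambda>x. f (L x + c)) has_derivative (\<lambda>h. f' (L x + c) (L h))) (at x within UNIV)" for x
    proof -
      have "((\<lambda>x. L x + c) has_derivative L) (at x)"
        using assms(1) by (auto intro!: derivative_eq_intros bounded_linear_imp_has_derivative)
      from has_derivative_compose[OF this *(1)] show ?thesis by simp
    qed
    show "C_k_on k UNIV (\<lambda>x. f' (L x + c) (L h))" for h
      using Suc.IH[OF *(2)] by simp
  qed
qed

lemma C_k_on_real_affine:
  fixes f :: "real \<Rightarrow> real"
  shows "C_k_on k UNIV f \<Longrightarrow> C_k_on k UNIV (\<lambda>x. f (a * x + c))"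
  using C_k_on_affine[of "\<lambda>x. a * x" k f c] bounded_linear_mult_right by blast

lemma C_k_on_Suc_realI:
  fixes f f' :: "real \<Rightarrow> real"
  assumes "\<And>x. (f has_real_derivative f' x) (at x)" "C_k_on k UNIV f'"
  shows "C_k_on (Suc k) UNIV f"
  unfolding C_k_on.simps
  by (rule exI[of _ "\<lambda>x h. f' x * h"])
    (use assms C_k_on_mult[OF assms(2) C_k_on_const] in \<open>auto simp: has_field_derivative_def\<close>)

lemma C_k_on_Suc_realD:
  fixes f :: "real \<Rightarrow> real"
  assumes "C_k_on (Suc k) UNIV f"
  shows "(f has_real_derivative deriv f x) (at x)" "C_k_on k UNIV (deriv f)"
proof -
  from assms obtain f' where *:
    "\<And>x. (f has_derivative f' x) (at x)" "\<And>h. C_k_on k UNIV (\<lambda>x. f' x h)"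
    unfolding C_k_on.simps by auto
  have d: "(f has_real_derivative f' x 1) (at x)" for x
  proof -
    have "f' x = (\<lambda>h. f' x 1 * h)"
      using linear_times_of_real[of ] has_derivative_linear[OF *(1)[of x]]
      by (metis (no_types, opaque_lifting) linear_cmul mult.commute mult.right_neutral real_scaleR_def)
    then show ?thesis using *(1)[of x] by (simp add: has_field_derivative_def)
  qed
  then have e: "deriv f = (\<lambda>x. f' x 1)" by (auto intro!: DERIV_imp_deriv)
  show "(f has_real_derivative deriv f x) (at x)" using d e by simp
  show "C_k_on k UNIV (deriv f)" using * e by simp
qed

section \<open>A smooth step\<close>

text \<open>For \<open>p = 1\<close> this is the classical function \<open>e\<^sup>-\<^sup>1\<^sup>/\<^sup>x\<close> that is flat at \<open>0\<close>. The polynomial factor in \<open>1/x\<close> makes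
  the family closed under differentiation, so that smoothness is a one-line induction.\<close>

definition flat_exp :: "real poly \<Rightarrow> real \<Rightarrow> real" where
  "flat_exp p x = (if 0 < x then poly p (inverse x) * exp (- inverse x) else 0)"

lemma poly_times_exp_minus_tendsto_0: "((\<lambda>y. poly p y * exp (- y)) \<longlongrightarrow> 0) at_top" for p :: "real poly"
proof -
  have "((\<lambda>y. \<Sum>i\<le>degree p. coeff p i * (y ^ i / exp y)) \<longlongrightarrow> (\<Sum>i\<le>degree p. coeff p i * 0)) at_top"
    by (intro tendsto_intros tendsto_power_div_exp_0)
  then show ?thesis
    by (simp add: poly_altdef exp_minus sum_distrib_right divide_inverse mult.assoc)
qed

lemma flat_exp_has_derivative:
  "(flat_exp p has_real_derivative flat_exp ((p - pderiv p) * [:0, 0, 1:]) x) (at x)"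
proof -
  consider "x < 0" | "x = 0" | "0 < x" by linarith
  then show ?thesis
  proof cases
    case 1
    have "((\<lambda>x. 0) has_real_derivative 0) (at x)" by simp
    then have "(flat_exp p has_real_derivative 0) (at x)"
      by (rule has_field_derivative_transform_within_open[of _ _ _ "{..<0}"])
        (use 1 in \<open>auto simp: flat_exp_def\<close>)
    then show ?thesis using 1 by (simp add: flat_exp_def)
  next
    case 3
    have "((\<lambda>x. poly p (inverse x) * exp (- inverse x)) has_real_derivative
       poly ((p - pderiv p) * [:0, 0, 1:]) (inverse x) * exp (- inverse x)) (at x)"
      using 3 by (auto intro!: derivative_eq_intros poly_DERIV DERIV_chain2[of "poly p"]
          simp: algebra_simps power2_eq_square)
    then have "(flat_exp p has_real_derivative poly ((p - pderiv p) * [:0, 0, 1:]) (inverse x) * exp (- inverse x)) (at x)"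
      by (rule has_field_derivative_transform_within_open[of _ _ _ "{0<..}"])
        (use 3 in \<open>auto simp: flat_exp_def\<close>)
    then show ?thesis using 3 by (simp add: flat_exp_def)
  next
    case 2
    \<comment> \<open>the difference quotient is \<open>q(y) e\<^sup>-\<^sup>y\<close> at \<open>y = 1/h\<close>, for another polynomial \<open>q\<close>\<close>
    have "((\<lambda>h. flat_exp p h / h) \<longlongrightarrow> 0) (at 0)"
    proof (subst filterlim_at_split, intro conjI)
      have "\<forall>\<^sub>F h in at_left 0. flat_exp p h / h = 0"
        by (auto simp: eventually_at_left_field flat_exp_def intro!: exI[of _ "-1"])
      then show "((\<lambda>h. flat_exp p h / h) \<longlongrightarrow> 0) (at_left 0)"
        by (simp add: tendsto_eventually)
      have "((\<lambda>h. poly (p * [:0, 1:]) (inverse h) * exp (- inverse h)) \<longlongrightarrow> 0) (at_right (0::real))"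
        by (rule filterlim_compose[OF poly_times_exp_minus_tendsto_0 filterlim_inverse_at_top_right])
      moreover have "\<forall>\<^sub>F h in at_right 0. poly (p * [:0, 1:]) (inverse h) * exp (- inverse h) = flat_exp p h / h"
        by (auto simp: eventually_at_right_field flat_exp_def divide_inverse intro!: exI[of _ 1])
      ultimately show "((\<lambda>h. flat_exp p h / h) \<longlongrightarrow> 0) (at_right 0)"
        by (rule Lim_transform_eventually)
    qed
    then show ?thesis using 2 by (simp add: DERIV_def flat_exp_def)
  qed
qed

lemma flat_exp_smooth: "C_k_on k UNIV (flat_exp p)"
proof (induction k arbitrary: p)
  case 0
  show ?case using flat_exp_has_derivative
    by (auto intro!: continuous_at_imp_continuous_on DERIV_isCont)
qed (rule C_k_on_Suc_realI, rule flat_exp_has_derivative, blast)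

text \<open>The two terms of the denominator do not vanish together. Writing the step as a quotient gives the
  values \<open>0\<close> and \<open>1\<close> outside \<open>[0,1]\<close> directly, and its derivative is a bump of integral \<open>1\<close> without a
  normalizing constant.\<close>

definition smooth_step :: "real \<Rightarrow> real" where
  "smooth_step x = flat_exp 1 x / (flat_exp 1 x + flat_exp 1 (1 - x))"

definition bump :: "real \<Rightarrow> real" where "bump = deriv smooth_step"

lemma flat_exp_1: "0 \<le> flat_exp 1 x" "0 < x \<Longrightarrow> 0 < flat_exp 1 x" "x \<le> 0 \<Longrightarrow> flat_exp 1 x = 0"
  by (auto simp: flat_exp_def)

lemma flat_exp_1_mono: "x \<le> y \<Longrightarrow> flat_exp 1 x \<le> flat_exp 1 y"
  by (auto simp: flat_exp_def le_imp_inverse_le)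

lemma smooth_step_denominator_pos: "0 < flat_exp 1 x + flat_exp 1 (1 - x)"
proof (cases "0 < x")
  case True then show ?thesis using flat_exp_1(2)[of x] flat_exp_1(1)[of "1 - x"] by linarith
next
  case False then show ?thesis using flat_exp_1(2)[of "1 - x"] flat_exp_1(1)[of x] by linarith
qed

lemma smooth_step_smooth: "C_k_on k UNIV smooth_step"
proof -
  have "C_k_on k UNIV (\<lambda>x. flat_exp 1 (1 - x))"
    using C_k_on_real_affine[OF flat_exp_smooth, of k 1 "-1" 1] by (simp add: algebra_simps)
  then have "C_k_on k UNIV (\<lambda>x. flat_exp 1 x * inverse (flat_exp 1 x + flat_exp 1 (1 - x)))"
    using smooth_step_denominator_pos
    by (intro C_k_on_mult C_k_on_inverse C_k_on_add flat_exp_smooth) (metis less_irrefl)+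
  then show ?thesis
    by (simp add: smooth_step_def[abs_def] divide_inverse)
qed

lemma smooth_step_0: "x \<le> 0 \<Longrightarrow> smooth_step x = 0"
  by (simp add: smooth_step_def flat_exp_1)

lemma smooth_step_1: "1 \<le> x \<Longrightarrow> smooth_step x = 1"
  using flat_exp_1(2)[of x] by (simp add: smooth_step_def flat_exp_1(3) less_imp_neq[symmetric])

lemma smooth_step_mono: "mono smooth_step"
proof
  fix x y :: real assume "x \<le> y"
  have "flat_exp 1 x * flat_exp 1 (1 - y) \<le> flat_exp 1 y * flat_exp 1 (1 - x)"
    using \<open>x \<le> y\<close> by (intro mult_mono flat_exp_1_mono flat_exp_1(1)) auto
  then have "flat_exp 1 x * (flat_exp 1 y + flat_exp 1 (1 - y)) \<le> flat_exp 1 y * (flat_exp 1 x + flat_exp 1 (1 - x))"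
    by (simp add: algebra_simps)
  then show "smooth_step x \<le> smooth_step y"
    using smooth_step_denominator_pos by (simp add: smooth_step_def frac_le_eq pos_divide_le_eq pos_le_divide_eq mult.commute)
qed

lemma smooth_step_range: "0 \<le> smooth_step x" "smooth_step x \<le> 1"
  using monoD[OF smooth_step_mono, of "min x 0" x] smooth_step_0[of "min x 0"]
    monoD[OF smooth_step_mono, of x "max x 1"] smooth_step_1[of "max x 1"] by auto

lemma smooth_step_DERIV: "(smooth_step has_real_derivative bump x) (at x)"
  using C_k_on_Suc_realD(1)[OF smooth_step_smooth] by (simp add: bump_def)

lemma bump_smooth: "C_k_on k UNIV bump"
  using C_k_on_Suc_realD(2)[OF smooth_step_smooth] by (simp add: bump_def)

lemma bump_nonneg: "0 \<le> bump x"
  using mono_on_imp_deriv_nonneg[of UNIV smooth_step "bump x" x] smooth_step_mono smooth_step_DERIV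
  by simp

lemma bump_outside: "x < 0 \<or> 1 < x \<Longrightarrow> bump x = 0"
proof -
  have "(smooth_step has_real_derivative 0) (at x)" if "x < 0"
    by (rule has_field_derivative_transform_within_open[of "\<lambda>x. 0" _ _ "{..<0}"])
      (use that in \<open>auto simp: smooth_step_0\<close>)
  moreover have "(smooth_step has_real_derivative 0) (at x)" if "1 < x"
    by (rule has_field_derivative_transform_within_open[of "\<lambda>x. 1" _ _ "{1<..}"])
      (use that in \<open>auto simp: smooth_step_1\<close>)
  ultimately show "x < 0 \<or> 1 < x \<Longrightarrow> bump x = 0"
    using smooth_step_DERIV DERIV_unique by blast
qed

section \<open>Compactly supported functions and test functions\<close>

lemma integrable_lborel_compact_support:
  fixes f :: "'a::euclidean_space \<Rightarrow> real"
  assumes "continuous_on UNIV f" "compact K" "\<And>x. x \<notin> K \<Longrightarrow> f x = 0"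
  shows "integrable lborel f"
proof -
  have "integrable lborel (\<lambda>x. indicator K x *\<^sub>R f x)"
    using assms by (intro borel_integrable_compact) (auto intro: continuous_on_subset)
  moreover have "(\<lambda>x. indicator K x *\<^sub>R f x) = f"
  proof
    show "indicator K x *\<^sub>R f x = f x" for x
      using assms(3) by (cases "x \<in> K") simp_all
  qed
  ultimately show ?thesis by (simp only:)
qed

lemma borel_measurable_lebesgue_continuous:
  fixes f :: "'a::euclidean_space \<Rightarrow> real"
  shows "continuous_on UNIV f \<Longrightarrow> f \<in> borel_measurable lebesgue"
  by (simp add: borel_measurable_continuous_onI measurable_completion)

lemma integrable_lebesgue_compact_support:
  fixes f :: "'a::euclidean_space \<Rightarrow> real"
  assumes "continuous_on UNIV f" "compact K" "\<And>x. x \<notin> K \<Longrightarrow> f x = 0"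
  shows "integrable lebesgue f"
  using integrable_lborel_compact_support[OF assms] assms(1)
  by (simp add: integrable_completion borel_measurable_continuous_onI)

lemma integral_lebesgue_eq_lborel:
  fixes f :: "'a::euclidean_space \<Rightarrow> real"
  shows "continuous_on UNIV f \<Longrightarrow> (LINT x|lebesgue. f x) = (LINT x|lborel. f x)"
  by (simp add: integral_completion borel_measurable_continuous_onI)

lemma compact_support_bounded:
  fixes f :: "'a::euclidean_space \<Rightarrow> real"
  assumes "continuous_on UNIV f" "compact K" "\<And>x. x \<notin> K \<Longrightarrow> f x = 0"
  obtains C where "0 \<le> C" "\<And>x. \<bar>f x\<bar> \<le> C"
proof -
  have "bounded (f ` K)"
    using assms by (intro compact_imp_bounded compact_continuous_image) (auto intro: continuous_on_subset)
  then obtain C where C: "0 < C" "\<And>x. x \<in> K \<Longrightarrow> \<bar>f x\<bar> \<le> C"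
    unfolding bounded_pos by auto
  have "\<bar>f x\<bar> \<le> C" for x using C assms(3)[of x] by (cases "x \<in> K") auto
  then show thesis using that[of C] C by simp
qed

lemma deriv_outside_support:
  fixes f :: "real \<Rightarrow> real"
  assumes "(f has_real_derivative f') (at x)" "closed K" "\<And>x. x \<notin> K \<Longrightarrow> f x = 0" "x \<notin> K"
  shows "f' = 0"
proof -
  have "(f has_real_derivative 0) (at x)"
    using has_field_derivative_transform_within_open[of "\<lambda>_. 0" 0 x "- K" f] assms(2-4)
    by (simp add: open_Compl)
  then show ?thesis using assms(1) DERIV_unique by blast
qed

lemma integral_deriv_compact_support:
  fixes f f' :: "real \<Rightarrow> real"
  assumes d: "\<And>x. (f has_real_derivative f' x) (at x)" and c: "continuous_on UNIV f'"
    and s: "\<And>x. R < \<bar>x\<bar> \<Longrightarrow> f x = 0"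
  shows "(LINT x|lborel. f' x) = 0"
proof -
  define B where "B = \<bar>R\<bar> + 1"
  have sK: "f x = 0" if "x \<notin> {-R..R}" for x using that by (intro s) auto
  have z: "f' x = 0" if "R < \<bar>x\<bar>" for x
    by (rule deriv_outside_support[OF d closed_atLeastAtMost sK]) (use that in auto)
  have "(LINT x|lborel. f' x * indicator {-B..B} x) = f B - f (-B)"
    using d c by (intro integral_FTC_Icc_real) (auto simp: B_def continuous_on_eq_continuous_at)
  also have "\<dots> = 0" using s[of B] s[of "-B"] by (simp add: B_def)
  also have "(\<lambda>x. f' x * indicator {-B..B} x) = f'"
  proof
    show "f' x * indicator {-B..B} x = f' x" for x
      using z[of x] by (cases "x \<in> {-B..B}") (auto simp: B_def)
  qed
  finally show ?thesis .
qed

lemma test_function_smooth: "\<psi> \<in> test_functions \<Omega> \<Longrightarrow> C_k_on k UNIV \<psi>"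
  by (simp add: test_functions_def)

lemma test_function_support:
  assumes "\<psi> \<in> test_functions (\<Omega> :: 'a::euclidean_space set)"
  obtains K where "compact K" "K \<subseteq> \<Omega>" "\<And>x. x \<notin> K \<Longrightarrow> \<psi> x = 0"
  using assms that[of "closure {x. \<psi> x \<noteq> 0}"] closure_subset[of "{x. \<psi> x \<noteq> 0}"]
  unfolding test_functions_def by blast

lemma test_function_continuous: "\<psi> \<in> test_functions \<Omega> \<Longrightarrow> continuous_on UNIV \<psi>"
  using test_function_smooth[of \<psi> \<Omega> 0] by simp

lemma test_functionI:
  assumes "\<And>k. C_k_on k UNIV \<psi>" "compact K" "K \<subseteq> \<Omega>" "\<And>x. x \<notin> K \<Longrightarrow> \<psi> x = 0"
  shows "\<psi> \<in> test_functions \<Omega>"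
proof -
  have "closure {x. \<psi> x \<noteq> 0} \<subseteq> K"
    using assms by (intro closure_minimal) (auto simp: compact_imp_closed)
  moreover from this have "compact (closure {x. \<psi> x \<noteq> 0})"
    using compact_Int_closed[OF assms(2) closed_closure, of "{x. \<psi> x \<noteq> 0}"] by (simp add: Int_absorb1)
  ultimately show ?thesis using assms(1,3) by (auto simp: test_functions_def)
qed

lemma test_function_mono: "\<psi> \<in> test_functions \<Omega> \<Longrightarrow> \<Omega> \<subseteq> \<Omega>' \<Longrightarrow> \<psi> \<in> test_functions \<Omega>'"
  by (auto simp: test_functions_def)

lemma test_function_interval:
  assumes "\<psi> \<in> test_functions (UNIV :: real set)"
  obtains R where "0 < R" "\<And>x. R < \<bar>x\<bar> \<Longrightarrow> \<psi> x = 0"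
proof -
  from test_function_support[OF assms] obtain K where K: "compact K" "\<And>x. x \<notin> K \<Longrightarrow> \<psi> x = 0" by metis
  then obtain R where "0 < R" "\<And>x. x \<in> K \<Longrightarrow> \<bar>x\<bar> \<le> R"
    using compact_imp_bounded[of K] by (auto simp: bounded_pos)
  with K that show thesis by (meson not_le)
qed

lemma test_function_bounded:
  assumes "\<psi> \<in> test_functions \<Omega>"
  obtains C where "0 \<le> C" "\<And>x. \<bar>\<psi> x\<bar> \<le> C"
  using test_function_support[OF assms] compact_support_bounded[OF test_function_continuous[OF assms]]
  by metis

lemma test_function_integrable: "\<psi> \<in> test_functions \<Omega> \<Longrightarrow> integrable lebesgue \<psi>"
  using test_function_support integrable_lebesgue_compact_support test_function_continuous by metis

lemma test_function_DERIV:
  fixes \<psi> :: "real \<Rightarrow> real"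
  assumes "\<psi> \<in> test_functions \<Omega>"
  shows "(\<psi> has_real_derivative deriv \<psi> x) (at x)"
  by (rule C_k_on_Suc_realD(1)[OF test_function_smooth[OF assms]])

lemma test_function_deriv:
  fixes \<psi> :: "real \<Rightarrow> real"
  assumes "\<psi> \<in> test_functions \<Omega>"
  shows "deriv \<psi> \<in> test_functions \<Omega>"
proof -
  obtain K where K: "compact K" "K \<subseteq> \<Omega>" "\<And>x. x \<notin> K \<Longrightarrow> \<psi> x = 0"
    using test_function_support[OF assms] by blast
  then have "deriv \<psi> x = 0" if "x \<notin> K" for x
    using deriv_outside_support[OF test_function_DERIV[OF assms], of K x] K that
    by (simp add: compact_imp_closed)
  then show ?thesis
    using C_k_on_Suc_realD(2) test_function_smooth[OF assms] K by (intro test_functionI) blast+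
qed

lemma test_function_shift:
  fixes \<psi> :: "real \<Rightarrow> real"
  assumes "\<psi> \<in> test_functions UNIV"
  shows "(\<lambda>x. \<psi> (x - y)) \<in> test_functions UNIV" "deriv (\<lambda>x. \<psi> (x - y)) = (\<lambda>x. deriv \<psi> (x - y))"
proof -
  obtain R where R: "0 < R" "\<And>x. R < \<bar>x\<bar> \<Longrightarrow> \<psi> x = 0" using test_function_interval[OF assms] by blast
  show "(\<lambda>x. \<psi> (x - y)) \<in> test_functions UNIV"
    using C_k_on_real_affine[OF test_function_smooth[OF assms], of _ 1 "-y"] R
    by (intro test_functionI[of _ "{y - R..y + R}"]) auto
  show "deriv (\<lambda>x. \<psi> (x - y)) = (\<lambda>x. deriv \<psi> (x - y))"
    by (rule ext, rule DERIV_imp_deriv)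
      (rule DERIV_chain2[OF test_function_DERIV[OF assms], where Db=1, simplified], auto intro!: derivative_eq_intros)
qed

lemma test_function_add_scaled:
  assumes "\<phi> \<in> test_functions \<Omega>" "\<psi> \<in> test_functions \<Omega>"
  shows "(\<lambda>x. \<phi> x + c * \<psi> x) \<in> test_functions \<Omega>"
proof -
  from assms obtain K L where "compact K" "K \<subseteq> \<Omega>" "\<And>x. x \<notin> K \<Longrightarrow> \<phi> x = 0"
    "compact L" "L \<subseteq> \<Omega>" "\<And>x. x \<notin> L \<Longrightarrow> \<psi> x = 0"
    using test_function_support by metis
  moreover have "C_k_on k UNIV (\<lambda>x. \<phi> x + c * \<psi> x)" for k
    using C_k_on_add[OF test_function_smooth[OF assms(1)] C_k_on_cmult[OF test_function_smooth[OF assms(2)]]] .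
  ultimately show ?thesis
    by (intro test_functionI[of _ "K \<union> L"] compact_Un) auto
qed

text \<open>Both ramps lie to the right, in \<open>[p, p + e]\<close> and \<open>[q, q + e]\<close>. As a test function in time, the plateau
  therefore only sees values after \<open>p\<close> and after \<open>q\<close>, and right continuity suffices when \<open>e\<close> tends
  to \<open>0\<close>.\<close>

definition plateau :: "real \<Rightarrow> real \<Rightarrow> real \<Rightarrow> real \<Rightarrow> real" where
  "plateau p q e x = smooth_step ((x - p) / e) - smooth_step ((x - q) / e)"

lemma plateau_smooth: "C_k_on k UNIV (plateau p q e)"
proof -
  have "C_k_on k UNIV (\<lambda>x. smooth_step ((x - a) / e))" for a
    using C_k_on_real_affine[OF smooth_step_smooth, of k "inverse e" "- a * inverse e"]
    by (simp add: divide_inverse algebra_simps)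
  then show ?thesis unfolding plateau_def[abs_def] by (intro C_k_on_diff)
qed

lemma plateau_outside: "0 < e \<Longrightarrow> p \<le> q \<Longrightarrow> x \<le> p \<or> q + e \<le> x \<Longrightarrow> plateau p q e x = 0"
  by (auto simp: plateau_def smooth_step_0 smooth_step_1 field_simps divide_nonpos_pos)

lemma plateau_inside: "0 < e \<Longrightarrow> p + e \<le> x \<Longrightarrow> x \<le> q \<Longrightarrow> plateau p q e x = 1"
  by (auto simp: plateau_def smooth_step_0 smooth_step_1 field_simps divide_nonpos_pos)

lemma plateau_range: "0 < e \<Longrightarrow> p \<le> q \<Longrightarrow> 0 \<le> plateau p q e x" "plateau p q e x \<le> 1"
  using monoD[OF smooth_step_mono, of "(x - q) / e" "(x - p) / e"]
    smooth_step_range[of "(x - q) / e"] smooth_step_range[of "(x - p) / e"]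
  by (auto simp: plateau_def divide_right_mono)

lemma plateau_test_function:
  assumes "0 < e" "p \<le> q" "{p..q + e} \<subseteq> \<Omega>"
  shows "plateau p q e \<in> test_functions \<Omega>"
  using assms plateau_outside
  by (intro test_functionI[of _ "{p..q + e}"] plateau_smooth) (auto simp: not_le)

lemma plateau_deriv:
  "deriv (plateau p q e) x = bump ((x - p) / e) / e - bump ((x - q) / e) / e"
proof (rule DERIV_imp_deriv)
  have "((\<lambda>x. smooth_step ((x - a) / e)) has_real_derivative bump ((x - a) / e) * (1 / e)) (at x)" for a
    by (rule DERIV_chain2[OF smooth_step_DERIV])
      (cases "e = 0"; auto intro!: derivative_eq_intros)
  from DERIV_diff[OF this[of p] this[of q]]
  show "(plateau p q e has_real_derivative bump ((x - p) / e) / e - bump ((x - q) / e) / e) (at x)"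
    by (simp add: plateau_def[abs_def])
qed

lemma test_function_tensor:
  fixes \<eta> \<psi> :: "real \<Rightarrow> real"
  assumes "\<eta> \<in> test_functions A" "\<psi> \<in> test_functions B"
  shows "(\<lambda>p. \<eta> (fst p) * \<psi> (snd p)) \<in> test_functions (A \<times> B)"
proof -
  from assms obtain K L where "compact K" "K \<subseteq> A" "\<And>x. x \<notin> K \<Longrightarrow> \<eta> x = 0"
    "compact L" "L \<subseteq> B" "\<And>x. x \<notin> L \<Longrightarrow> \<psi> x = 0"
    using test_function_support by metis
  moreover have "C_k_on k UNIV (\<lambda>p. \<eta> (fst p) * \<psi> (snd p))" for k
    using C_k_on_affine[OF bounded_linear_fst test_function_smooth[OF assms(1)], of k 0]
      C_k_on_affine[OF bounded_linear_snd test_function_smooth[OF assms(2)], of k 0]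
    by (intro C_k_on_mult) simp_all
  moreover have "\<eta> (fst p) * \<psi> (snd p) = 0" if "p \<notin> K \<times> L" for p
    using that calculation by (cases p) auto
  ultimately show ?thesis
    by (intro test_functionI[of _ "K \<times> L"] compact_Times) auto
qed

lemma frechet_derivative_tensor:
  fixes \<eta> \<psi> :: "real \<Rightarrow> real"
  assumes "\<eta> \<in> test_functions A" "\<psi> \<in> test_functions B"
  shows "frechet_derivative (\<lambda>p. \<eta> (fst p) * \<psi> (snd p)) (at (t, x)) (h, k)
     = deriv \<eta> t * \<psi> x * h + \<eta> t * deriv \<psi> x * k"
proof -
  have "(\<eta> has_derivative (*) (deriv \<eta> t)) (at t)" "(\<psi> has_derivative (*) (deriv \<psi> x)) (at x)"
    using assms test_function_DERIV by (auto simp: has_field_derivative_def)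
  then have "((\<lambda>p. \<eta> (fst p)) has_derivative (\<lambda>p. deriv \<eta> t * fst p)) (at (t, x))"
      "((\<lambda>p. \<psi> (snd p)) has_derivative (\<lambda>p. deriv \<psi> x * snd p)) (at (t, x))"
    using has_derivative_compose[of fst fst "(t, x)" UNIV \<eta> "(*) (deriv \<eta> t)"]
      has_derivative_compose[of snd snd "(t, x)" UNIV \<psi> "(*) (deriv \<psi> x)"]
    by (simp_all add: bounded_linear_imp_has_derivative bounded_linear_fst bounded_linear_snd)
  from has_derivative_mult[OF this] 
  have "((\<lambda>p. \<eta> (fst p) * \<psi> (snd p)) has_derivative
      (\<lambda>p. \<eta> t * (deriv \<psi> x * snd p) + deriv \<eta> t * fst p * \<psi> x)) (at (t, x))" by simp
  from frechet_derivative_at[OF this, symmetric] show ?thesis by simp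
qed

section \<open>Fubini and null functions for Lebesgue measure\<close>

text \<open>Lebesgue measure on the plane is the completion of the product \<open>lborel \<Otimes> lborel\<close> and not itself a
  product. The theorem of Fubini for products is applied to a Borel function that equals \<open>f\<close> almost
  everywhere, and almost every slice of the exceptional set is a null set.\<close>

lemma lebesgue_Fubini:
  fixes f :: "real \<times> real \<Rightarrow> real"
  assumes f: "integrable lebesgue f"
  shows "AE t in lebesgue. integrable lebesgue (\<lambda>x. f (t, x))"
    and "integrable lebesgue (\<lambda>t. LINT x|lebesgue. f (t, x))"
    and "(LINT p|lebesgue. f p) = (LINT t|lebesgue. LINT x|lebesgue. f (t, x))"
proof -
  obtain g where g[measurable]: "g \<in> borel_measurable lborel" and ae0: "AE p in lborel. f p = g p"
    using completion_ex_borel_measurable_real[OF borel_measurable_integrable[OF f]] by blast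
  from ae0 have fg: "AE p in lborel \<Otimes>\<^sub>M lborel. f p = g p" unfolding lborel_prod .
  from g have gl: "g \<in> borel_measurable lebesgue" by (rule measurable_completion)
  have ae: "AE p in lebesgue. f p = g p" using fg unfolding lborel_prod by (rule AE_completion)
  have "integrable lebesgue g"
    using f gl ae integrable_cong_AE[of f lebesgue g] by auto
  then have ig: "integrable (lborel \<Otimes>\<^sub>M lborel) (\<lambda>(t, x). g (t, x))"
    using integrable_completion[OF g] by (simp add: lborel_prod)
  have "AE t in lborel. AE x in lborel. f (t, x) = g (t, x)"
    using lborel_pair.AE_pair[OF fg] .
  moreover have "AE t in lborel. integrable lborel (\<lambda>x. g (t, x))"
    using lborel_pair.AE_integrable_fst[OF ig] .
  ultimately have *: "AE t in lborel. integrable lebesgue (\<lambda>x. f (t, x)) \<and>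
      (LINT x|lebesgue. f (t, x)) = (LINT x|lborel. g (t, x))"
  proof eventually_elim
    case (elim t)
    have m: "(\<lambda>x. g (t, x)) \<in> borel_measurable lborel" using elim(2) by simp
    have g': "integrable lebesgue (\<lambda>x. g (t, x))" using elim(2) integrable_completion[OF m] by simp
    have ae': "AE x in lebesgue. f (t, x) = g (t, x)" using elim(1) by (rule AE_completion)
    have fm: "(\<lambda>x. f (t, x)) \<in> borel_measurable lebesgue"
      by (rule borel_measurable_AE[OF borel_measurable_integrable[OF g']]) (use ae' in auto)
    show ?case
      using integrable_cong_AE[OF fm borel_measurable_integrable[OF g'] ae']
        integral_cong_AE[OF fm borel_measurable_integrable[OF g'] ae'] g' integral_completion[OF m]
      by simp
  qed
  then show "AE t in lebesgue. integrable lebesgue (\<lambda>x. f (t, x))"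
    by (intro AE_completion) auto
  have i: "integrable lborel (\<lambda>t. LINT x|lborel. g (t, x))"
    using lborel_pair.integrable_fst[OF ig] .
  then have im: "(\<lambda>t. LINT x|lborel. g (t, x)) \<in> borel_measurable lborel" by simp
  have i': "integrable lebesgue (\<lambda>t. LINT x|lborel. g (t, x))" using i integrable_completion[OF im] by simp
  have ae'': "AE t in lebesgue. (LINT x|lebesgue. f (t, x)) = (LINT x|lborel. g (t, x))"
    using * by (intro AE_completion) auto
  have m'': "(\<lambda>t. LINT x|lebesgue. f (t, x)) \<in> borel_measurable lebesgue"
    by (rule borel_measurable_AE[OF borel_measurable_integrable[OF i']]) (use ae'' in auto)
  show "integrable lebesgue (\<lambda>t. LINT x|lebesgue. f (t, x))"
    using integrable_cong_AE[OF m'' borel_measurable_integrable[OF i'] ae''] i' by simp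
  have "(LINT p|lebesgue. f p) = (LINT p|lebesgue. g p)"
    using f gl ae by (intro integral_cong_AE) auto
  also have "\<dots> = (LINT p|(lborel \<Otimes>\<^sub>M lborel). g p)" using integral_completion[OF g] by (simp add: lborel_prod)
  also have "\<dots> = (LINT t|lborel. LINT x|lborel. g (t, x))"
    using lborel_pair.integral_fst[OF ig] by simp
  also have "\<dots> = (LINT t|lebesgue. LINT x|lborel. g (t, x))"
    using integral_completion[OF im] by simp
  also have "\<dots> = (LINT t|lebesgue. LINT x|lebesgue. f (t, x))"
    by (rule integral_cong_AE[OF borel_measurable_integrable[OF i'] m'']) (use ae'' in auto)
  finally show "(LINT p|lebesgue. f p) = (LINT t|lebesgue. LINT x|lebesgue. f (t, x))" .
qed

text \<open>The positive and the negative part of \<open>w\<close> are the densities of two finite measures. By hypothesis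
  these agree on the half lines, which generate the Borel sets, so the densities agree.\<close>

lemma AE_zero_if_half_line_integrals_zero:
  fixes w :: "real \<Rightarrow> real"
  assumes w: "integrable lebesgue w" and z: "\<And>p. (LINT x|lebesgue. indicator {p<..} x * w x) = 0"
  shows "AE x in lebesgue. w x = 0"
proof -
  obtain g where g[measurable]: "g \<in> borel_measurable lborel" and wg: "AE x in lborel. w x = g x"
    using completion_ex_borel_measurable_real[OF borel_measurable_integrable[OF w]] by blast
  from g have gl: "g \<in> borel_measurable lebesgue" by (rule measurable_completion)
  have ae: "AE x in lebesgue. w x = g x" using wg by (rule AE_completion)
  have "integrable lebesgue g"
    using w gl ae integrable_cong_AE[of w lebesgue g] by auto
  then have ig: "integrable lborel g" using integrable_completion[OF g] by simp
  have zg: "(LINT x|lborel. indicator {p<..} x * g x) = 0" for p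
  proof -
    have "(LINT x|lborel. indicator {p<..} x * g x) = (LINT x|lebesgue. indicator {p<..} x * g x)"
      by (rule integral_completion[symmetric]) measurable
    also have "\<dots> = (LINT x|lebesgue. indicator {p<..} x * w x)"
      using ae w gl
      by (intro integral_cong_AE borel_measurable_times borel_measurable_indicator) auto
    finally show ?thesis using z by simp
  qed
  let ?P = "density lborel (\<lambda>x. ennreal (max 0 (g x)))"
  let ?N = "density lborel (\<lambda>x. ennreal (max 0 (- g x)))"
  have ip: "integrable lborel (\<lambda>x. indicator {p<..} x * max 0 (g x))"
    and im: "integrable lborel (\<lambda>x. indicator {p<..} x * max 0 (- g x))" for p
    by (rule Bochner_Integration.integrable_bound[OF ig]; auto simp: indicator_def)+
  have eP: "emeasure ?P {p<..} = ennreal (LINT x|lborel. indicator {p<..} x * max 0 (g x))"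
    and eN: "emeasure ?N {p<..} = ennreal (LINT x|lborel. indicator {p<..} x * max 0 (- g x))" for p
    by (subst emeasure_density; (simp add: ennreal_mult[symmetric] mult.commute ennreal_indicator[symmetric] nn_integral_eq_integral[symmetric] ip im)?)+
  have "(LINT x|lborel. indicator {p<..} x * max 0 (g x)) = (LINT x|lborel. indicator {p<..} x * max 0 (- g x))" for p
  proof -
    have "(LINT x|lborel. indicator {p<..} x * g x)
      = (LINT x|lborel. indicator {p<..} x * max 0 (g x) - indicator {p<..} x * max 0 (- g x))"
      by (rule Bochner_Integration.integral_cong) (auto simp: indicator_def)
    also have "\<dots> = (LINT x|lborel. indicator {p<..} x * max 0 (g x)) - (LINT x|lborel. indicator {p<..} x * max 0 (- g x))"
      by (rule Bochner_Integration.integral_diff[OF ip im])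
    finally show ?thesis using zg by simp
  qed
  then have "?P = ?N"
    by (intro measure_eqI_lessThan) (auto simp: eP eN)
  then have "AE x in lborel. ennreal (max 0 (g x)) = ennreal (max 0 (- g x))"
    by (intro sigma_finite_measure.density_unique[OF sigma_finite_lborel]) auto
  then have "AE x in lborel. g x = 0"
    by eventually_elim (auto simp: max_def split: if_splits)
  with wg have "AE x in lborel. w x = 0" by eventually_elim simp
  then show ?thesis by (rule AE_completion)
qed

lemma integrable_mult_bounded_lebesgue:
  fixes f g :: "'a::euclidean_space \<Rightarrow> real"
  assumes "integrable lebesgue f" "g \<in> borel_measurable lebesgue" "\<And>x. \<bar>g x\<bar> \<le> C"
  shows "integrable lebesgue (\<lambda>x. f x * g x)"
proof (rule Bochner_Integration.integrable_bound)
  show "integrable lebesgue (\<lambda>x. C * f x)" using assms by simp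
  show "(\<lambda>x. f x * g x) \<in> borel_measurable lebesgue" using assms by measurable
  show "AE x in lebesgue. norm (f x * g x) \<le> norm (C * f x)"
  proof (intro AE_I2)
    fix x
    have "\<bar>g x\<bar> * \<bar>f x\<bar> \<le> \<bar>C\<bar> * \<bar>f x\<bar>" using assms(3)[of x] by (intro mult_right_mono) auto
    then show "norm (f x * g x) \<le> norm (C * f x)" by (simp add: abs_mult mult.commute)
  qed
qed

text \<open>The fundamental lemma of the calculus of variations: plateaus that are bounded by \<open>1\<close> converge
  pointwise to the indicator function of a half line.\<close>

lemma AE_zero_if_orthogonal_test_functions:
  fixes w :: "real \<Rightarrow> real"
  assumes w: "integrable lebesgue w"
    and z: "\<And>\<psi>. \<psi> \<in> test_functions UNIV \<Longrightarrow> (LINT x|lebesgue. w x * \<psi> x) = 0"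
  shows "AE x in lebesgue. w x = 0"
proof (rule AE_zero_if_half_line_integrals_zero[OF w])
  fix p :: real
  define s where "s n x = smooth_step ((x - p) * real n) - smooth_step ((x - (p + real n)) * real n)" for n x
  have s: "s n = plateau p (p + real n) (1 / real n)" for n
    by (auto simp: s_def plateau_def)
  have lim: "(\<lambda>n. w x * s n x) \<longlonglongrightarrow> indicator {p<..} x * w x" for x
  proof -
    have "eventually (\<lambda>n. s n x = indicator {p<..} x) sequentially"
    proof (cases "p < x")
      case True
      obtain N where N: "1 / (x - p) < real N" "x - p < real N"
        by (meson reals_Archimedean2 max_less_iff_conj)
      have "s n x = 1" if "N \<le> n" for n
      proof -
        have n: "1 / (x - p) < real n" "x - p < real n" using N that by linarith+
        then have "1 \<le> (x - p) * real n" using True by (simp add: field_simps)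
        moreover have "(x - (p + real n)) * real n \<le> 0" using n by (intro mult_nonpos_nonneg) auto
        ultimately show ?thesis by (simp add: s_def smooth_step_0 smooth_step_1)
      qed
      then show ?thesis using True by (auto simp: eventually_sequentially)
    next
      case False
      have "s n x = 0" for n
        using False by (simp add: s_def smooth_step_0 mult_nonpos_nonneg)
      then show ?thesis using False by simp
    qed
    then have "(\<lambda>n. s n x) \<longlonglongrightarrow> indicator {p<..} x" by (rule tendsto_eventually)
    from tendsto_mult[OF tendsto_const[of "w x"] this] show ?thesis by (simp add: mult.commute)
  qed
  have r: "\<bar>s n x\<bar> \<le> 1" for n x
    using smooth_step_range[of "(x - p) * real n"] smooth_step_range[of "(x - (p + real n)) * real n"]
    by (simp add: s_def abs_if)
  have sm: "s n \<in> borel_measurable lebesgue" for n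
    unfolding s by (rule borel_measurable_lebesgue_continuous[OF C_k_on_imp_continuous[OF plateau_smooth]])
  have "(\<lambda>n. LINT x|lebesgue. w x * s n x) \<longlonglongrightarrow> (LINT x|lebesgue. indicator {p<..} x * w x)"
  proof (rule integral_dominated_convergence[where w="\<lambda>x. \<bar>w x\<bar>"])
    show "(\<lambda>x. indicator {p<..} x * w x) \<in> borel_measurable lebesgue"
      using w by (intro borel_measurable_times borel_measurable_indicator) auto
    show "(\<lambda>x. w x * s n x) \<in> borel_measurable lebesgue" for n
      using w sm by (intro borel_measurable_times) auto
    show "AE x in lebesgue. norm (w x * s n x) \<le> \<bar>w x\<bar>" for n
      using r[of n] by (intro AE_I2) (simp add: abs_mult mult_left_le)
  qed (use w lim in auto)
  moreover have "(LINT x|lebesgue. w x * s n x) = 0" for n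
  proof (cases n)
    case 0
    then show ?thesis by (simp add: s_def)
  next
    case (Suc m)
    then have "s n \<in> test_functions UNIV" unfolding s by (intro plateau_test_function) auto
    then show ?thesis by (rule z)
  qed
  ultimately show "(LINT x|lebesgue. indicator {p<..} x * w x) = 0"
    by (simp add: LIMSEQ_const_iff)
qed

section \<open>Right-sided mollification\<close>

lemma bump_integral: "(LINT x|lebesgue. bump x) = 1"
proof -
  have c: "continuous_on UNIV bump" by (rule C_k_on_imp_continuous[OF bump_smooth])
  have "(LINT x|lborel. bump x * indicator {0..1} x) = smooth_step 1 - smooth_step 0"
    using c smooth_step_DERIV by (intro integral_FTC_Icc_real) (auto simp: continuous_on_eq_continuous_at)
  moreover have "(\<lambda>x. bump x * indicator {0..1} x) = bump"
  proof
    show "bump x * indicator {0..1} x = bump x" for x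
      using bump_outside[of x] by (cases "x \<in> {0..1}") auto
  qed
  ultimately have "(LINT x|lborel. bump x) = smooth_step 1 - smooth_step 0" by (simp only:)
  then show ?thesis
    using c by (simp add: integral_lebesgue_eq_lborel smooth_step_0 smooth_step_1)
qed

lemma scaled_bump:
  assumes "0 < e"
  shows "(LINT x|lebesgue. bump ((x - s) / e) / e) = 1"
    and "continuous_on UNIV (\<lambda>x. bump ((x - s) / e) / e)"
    and "integrable lebesgue (\<lambda>x. bump ((x - s) / e) / e)"
    and "x \<notin> {s..s + e} \<Longrightarrow> bump ((x - s) / e) / e = 0"
proof -
  have *: "(x - s) / e = - (s / e) + (1 / e) * x" for x using assms by (simp add: field_simps)
  have "(LINT x|lebesgue. bump x) = \<bar>1 / e\<bar> *\<^sub>R (LINT x|lebesgue. bump (- (s / e) + (1 / e) * x))"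
    using assms by (intro lebesgue_integral_real_affine) simp
  then show "(LINT x|lebesgue. bump ((x - s) / e) / e) = 1"
    using assms bump_integral unfolding * by simp
  show c: "continuous_on UNIV (\<lambda>x. bump ((x - s) / e) / e)"
  proof -
    have "continuous_on UNIV (\<lambda>x. (x - s) / e)" using assms by (intro continuous_intros) simp
    from continuous_on_compose2[OF C_k_on_imp_continuous[OF bump_smooth] this]
    show ?thesis using assms by (intro continuous_on_divide continuous_on_const) simp_all
  qed
  show z: "bump ((x - s) / e) / e = 0" if "x \<notin> {s..s + e}" for x
    using assms that bump_outside[of "(x - s) / e"] by (auto simp: field_simps)
  show "integrable lebesgue (\<lambda>x. bump ((x - s) / e) / e)"
    by (rule integrable_lebesgue_compact_support[OF c compact_Icc z])
qed

lemma scaled_bump_mult_integrable: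
  assumes "0 < e" "s + e \<le> t" and gi: "integrable lebesgue (\<lambda>x. indicator {s..t} x * g x)"
  shows "integrable lebesgue (\<lambda>x. bump ((x - s) / e) / e * g x)"
proof -
  note sb = scaled_bump[OF assms(1), where s = s]
  obtain C where C: "\<And>x. \<bar>bump ((x - s) / e) / e\<bar> \<le> C"
    using compact_support_bounded[OF sb(2) compact_Icc, of s "s + e"] sb(4) by blast
  have "integrable lebesgue (\<lambda>x. indicator {s..t} x * g x * (bump ((x - s) / e) / e))"
    by (rule integrable_mult_bounded_lebesgue[OF gi borel_measurable_lebesgue_continuous[OF sb(2)] C])
  moreover have "indicator {s..t} x * g x * (bump ((x - s) / e) / e) = bump ((x - s) / e) / e * g x" for x
    using sb(4)[of x] assms(2) by (cases "x \<in> {s..t}") auto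
  ultimately show ?thesis by (simp only:)
qed

text \<open>The bumps are supported in \<open>[s, s + e]\<close> and have integral \<open>1\<close>, so they average values of \<open>g\<close> to the
  right of \<open>s\<close>.\<close>

lemma right_mollification_tendsto:
  fixes g :: "real \<Rightarrow> real" and e :: "nat \<Rightarrow> real"
  assumes st: "s < t" and gi: "integrable lebesgue (\<lambda>x. indicator {s..t} x * g x)"
    and gr: "(g \<longlongrightarrow> g s) (at_right s)" and e0: "\<And>n. 0 < e n" and e: "e \<longlonglongrightarrow> 0"
  shows "(\<lambda>n. LINT x|lebesgue. bump ((x - s) / e n) / e n * g x) \<longlonglongrightarrow> g s"
proof (rule metric_LIMSEQ_I)
  fix r :: real assume "0 < r"
  then obtain b where b: "s < b" "\<And>x. s < x \<Longrightarrow> x < b \<Longrightarrow> \<bar>g x - g s\<bar> < r / 2"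
    using tendstoD[OF gr, of "r / 2"] unfolding eventually_at_right_field dist_real_def by auto
  define d where "d = min (b - s) (t - s)"
  have "0 < d" using b st by (simp add: d_def)
  then obtain N where N: "\<And>n. N \<le> n \<Longrightarrow> e n < d"
    using order_tendstoD(2)[OF e] by (auto simp: eventually_sequentially)
  show "\<exists>N. \<forall>n\<ge>N. dist (LINT x|lebesgue. bump ((x - s) / e n) / e n * g x) (g s) < r"
  proof (intro exI[of _ N] allI impI)
    fix n assume "N \<le> n"
    define \<beta> where "\<beta> x = bump ((x - s) / e n) / e n" for x
    note sb = scaled_bump[OF e0[of n], where s = s, folded \<beta>_def]
    have en: "e n < d" using N[OF \<open>N \<le> n\<close>] .
    have sup: "{s..s + e n} \<subseteq> {s..t}" "{s..s + e n} \<subseteq> {s..<b}" using en by (auto simp: d_def)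
    have ig: "integrable lebesgue (\<lambda>x. \<beta> x * g x)"
      unfolding \<beta>_def using en by (intro scaled_bump_mult_integrable[OF e0 _ gi]) (simp add: d_def)
    have "\<bar>(LINT x|lebesgue. \<beta> x * g x) - g s\<bar> = \<bar>(LINT x|lebesgue. \<beta> x * g x) - (LINT x|lebesgue. \<beta> x * g s)\<bar>"
      using sb(1) by simp
    also have "\<dots> = \<bar>LINT x|lebesgue. \<beta> x * g x - \<beta> x * g s\<bar>"
      using ig sb(3) by (subst Bochner_Integration.integral_diff) auto
    also have "\<dots> \<le> (LINT x|lebesgue. \<bar>\<beta> x * g x - \<beta> x * g s\<bar>)"
      by (rule integral_abs_bound)
    also have "\<dots> \<le> (LINT x|lebesgue. \<beta> x * (r / 2))"
    proof (rule integral_mono)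
      fix x
      have \<beta>0: "0 \<le> \<beta> x" using bump_nonneg e0[of n] by (simp add: \<beta>_def)
      have "\<bar>g x - g s\<bar> \<le> r / 2" if "\<beta> x \<noteq> 0"
        using sb(4)[of x] that sup(2) b(2)[of x] \<open>0 < r\<close> by (cases "x = s") force+
      then have "\<beta> x * \<bar>g x - g s\<bar> \<le> \<beta> x * (r / 2)"
        using \<beta>0 by (cases "\<beta> x = 0") (auto intro: mult_left_mono)
      moreover have "\<bar>\<beta> x * g x - \<beta> x * g s\<bar> = \<beta> x * \<bar>g x - g s\<bar>"
        using \<beta>0 by (simp add: abs_mult flip: right_diff_distrib)
      ultimately show "\<bar>\<beta> x * g x - \<beta> x * g s\<bar> \<le> \<beta> x * (r / 2)" by simp
    qed (use ig sb(3) in auto)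
    also have "\<dots> = r / 2" using sb(1) by simp
    finally show "dist (LINT x|lebesgue. bump ((x - s) / e n) / e n * g x) (g s) < r"
      using \<open>0 < r\<close> by (simp add: dist_real_def \<beta>_def)
  qed
qed

section \<open>Weak form of the transport equation\<close>

text \<open>Kruzkov solutions for a speed that depends on time only. The speed is a given function here, so
  that the results apply to the nonlinear equation once a solution, and thereby its speed, has been
  fixed.\<close>

locale kruzkov_transport =
  fixes T' :: real and a :: "real \<Rightarrow> real" and u0 :: "real \<Rightarrow> real" and u :: "real \<Rightarrow> real \<Rightarrow> real"
    and M L :: real
  assumes kruzkov: "kruzkov_solution T' (\<lambda>t x. a t) (\<lambda>t x. 0) u0 u"
    and u_bound: "\<And>t x. t \<in> {0..<T'} \<Longrightarrow> \<bar>u t x\<bar> \<le> M"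
    and u_L1: "\<And>t. t \<in> {0..<T'} \<Longrightarrow> (LINT x|lebesgue. \<bar>u t x\<bar>) \<le> L"
    and M_nonneg: "0 \<le> M" and L_nonneg: "0 \<le> L"
begin

definition pairing :: "(real \<Rightarrow> real) \<Rightarrow> real \<Rightarrow> real" where
  "pairing \<psi> t = (LINT x|lebesgue. u t x * \<psi> x)"

text \<open>The curried solution as a measurable function on the whole plane, for use with Fubini.\<close>

definition u_ext :: "real \<times> real \<Rightarrow> real" where
  "u_ext p = indicator ({0..<T'} \<times> UNIV) p * u (fst p) (snd p)"

lemma u_integrable: "t \<in> {0..<T'} \<Longrightarrow> integrable lebesgue (u t)"
  using kruzkov unfolding kruzkov_solution_def by blast

lemma u_right_continuous:
  "t \<in> {0..<T'} \<Longrightarrow> ((\<lambda>s. LINT x|lebesgue. \<bar>u s x - u t x\<bar>) \<longlongrightarrow> 0) (at_right t)"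
  using kruzkov unfolding kruzkov_solution_def by blast

lemma u_ext_measurable: "u_ext \<in> borel_measurable lebesgue"
proof -
  have s: "{0..<T'} \<times> (UNIV :: real set) \<in> sets lebesgue"
    by (intro sets_completionI_sets) (auto simp: borel_Times)
  have "(\<lambda>(t, x). u t x) \<in> borel_measurable (lebesgue_on ({0..<T'} \<times> UNIV))"
    using kruzkov unfolding kruzkov_solution_def by blast
  then have "(\<lambda>p. indicator ({0..<T'} \<times> UNIV) p *\<^sub>R (case p of (t, x) \<Rightarrow> u t x)) \<in> borel_measurable lebesgue"
    using s by (subst (asm) borel_measurable_restrict_space_iff) auto
  then show ?thesis by (simp add: u_ext_def[abs_def] case_prod_beta)
qed

lemma u_ext_bound: "\<bar>u_ext p\<bar> \<le> M"
  using u_bound M_nonneg by (cases "p \<in> {0..<T'} \<times> UNIV") (auto simp: u_ext_def)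

lemma u_mult_integrable:
  assumes "t \<in> {0..<T'}" "\<psi> \<in> borel_measurable lebesgue" "\<And>x. \<bar>\<psi> x\<bar> \<le> C"
  shows "integrable lebesgue (\<lambda>x. u t x * \<psi> x)"
  using integrable_mult_bounded_lebesgue[OF u_integrable[OF assms(1)] assms(2,3)] .

lemma u_mult_test_integrable:
  assumes "t \<in> {0..<T'}" "\<psi> \<in> test_functions \<Omega>"
  shows "integrable lebesgue (\<lambda>x. u t x * \<psi> x)"
  using test_function_bounded[OF assms(2)] u_mult_integrable[OF assms(1)]
    borel_measurable_lebesgue_continuous[OF test_function_continuous[OF assms(2)]] by metis

lemma u_mult_bound:
  assumes t: "t \<in> {0..<T'}" and m: "\<psi> \<in> borel_measurable lebesgue" and C: "\<And>x. \<bar>\<psi> x\<bar> \<le> C"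
  shows "\<bar>LINT x|lebesgue. u t x * \<psi> x\<bar> \<le> L * C"
proof -
  have C0: "0 \<le> C" using C[of 0] by linarith
  have "\<bar>LINT x|lebesgue. u t x * \<psi> x\<bar> \<le> (LINT x|lebesgue. \<bar>u t x * \<psi> x\<bar>)"
    by (rule integral_abs_bound)
  also have "\<dots> \<le> (LINT x|lebesgue. \<bar>u t x\<bar> * C)"
  proof (rule integral_mono)
    show "integrable lebesgue (\<lambda>x. \<bar>u t x * \<psi> x\<bar>)" using u_mult_integrable[OF t m C] by (rule integrable_abs)
    show "integrable lebesgue (\<lambda>x. \<bar>u t x\<bar> * C)" using u_integrable[OF t] by simp
  qed (simp add: abs_mult mult_left_mono C)
  also have "\<dots> \<le> L * C" using u_L1[OF t] C0 by (simp add: mult_right_mono)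
  finally show ?thesis .
qed

lemma pairing_bound:
  assumes "t \<in> {0..<T'}" "\<psi> \<in> test_functions \<Omega>" "\<And>x. \<bar>\<psi> x\<bar> \<le> C"
  shows "\<bar>pairing \<psi> t\<bar> \<le> L * C"
  unfolding pairing_def
  using u_mult_bound assms borel_measurable_lebesgue_continuous test_function_continuous by blast

lemma pairing_right_continuous:
  assumes t: "t \<in> {0..<T'}" and \<psi>: "\<psi> \<in> test_functions \<Omega>"
  shows "(pairing \<psi> \<longlongrightarrow> pairing \<psi> t) (at_right t)"
proof -
  obtain C where C: "\<And>x. \<bar>\<psi> x\<bar> \<le> C" using test_function_bounded[OF \<psi>] by metis
  have "((\<lambda>s. pairing \<psi> s - pairing \<psi> t) \<longlongrightarrow> 0) (at_right t)"
  proof (rule Lim_null_comparison)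
    show "((\<lambda>s. (LINT x|lebesgue. \<bar>u s x - u t x\<bar>) * C) \<longlongrightarrow> 0) (at_right t)"
      using tendsto_mult_right[OF u_right_continuous[OF t], of C] by simp
    have "\<forall>\<^sub>F s in at_right t. s \<in> {t<..<T'}"
      using t by (auto simp: eventually_at_right_field intro!: exI[of _ T'])
    then show "\<forall>\<^sub>F s in at_right t. norm (pairing \<psi> s - pairing \<psi> t) \<le> (LINT x|lebesgue. \<bar>u s x - u t x\<bar>) * C"
    proof eventually_elim
      case (elim s)
      then have s: "s \<in> {0..<T'}" using t by auto
      note i = u_mult_test_integrable[OF s \<psi>] u_mult_test_integrable[OF t \<psi>]
      have "pairing \<psi> s - pairing \<psi> t = (LINT x|lebesgue. u s x * \<psi> x - u t x * \<psi> x)"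
        unfolding pairing_def by (rule Bochner_Integration.integral_diff[OF i, symmetric])
      also have "\<bar>\<dots>\<bar> \<le> (LINT x|lebesgue. \<bar>u s x * \<psi> x - u t x * \<psi> x\<bar>)"
        by (rule integral_abs_bound)
      also have "\<dots> \<le> (LINT x|lebesgue. \<bar>u s x - u t x\<bar> * C)"
      proof (rule integral_mono)
        show "integrable lebesgue (\<lambda>x. \<bar>u s x * \<psi> x - u t x * \<psi> x\<bar>)"
          using i by (intro integrable_abs Bochner_Integration.integrable_diff)
        show "integrable lebesgue (\<lambda>x. \<bar>u s x - u t x\<bar> * C)"
          using u_integrable[OF s] u_integrable[OF t] by simp
        show "\<bar>u s x * \<psi> x - u t x * \<psi> x\<bar> \<le> \<bar>u s x - u t x\<bar> * C" for x
          using C[of x] by (simp add: abs_mult mult_left_mono flip: left_diff_distrib)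
      qed
      finally show ?case by simp
    qed
  qed
  then show ?thesis by (simp add: LIM_zero_iff)
qed

lemma entropy_inequality:
  obtains D where "weak_derivative_on ({0<..<T'} \<times> UNIV) (0, 1) (\<lambda>(t, x). k * a t) D"
    "\<And>\<phi>. \<phi> \<in> test_functions ({0<..<T'} \<times> UNIV) \<Longrightarrow> (\<forall>p. 0 \<le> \<phi> p) \<Longrightarrow>
       0 \<le> (LINT p:({0<..<T'} \<times> UNIV)|lebesgue.
              ((u (fst p) (snd p) - k) * frechet_derivative \<phi> (at p) (1, 0)
               + (u (fst p) (snd p) - k) * a (fst p) * frechet_derivative \<phi> (at p) (0, 1)
               - D p * \<phi> p) * sgn (u (fst p) (snd p) - k))"
proof -
  from kruzkov obtain D where
    D: "weak_derivative_on ({0<..<T'} \<times> UNIV) (0, 1) (\<lambda>(t, x). k * a t + 0) D"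
    "\<And>\<phi>. \<phi> \<in> test_functions ({0<..<T'} \<times> UNIV) \<Longrightarrow> (\<forall>p. 0 \<le> \<phi> p) \<Longrightarrow>
       0 \<le> (LINT (t, x):({0<..<T'} \<times> UNIV)|lebesgue.
                  ((u t x - k) * frechet_derivative \<phi> (at (t, x)) (1, 0)
                   + (u t x - k) * a t * frechet_derivative \<phi> (at (t, x)) (0, 1)
                   - D (t, x) * \<phi> (t, x)) * sgn (u t x - k))"
    unfolding kruzkov_solution_def by blast
  show thesis
    by (rule that[of D]) (use D in \<open>simp_all add: case_prod_beta' del: split_paired_All\<close>)
qed

text \<open>The entropy condition with \<open>k = 1\<close> contains the local integrability of the speed. At this stage
  nothing else is known about \<open>a\<close>.\<close>

lemma speed_integrable_prod:
  assumes "compact C" "C \<subseteq> {0<..<T'} \<times> (UNIV :: real set)"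
  shows "integrable lebesgue (\<lambda>p. indicator C p * a (fst p))"
proof -
  obtain D where "weak_derivative_on ({0<..<T'} \<times> UNIV) (0, 1) (\<lambda>(t, x::real). 1 * a t) D"
    using entropy_inequality[of 1] by blast
  then have "set_integrable lebesgue C (\<lambda>(t, x::real). 1 * a t)"
    using assms unfolding weak_derivative_on_def locally_integrable_on_def by blast
  then show ?thesis by (simp add: set_integrable_def case_prod_beta')
qed

lemma speed_pairing_integrable_prod:
  assumes "compact K" "K \<subseteq> {0<..<T'}" "\<psi> \<in> test_functions UNIV" "\<eta> \<in> test_functions UNIV"
  shows "integrable lebesgue (\<lambda>p. indicator K (fst p) * a (fst p) * \<eta> (fst p) * (u_ext p * \<psi> (snd p)))"
proof -
  obtain R where R: "0 < R" "\<And>x. R < \<bar>x\<bar> \<Longrightarrow> \<psi> x = 0" using test_function_interval[OF assms(3)] by blast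
  obtain C where C: "\<And>x. \<bar>\<psi> x\<bar> \<le> C" using test_function_bounded[OF assms(3)] by metis
  obtain E where E: "\<And>x. \<bar>\<eta> x\<bar> \<le> E" using test_function_bounded[OF assms(4)] by metis
  have m: "(\<lambda>p. \<eta> (fst p) * (u_ext p * \<psi> (snd p))) \<in> borel_measurable lebesgue"
    by (intro borel_measurable_times u_ext_measurable borel_measurable_lebesgue_continuous
        continuous_on_compose2[OF test_function_continuous[OF assms(3)]]
        continuous_on_compose2[OF test_function_continuous[OF assms(4)]] continuous_intros) auto
  have b: "\<bar>\<eta> (fst p) * (u_ext p * \<psi> (snd p))\<bar> \<le> E * (M * C)" for p
    unfolding abs_mult using C E u_ext_bound[of p] M_nonneg
    by (intro mult_mono) (auto intro: order_trans[OF abs_ge_zero])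
  have "integrable lebesgue (\<lambda>p. indicator (K \<times> {-R..R}) p * a (fst p) * (\<eta> (fst p) * (u_ext p * \<psi> (snd p))))"
    using assms by (intro integrable_mult_bounded_lebesgue[OF _ m b] speed_integrable_prod compact_Times) auto
  moreover have "indicator (K \<times> {-R..R}) p * a (fst p) * (\<eta> (fst p) * (u_ext p * \<psi> (snd p)))
      = indicator K (fst p) * a (fst p) * \<eta> (fst p) * (u_ext p * \<psi> (snd p))" for p
    using R(2)[of "snd p"] by (cases "\<bar>snd p\<bar> \<le> R") (auto simp: indicator_def mem_Times_iff)
  ultimately show ?thesis by simp
qed

lemma u_ext_slice_integral:
  "t \<in> {0..<T'} \<Longrightarrow> (LINT x|lebesgue. u_ext (t, x) * \<psi> x) = pairing \<psi> t"
  by (simp add: u_ext_def pairing_def)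

lemma speed_pairing_integrable:
  assumes "0 < s" "t < T'" "\<psi> \<in> test_functions UNIV"
  shows "integrable lebesgue (\<lambda>\<tau>. indicator {s..t} \<tau> * (a \<tau> * pairing \<psi> \<tau>))"
proof -
  define \<xi> where "\<xi> = plateau (s - 1) (max s t) 1"
  have \<xi>: "\<xi> \<in> test_functions UNIV" unfolding \<xi>_def by (intro plateau_test_function) auto
  have 1: "\<xi> x = 1" if "x \<in> {s..t}" for x using that unfolding \<xi>_def by (intro plateau_inside) auto
  from lebesgue_Fubini(2)[OF speed_pairing_integrable_prod[of "{s..t}", OF _ _ assms(3) \<xi>]] assms
  have "integrable lebesgue (\<lambda>\<tau>. indicator {s..t} \<tau> * a \<tau> * \<xi> \<tau> * (LINT x|lebesgue. u_ext (\<tau>, x) * \<psi> x))"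
    by (simp add: subset_iff)
  moreover have "indicator {s..t} \<tau> * a \<tau> * \<xi> \<tau> * (LINT x|lebesgue. u_ext (\<tau>, x) * \<psi> x)
      = indicator {s..t} \<tau> * (a \<tau> * pairing \<psi> \<tau>)" for \<tau>
    using 1[of \<tau>] u_ext_slice_integral[of \<tau> \<psi>] assms by (cases "\<tau> \<in> {s..t}") auto
  ultimately show ?thesis by simp
qed

lemma u_ext_tensor_integrable:
  assumes "\<psi> \<in> test_functions UNIV" "\<eta> \<in> test_functions UNIV"
  shows "integrable lebesgue (\<lambda>p. \<eta> (fst p) * \<psi> (snd p) * u_ext p)"
  by (rule integrable_mult_bounded_lebesgue[OF _ u_ext_measurable u_ext_bound])
    (rule test_function_integrable[OF test_function_tensor[OF assms(2,1)]])

lemma pairing_integrable: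
  assumes "0 < s" "t < T'" "\<psi> \<in> test_functions UNIV"
  shows "integrable lebesgue (\<lambda>\<tau>. indicator {s..t} \<tau> * pairing \<psi> \<tau>)"
proof -
  define \<xi> where "\<xi> = plateau (s - 1) (max s t) 1"
  have \<xi>: "\<xi> \<in> test_functions UNIV" unfolding \<xi>_def by (intro plateau_test_function) auto
  have 1: "\<xi> x = 1" if "x \<in> {s..t}" for x using that unfolding \<xi>_def by (intro plateau_inside) auto
  from lebesgue_Fubini(2)[OF u_ext_tensor_integrable[OF assms(3) \<xi>]]
  have "integrable lebesgue (\<lambda>\<tau>. \<xi> \<tau> * (LINT x|lebesgue. u_ext (\<tau>, x) * \<psi> x))"
    by (simp add: mult.assoc mult.commute[of "u_ext _"])
  then have "integrable lebesgue (\<lambda>\<tau>. \<xi> \<tau> * (LINT x|lebesgue. u_ext (\<tau>, x) * \<psi> x) * indicator {s..t} \<tau>)"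
  proof (rule integrable_mult_bounded_lebesgue)
    show "(indicator {s..t} :: real \<Rightarrow> real) \<in> borel_measurable lebesgue" by (rule borel_measurable_indicator) simp
    show "\<bar>indicator {s..t} \<tau> :: real\<bar> \<le> 1" for \<tau> by (simp add: indicator_def)
  qed
  moreover have "\<xi> \<tau> * (LINT x|lebesgue. u_ext (\<tau>, x) * \<psi> x) * indicator {s..t} \<tau> = indicator {s..t} \<tau> * pairing \<psi> \<tau>" for \<tau>
    using 1[of \<tau>] u_ext_slice_integral[of \<tau> \<psi>] assms by (cases "\<tau> \<in> {s..t}") auto
  ultimately show ?thesis by simp
qed

text \<open>For \<open>\<bar>k\<bar> > M\<close> the sign of \<open>u - k\<close> is constant, so the entropy inequality is linear in \<open>u\<close>. The
  contributions of the constant \<open>k\<close> and of \<open>D = \<partial>\<^sub>x (k a)\<close> cancel after integration, and the two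
  choices \<open>k = M + 1\<close> and \<open>k = -(M + 1)\<close> give opposite inequalities, hence equality.\<close>

lemma weak_form_tensor:
  assumes \<eta>: "\<eta> \<in> test_functions {0<..<T'}" "\<And>t. 0 \<le> \<eta> t"
    and \<psi>: "\<psi> \<in> test_functions UNIV" "\<And>x. 0 \<le> \<psi> x"
  shows "(LINT t|lebesgue. deriv \<eta> t * pairing \<psi> t) + (LINT t|lebesgue. \<eta> t * (a t * pairing (deriv \<psi>) t)) = 0"
proof -
  define \<Omega> where "\<Omega> = {0<..<T'} \<times> (UNIV :: real set)"
  define \<phi> where "\<phi> p = \<eta> (fst p) * \<psi> (snd p)" for p
  have \<phi>: "\<phi> \<in> test_functions \<Omega>" unfolding \<phi>_def[abs_def] \<Omega>_def by (rule test_function_tensor[OF \<eta>(1) \<psi>(1)])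
  have \<phi>0: "\<forall>p. 0 \<le> \<phi> p" using \<eta> \<psi> by (simp add: \<phi>_def)
  have \<phi>t: "frechet_derivative \<phi> (at p) (1, 0) = deriv \<eta> (fst p) * \<psi> (snd p)"
    and \<phi>x: "frechet_derivative \<phi> (at p) (0, 1) = \<eta> (fst p) * deriv \<psi> (snd p)" for p
    using frechet_derivative_tensor[OF \<eta>(1) \<psi>(1), of "fst p" "snd p"] by (simp_all add: \<phi>_def[abs_def])
  note \<eta>' = test_function_deriv[OF \<eta>(1)] and \<psi>' = test_function_deriv[OF \<psi>(1)]
  note u_ext\<eta> = test_function_mono[OF \<eta>(1) subset_UNIV] and u_ext\<eta>' = test_function_mono[OF \<eta>' subset_UNIV]
  obtain K where K: "compact K" "K \<subseteq> {0<..<T'}" "\<And>x. x \<notin> K \<Longrightarrow> \<eta> x = 0" "\<And>x. x \<notin> K \<Longrightarrow> deriv \<eta> x = 0"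
  proof -
    obtain A B where "compact A" "A \<subseteq> {0<..<T'}" "\<And>x. x \<notin> A \<Longrightarrow> \<eta> x = 0"
      "compact B" "B \<subseteq> {0<..<T'}" "\<And>x. x \<notin> B \<Longrightarrow> deriv \<eta> x = 0"
      using test_function_support[OF \<eta>(1)] test_function_support[OF \<eta>'] by metis
    then show thesis using that[of "A \<union> B"] by (auto simp: compact_Un)
  qed
  obtain R where R: "0 < R" "\<And>x. R < \<bar>x\<bar> \<Longrightarrow> \<psi> x = 0" "\<And>x. R < \<bar>x\<bar> \<Longrightarrow> deriv \<psi> x = 0"
  proof -
    obtain A B where "0 < A" "\<And>x. A < \<bar>x\<bar> \<Longrightarrow> \<psi> x = 0" "0 < B" "\<And>x. B < \<bar>x\<bar> \<Longrightarrow> deriv \<psi> x = 0"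
      using test_function_interval[OF \<psi>(1)] test_function_interval[OF \<psi>'] by metis
    then show thesis using that[of "max A B"] by auto
  qed
  define C where "C = K \<times> {-R..R}"
  have C: "compact C" "C \<subseteq> \<Omega>" using K by (auto simp: C_def \<Omega>_def intro: compact_Times)
  have \<phi>C: "\<phi> p = 0" "\<eta> (fst p) * deriv \<psi> (snd p) = 0" "deriv \<eta> (fst p) * \<psi> (snd p) = 0" if "p \<notin> C" for p
  proof -
    from that have "fst p \<notin> K \<or> R < \<bar>snd p\<bar>" by (cases p) (auto simp: C_def)
    then show "\<phi> p = 0" "\<eta> (fst p) * deriv \<psi> (snd p) = 0" "deriv \<eta> (fst p) * \<psi> (snd p) = 0"
      using K(3,4) R(2,3) by (auto simp: \<phi>_def)
  qed
  define f1 where "f1 p = deriv \<eta> (fst p) * \<psi> (snd p) * u_ext p" for p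
  define f2 where "f2 p = indicator K (fst p) * a (fst p) * \<eta> (fst p) * (u_ext p * deriv \<psi> (snd p))" for p
  define f3 where "f3 p = deriv \<eta> (fst p) * \<psi> (snd p)" for p
  have f1: "integrable lebesgue f1" unfolding f1_def[abs_def] by (rule u_ext_tensor_integrable[OF \<psi>(1) u_ext\<eta>'])
  have f2: "integrable lebesgue f2" unfolding f2_def[abs_def] by (rule speed_pairing_integrable_prod[OF K(1,2) \<psi>' u_ext\<eta>])
  have f3: "integrable lebesgue f3" unfolding f3_def[abs_def]
    by (rule test_function_integrable[OF test_function_tensor[OF \<eta>' \<psi>(1)]])
  have f3_0: "(LINT p|lebesgue. f3 p) = 0"
  proof -
    obtain R' where R': "\<And>x. R' < \<bar>x\<bar> \<Longrightarrow> \<eta> x = 0" using test_function_interval[OF u_ext\<eta>] by metis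
    have "(LINT t|lebesgue. deriv \<eta> t) = (LINT t|lborel. deriv \<eta> t)"
      by (rule integral_lebesgue_eq_lborel[OF test_function_continuous[OF \<eta>']])
    also have "\<dots> = 0"
      by (rule integral_deriv_compact_support[OF test_function_DERIV[OF \<eta>(1)] test_function_continuous[OF \<eta>'] R'])
    finally show ?thesis using lebesgue_Fubini(3)[OF f3] by (simp add: f3_def)
  qed
  have key: "0 \<le> - sgn k * ((LINT p|lebesgue. f1 p) + (LINT p|lebesgue. f2 p))" if k: "M < \<bar>k\<bar>" for k
  proof -
    let ?e = "\<lambda>D \<phi> p. ((u (fst p) (snd p) - k) * frechet_derivative \<phi> (at p) (1, 0)
      + (u (fst p) (snd p) - k) * a (fst p) * frechet_derivative \<phi> (at p) (0, 1)
      - D p * \<phi> p) * sgn (u (fst p) (snd p) - k)"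
    obtain D where D: "weak_derivative_on \<Omega> (0, 1) (\<lambda>(t, x). k * a t) D"
      and ent: "0 \<le> (LINT p:\<Omega>|lebesgue.
              ?e D \<phi> p)"
    proof (rule entropy_inequality[of k, folded \<Omega>_def])
      fix D assume 1: "weak_derivative_on \<Omega> (0, 1) (\<lambda>(t, x). k * a t) D"
        and 2: "\<And>\<phi>. \<phi> \<in> test_functions \<Omega> \<Longrightarrow> \<forall>p. 0 \<le> \<phi> p \<Longrightarrow> 0 \<le> (LINT p:\<Omega>|lebesgue.
              ?e D \<phi> p)"
      show thesis by (rule that[OF 1 2[OF \<phi> \<phi>0]])
    qed
    define f4 where "f4 p = indicator C p * a (fst p) * (\<eta> (fst p) * deriv \<psi> (snd p))" for p
    define f5 where "f5 p = indicator C p * D p * \<phi> p" for p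
    obtain E where E: "\<And>p. \<bar>\<phi> p\<bar> \<le> E" using test_function_bounded[OF \<phi>] by metis
    have \<phi>': "(\<lambda>p. \<eta> (fst p) * deriv \<psi> (snd p)) \<in> test_functions \<Omega>"
      unfolding \<Omega>_def by (rule test_function_tensor[OF \<eta>(1) \<psi>'])
    obtain E' where E': "\<And>p. \<bar>\<eta> (fst p) * deriv \<psi> (snd p)\<bar> \<le> E'" using test_function_bounded[OF \<phi>'] by metis
    have f4: "integrable lebesgue f4" unfolding f4_def[abs_def]
      using C by (intro integrable_mult_bounded_lebesgue[OF _ _ E'] speed_integrable_prod
          borel_measurable_lebesgue_continuous test_function_continuous[OF \<phi>']) (auto simp: \<Omega>_def)
    have "set_integrable lebesgue C D"
      using D C unfolding weak_derivative_on_def locally_integrable_on_def by blast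
    then have f5: "integrable lebesgue f5" unfolding f5_def[abs_def]
      by (intro integrable_mult_bounded_lebesgue[OF _ _ E] borel_measurable_lebesgue_continuous
          test_function_continuous[OF \<phi>]) (simp add: set_integrable_def)
    have "(LINT p:\<Omega>|lebesgue. (case p of (t, x) \<Rightarrow> k * a t) * frechet_derivative \<phi> (at p) (0, 1))
        = - (LINT p:\<Omega>|lebesgue. D p * \<phi> p)"
      using D \<phi> unfolding weak_derivative_on_def by blast
    moreover have "(LINT p:\<Omega>|lebesgue. (case p of (t, x) \<Rightarrow> k * a t) * frechet_derivative \<phi> (at p) (0, 1))
        = (LINT p|lebesgue. k * f4 p)"
      unfolding set_lebesgue_integral_def
    proof (rule Bochner_Integration.integral_cong[OF refl])
      fix p :: "real \<times> real"
      show "indicator \<Omega> p *\<^sub>R ((case p of (t, x) \<Rightarrow> k * a t) * frechet_derivative \<phi> (at p) (0, 1)) = k * f4 p"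
        using \<phi>C(2)[of p] C(2) by (cases "p \<in> C") (auto simp: f4_def \<phi>x indicator_def split: prod.splits)
    qed
    moreover have "(LINT p:\<Omega>|lebesgue. D p * \<phi> p) = (LINT p|lebesgue. f5 p)"
      unfolding set_lebesgue_integral_def
    proof (rule Bochner_Integration.integral_cong[OF refl])
      fix p :: "real \<times> real"
      show "indicator \<Omega> p *\<^sub>R (D p * \<phi> p) = f5 p"
        using \<phi>C(1)[of p] C(2) by (cases "p \<in> C") (auto simp: f5_def indicator_def)
    qed
    ultimately have f45: "k * (LINT p|lebesgue. f4 p) + (LINT p|lebesgue. f5 p) = 0" by simp
    have "(LINT p:\<Omega>|lebesgue. ?e D \<phi> p)
       = (LINT p|lebesgue. - sgn k * (f1 p + f2 p - k * f3 p - k * f4 p - f5 p))"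
      unfolding set_lebesgue_integral_def
    proof (rule Bochner_Integration.integral_cong[OF refl])
      fix p :: "real \<times> real"
      show "indicator \<Omega> p *\<^sub>R (?e D \<phi> p)
          = - sgn k * (f1 p + f2 p - k * f3 p - k * f4 p - f5 p)"
      proof (cases "p \<in> C")
        case True
        then have p: "p \<in> \<Omega>" "fst p \<in> K" "fst p \<in> {0..<T'}" "p \<in> {0..<T'} \<times> UNIV"
          using C(2) by (auto simp: C_def \<Omega>_def)
        have "sgn (u (fst p) (snd p) - k) = - sgn k"
          using u_bound[OF p(3), of "snd p"] k by (auto simp: sgn_if)
        then show ?thesis using p True
          by (simp add: f1_def f2_def f3_def f4_def f5_def \<phi>t \<phi>x u_ext_def) (simp add: algebra_simps)
      next
        case False
        note z = \<phi>C[OF False]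
        have "f2 p = 0" using z(2) by (auto simp: f2_def)
        then show ?thesis using z False
          by (auto simp: f1_def f3_def f4_def f5_def \<phi>t \<phi>x)
      qed
    qed
    also have "\<dots> = - sgn k * ((LINT p|lebesgue. f1 p) + (LINT p|lebesgue. f2 p) - k * (LINT p|lebesgue. f3 p)
        - k * (LINT p|lebesgue. f4 p) - (LINT p|lebesgue. f5 p))"
      using f1 f2 f3 f4 f5 by simp
    also have "\<dots> = - sgn k * ((LINT p|lebesgue. f1 p) + (LINT p|lebesgue. f2 p))"
      using f3_0 f45 by (simp add: algebra_simps)
    finally show ?thesis using ent by simp
  qed
  have "(LINT p|lebesgue. f1 p) + (LINT p|lebesgue. f2 p) = 0"
    using key[of "M + 1"] key[of "- (M + 1)"] M_nonneg by (simp add: sgn_if split: if_splits)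
  moreover have "(LINT p|lebesgue. f1 p) = (LINT t|lebesgue. deriv \<eta> t * pairing \<psi> t)"
  proof -
    have "(LINT x|lebesgue. f1 (t, x)) = deriv \<eta> t * pairing \<psi> t" for t
    proof (cases "t \<in> K")
      case True
      then have t: "t \<in> {0..<T'}" using K(2) by auto
      have "(LINT x|lebesgue. f1 (t, x)) = (LINT x|lebesgue. deriv \<eta> t * (u_ext (t, x) * \<psi> x))"
        by (simp add: f1_def mult_ac)
      then show ?thesis using u_ext_slice_integral[OF t] by simp
    qed (simp add: f1_def K(4))
    then show ?thesis using lebesgue_Fubini(3)[OF f1] by simp
  qed
  moreover have "(LINT p|lebesgue. f2 p) = (LINT t|lebesgue. \<eta> t * (a t * pairing (deriv \<psi>) t))"
  proof -
    have "(LINT x|lebesgue. f2 (t, x)) = \<eta> t * (a t * pairing (deriv \<psi>) t)" for t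
    proof (cases "t \<in> K")
      case True
      then have t: "t \<in> {0..<T'}" using K(2) by auto
      show ?thesis using u_ext_slice_integral[OF t] True by (simp add: f2_def)
    qed (simp add: f2_def K(3))
    then show ?thesis using lebesgue_Fubini(3)[OF f2] by simp
  qed
  ultimately show ?thesis by simp
qed

end

text \<open>This replaces the chain rule along a characteristic: to differentiate a pairing with a moving test
  function it is enough to control increments up to second order.\<close>

lemma constant_if_quadratic_modulus:
  fixes H :: "real \<Rightarrow> real"
  assumes S: "convex S" and q: "\<And>s t. s \<in> S \<Longrightarrow> t \<in> S \<Longrightarrow> s \<le> t \<Longrightarrow> \<bar>H t - H s\<bar> \<le> K * (t - s)\<^sup>2"
    and st: "s \<in> S" "t \<in> S"
  shows "H s = H t"
proof -
  have q': "\<bar>H y - H x\<bar> \<le> \<bar>K\<bar> * (y - x)\<^sup>2" if "x \<in> S" "y \<in> S" for x y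
  proof -
    have "\<bar>H y - H x\<bar> \<le> K * (y - x)\<^sup>2"
      using q[of x y] q[of y x] that by (cases "x \<le> y") (auto simp: abs_minus_commute power2_commute)
    also have "\<dots> \<le> \<bar>K\<bar> * (y - x)\<^sup>2" by (intro mult_right_mono) auto
    finally show ?thesis .
  qed
  have sq: "z\<^sup>2 = \<bar>z\<bar> * \<bar>z\<bar>" for z :: real by (simp add: power2_eq_square)
  have "(H has_field_derivative 0) (at x within S)" if x: "x \<in> S" for x
    unfolding has_field_derivative_iff
  proof (rule Lim_null_comparison)
    show "\<forall>\<^sub>F y in at x within S. norm ((H y - H x) / (y - x)) \<le> \<bar>K\<bar> * \<bar>y - x\<bar>"
      unfolding eventually_at_filter
    proof (intro always_eventually allI impI)
      fix y assume "y \<noteq> x" "y \<in> S"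
      then show "norm ((H y - H x) / (y - x)) \<le> \<bar>K\<bar> * \<bar>y - x\<bar>"
        using q'[OF x \<open>y \<in> S\<close>] unfolding sq[of "y - x"] by (simp add: abs_divide pos_divide_le_eq mult.assoc)
    qed
    have "((\<lambda>y. \<bar>K\<bar> * \<bar>y - x\<bar>) \<longlongrightarrow> \<bar>K\<bar> * \<bar>x - x\<bar>) (at x within S)" by (intro tendsto_intros)
    then show "((\<lambda>y. \<bar>K\<bar> * \<bar>y - x\<bar>) \<longlongrightarrow> 0) (at x within S)" by simp
  qed
  then have "\<exists>c. \<forall>x\<in>S. H x = c"
    by (intro has_field_derivative_zero_constant S)
  then show ?thesis using st by auto
qed

lemma first_order_Taylor_bound:
  fixes \<psi> :: "real \<Rightarrow> real"
  assumes \<psi>: "\<psi> \<in> test_functions UNIV" and C: "\<And>x. \<bar>deriv (deriv \<psi>) x\<bar> \<le> C"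
  shows "\<bar>\<psi> p - \<psi> q + (q - p) * deriv \<psi> p\<bar> \<le> C * (q - p)\<^sup>2"
proof (cases "p = q")
  case False
  have lip: "\<bar>deriv \<psi> x - deriv \<psi> y\<bar> \<le> C * \<bar>x - y\<bar>" for x y
    using field_differentiable_bound[of UNIV "deriv \<psi>" "deriv (deriv \<psi>)" C x y] C
      test_function_DERIV[OF test_function_deriv[OF \<psi>]] by auto
  obtain z where z: "min p q < z" "z < max p q" "\<psi> p - \<psi> q = (p - q) * deriv \<psi> z"
  proof (cases "p < q")
    case True
    from MVT2[OF this, of \<psi> "deriv \<psi>"] test_function_DERIV[OF \<psi>] that show ?thesis
      by (auto simp: algebra_simps)
  next
    case F: False
    then have "q < p" using False by simp
    from MVT2[OF this, of \<psi> "deriv \<psi>"] test_function_DERIV[OF \<psi>] that show ?thesis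
      by (auto simp: algebra_simps)
  qed
  have "\<psi> p - \<psi> q + (q - p) * deriv \<psi> p = (q - p) * (deriv \<psi> p - deriv \<psi> z)"
    using z(3) by (simp add: algebra_simps)
  then have "\<bar>\<psi> p - \<psi> q + (q - p) * deriv \<psi> p\<bar> \<le> \<bar>q - p\<bar> * (C * \<bar>p - z\<bar>)"
    using lip[of p z] by (simp add: abs_mult mult_left_mono)
  also have "\<dots> \<le> \<bar>q - p\<bar> * (C * \<bar>q - p\<bar>)"
    using z(1,2) order_trans[OF abs_ge_zero C[of 0]] by (intro mult_left_mono) auto
  also have "\<dots> = C * (\<bar>q - p\<bar> * \<bar>q - p\<bar>)" by (simp only: mult_ac)
  finally show ?thesis by (simp add: power2_eq_square)
qed simp

context kruzkov_transport
begin

text \<open>The weak form is tested with a plateau in time over \<open>[s,t]\<close>. When the ramps shrink, the derivative of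
  the plateau evaluates the pairing at \<open>s\<close> and at \<open>t\<close>, by right continuity, and the plateau itself
  converges to the indicator function of \<open>]s,t]\<close>.\<close>

lemma pairing_increment_nonneg:
  assumes s: "0 < s" "s < t" "t < T'" and \<psi>: "\<psi> \<in> test_functions UNIV" "\<And>x. 0 \<le> \<psi> x"
  shows "pairing \<psi> t - pairing \<psi> s = integral {s..t} (\<lambda>\<tau>. a \<tau> * pairing (deriv \<psi>) \<tau>)"
proof -
  define t1 where "t1 = (t + T') / 2"
  have t1: "t < t1" "t1 < T'" using s by (auto simp: t1_def)
  \<comment> \<open>the ramps stay inside \<open>[s,t1]\<close>, a compact part of \<open>]0,T'[\<close> on which the speed is integrable\<close>
  define e where "e n = (t1 - t) * inverse (real (Suc n))" for n
  have e0: "0 < e n" for n using t1 by (simp add: e_def)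
  have e1: "e n \<le> t1 - t" for n using t1 by (simp add: e_def mult_left_le inverse_le_1_iff)
  have el: "e \<longlonglongrightarrow> 0"
    unfolding e_def[abs_def] by (rule tendsto_mult_right_zero[OF LIMSEQ_inverse_real_of_nat])
  define \<eta> where "\<eta> n = plateau s t (e n)" for n
  note \<psi>' = test_function_deriv[OF \<psi>(1)]
  define f where "f \<tau> = indicator {s..t1} \<tau> * (a \<tau> * pairing (deriv \<psi>) \<tau>)" for \<tau>
  have f: "integrable lebesgue f" unfolding f_def[abs_def] by (rule speed_pairing_integrable[OF s(1) t1(2) \<psi>'])
  have g1: "integrable lebesgue (\<lambda>x. indicator {s..t1} x * pairing \<psi> x)"
    and g2: "integrable lebesgue (\<lambda>x. indicator {t..t1} x * pairing \<psi> x)"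
    using s t1 by (auto intro: pairing_integrable[OF _ _ \<psi>(1)])
  have weak: "(LINT x|lebesgue. bump ((x - s) / e n) / e n * pairing \<psi> x) -
      (LINT x|lebesgue. bump ((x - t) / e n) / e n * pairing \<psi> x) + (LINT \<tau>|lebesgue. \<eta> n \<tau> * f \<tau>) = 0" for n
  proof -
    have "\<eta> n \<in> test_functions {0<..<T'}" unfolding \<eta>_def
      using s e0[of n] e1[of n] t1 by (intro plateau_test_function) auto
    moreover have "0 \<le> \<eta> n x" for x unfolding \<eta>_def using s e0 by (intro plateau_range) auto
    ultimately have "(LINT t|lebesgue. deriv (\<eta> n) t * pairing \<psi> t) + (LINT t|lebesgue. \<eta> n t * (a t * pairing (deriv \<psi>) t)) = 0"
      by (rule weak_form_tensor[OF _ _ \<psi>])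
    moreover have "\<eta> n \<tau> * (a \<tau> * pairing (deriv \<psi>) \<tau>) = \<eta> n \<tau> * f \<tau>" for \<tau>
      using plateau_outside[OF e0, of s t \<tau> n] s e1[of n] by (cases "\<tau> \<in> {s..t1}") (auto simp: f_def \<eta>_def)
    moreover have "(LINT x|lebesgue. deriv (\<eta> n) x * pairing \<psi> x) = (LINT x|lebesgue. bump ((x - s) / e n) / e n * pairing \<psi> x) -
      (LINT x|lebesgue. bump ((x - t) / e n) / e n * pairing \<psi> x)"
    proof -
      have "(LINT x|lebesgue. deriv (\<eta> n) x * pairing \<psi> x)
        = (LINT x|lebesgue. bump ((x - s) / e n) / e n * pairing \<psi> x - bump ((x - t) / e n) / e n * pairing \<psi> x)"
        by (simp add: \<eta>_def plateau_deriv left_diff_distrib)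
      also have "\<dots> = (LINT x|lebesgue. bump ((x - s) / e n) / e n * pairing \<psi> x) -
          (LINT x|lebesgue. bump ((x - t) / e n) / e n * pairing \<psi> x)"
        using e0 e1[of n] s
        by (intro Bochner_Integration.integral_diff scaled_bump_mult_integrable[OF _ _ g1] scaled_bump_mult_integrable[OF _ _ g2]) auto
      finally show ?thesis .
    qed
    ultimately show ?thesis by simp
  qed
  have "(\<lambda>n. LINT \<tau>|lebesgue. \<eta> n \<tau> * f \<tau>) \<longlonglongrightarrow> (LINT \<tau>|lebesgue. indicator {s<..t} \<tau> * f \<tau>)"
  proof (rule integral_dominated_convergence[where w="\<lambda>\<tau>. \<bar>f \<tau>\<bar>"])
    show "(\<lambda>\<tau>. indicator {s<..t} \<tau> * f \<tau>) \<in> borel_measurable lebesgue"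
      using f by (intro borel_measurable_times borel_measurable_indicator) auto
    show "(\<lambda>\<tau>. \<eta> n \<tau> * f \<tau>) \<in> borel_measurable lebesgue" for n
      using borel_measurable_lebesgue_continuous[OF C_k_on_imp_continuous[OF plateau_smooth]] f
      unfolding \<eta>_def by (intro borel_measurable_times) auto
    show "AE \<tau> in lebesgue. norm (\<eta> n \<tau> * f \<tau>) \<le> \<bar>f \<tau>\<bar>" for n
      using plateau_range(1)[OF e0, of s t n] plateau_range(2)[of s t "e n"] s
      by (intro AE_I2) (auto simp: \<eta>_def abs_mult intro!: mult_left_le_one_le)
    show "AE \<tau> in lebesgue. (\<lambda>n. \<eta> n \<tau> * f \<tau>) \<longlonglongrightarrow> indicator {s<..t} \<tau> * f \<tau>"
    proof (intro AE_I2 tendsto_mult tendsto_const tendsto_eventually)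
      fix \<tau> :: real
      show "\<forall>\<^sub>F n in sequentially. \<eta> n \<tau> = indicator {s<..t} \<tau>"
      proof (cases "\<tau> \<le> s")
        case True
        then show ?thesis using plateau_outside[OF e0, of s t \<tau>] s by (simp add: \<eta>_def)
      next
        case F: False
        show ?thesis
        proof (cases "\<tau> \<le> t")
          case True
          have "\<forall>\<^sub>F n in sequentially. e n < \<tau> - s" using F by (intro order_tendstoD[OF el]) simp
          then show ?thesis
            by eventually_elim (use True F plateau_inside[OF e0] in \<open>auto simp: \<eta>_def\<close>)
        next
          case False
          have "\<forall>\<^sub>F n in sequentially. e n < \<tau> - t" using False by (intro order_tendstoD[OF el]) simp
          then show ?thesis
            by eventually_elim (use False s plateau_outside[OF e0, of s t] in \<open>auto simp: \<eta>_def\<close>)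
        qed
      qed
    qed
  qed (use f in auto)
  moreover have "(\<lambda>n. LINT x|lebesgue. bump ((x - s) / e n) / e n * pairing \<psi> x) \<longlonglongrightarrow> pairing \<psi> s"
    using s t1 by (intro right_mollification_tendsto[OF _ g1 pairing_right_continuous[OF _ \<psi>(1)] e0 el]) auto
  moreover have "(\<lambda>n. LINT x|lebesgue. bump ((x - t) / e n) / e n * pairing \<psi> x) \<longlonglongrightarrow> pairing \<psi> t"
    using s t1 by (intro right_mollification_tendsto[OF _ g2 pairing_right_continuous[OF _ \<psi>(1)] e0 el]) auto
  ultimately have "(\<lambda>n. (LINT x|lebesgue. bump ((x - s) / e n) / e n * pairing \<psi> x) -
      (LINT x|lebesgue. bump ((x - t) / e n) / e n * pairing \<psi> x) + (LINT \<tau>|lebesgue. \<eta> n \<tau> * f \<tau>))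
      \<longlonglongrightarrow> pairing \<psi> s - pairing \<psi> t + (LINT \<tau>|lebesgue. indicator {s<..t} \<tau> * f \<tau>)"
    by (intro tendsto_add tendsto_diff)
  then have "(\<lambda>n. 0::real) \<longlonglongrightarrow> pairing \<psi> s - pairing \<psi> t + (LINT \<tau>|lebesgue. indicator {s<..t} \<tau> * f \<tau>)"
    by (simp only: weak)
  then have "pairing \<psi> t - pairing \<psi> s = (LINT \<tau>|lebesgue. indicator {s<..t} \<tau> * f \<tau>)"
    by (simp add: LIMSEQ_const_iff)
  also have "\<dots> = (LINT \<tau>|lebesgue. indicator {s..t} \<tau> * (a \<tau> * pairing (deriv \<psi>) \<tau>))"
  proof (rule integral_cong_AE)
    have "AE \<tau> in lebesgue. \<tau> \<noteq> s" by (intro AE_completion AE_lborel_singleton)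
    then show "AE \<tau> in lebesgue. indicator {s<..t} \<tau> * f \<tau> = indicator {s..t} \<tau> * (a \<tau> * pairing (deriv \<psi>) \<tau>)"
      by eventually_elim (use t1 in \<open>auto simp: f_def indicator_def\<close>)
    show "(\<lambda>\<tau>. indicator {s<..t} \<tau> * f \<tau>) \<in> borel_measurable lebesgue"
      using f by (intro borel_measurable_times borel_measurable_indicator) auto
    show "(\<lambda>\<tau>. indicator {s..t} \<tau> * (a \<tau> * pairing (deriv \<psi>) \<tau>)) \<in> borel_measurable lebesgue"
      using speed_pairing_integrable[OF s(1,3) \<psi>'] by (rule borel_measurable_integrable)
  qed
  also have "\<dots> = integral {s..t} (\<lambda>\<tau>. a \<tau> * pairing (deriv \<psi>) \<tau>)"
    using set_lebesgue_integral_eq_integral(2)[of "{s..t}" "\<lambda>\<tau>. a \<tau> * pairing (deriv \<psi>) \<tau>"]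
      speed_pairing_integrable[OF s(1,3) \<psi>'] by (simp add: set_integrable_def set_lebesgue_integral_def)
  finally show ?thesis .
qed

lemma speed_pairing_integrable_on:
  assumes "0 < s" "t < T'" "\<psi> \<in> test_functions UNIV"
  shows "(\<lambda>\<tau>. a \<tau> * pairing \<psi> \<tau>) integrable_on {s..t}"
  using set_lebesgue_integral_eq_integral(1)[of "{s..t}" "\<lambda>\<tau>. a \<tau> * pairing \<psi> \<tau>"] speed_pairing_integrable[OF assms]
  by (simp add: set_integrable_def)

lemma pairing_add_scaled:
  assumes "\<phi> \<in> test_functions UNIV" "\<psi> \<in> test_functions UNIV" "t \<in> {0..<T'}"
  shows "pairing (\<lambda>x. \<phi> x + c * \<psi> x) t = pairing \<phi> t + c * pairing \<psi> t"
proof -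
  have "pairing (\<lambda>x. \<phi> x + c * \<psi> x) t = (LINT x|lebesgue. u t x * \<phi> x + c * (u t x * \<psi> x))"
    by (simp add: pairing_def algebra_simps)
  also have "\<dots> = pairing \<phi> t + c * pairing \<psi> t"
    using u_mult_test_integrable[OF assms(3,1)] u_mult_test_integrable[OF assms(3,2)] by (simp add: pairing_def)
  finally show ?thesis .
qed

text \<open>Entropy inequalities are available only for nonnegative test functions. A signed \<open>\<psi>\<close> is the
  difference of \<open>\<psi> + C \<xi>\<close> and \<open>C \<xi>\<close>, where the plateau \<open>\<xi>\<close> is \<open>1\<close> on the support of \<open>\<psi>\<close>.\<close>

lemma pairing_increment:
  assumes s: "0 < s" "s \<le> t" "t < T'" and \<psi>: "\<psi> \<in> test_functions UNIV"
  shows "pairing \<psi> t - pairing \<psi> s = integral {s..t} (\<lambda>\<tau>. a \<tau> * pairing (deriv \<psi>) \<tau>)"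
proof (cases "s = t")
  case False
  then have st: "s < t" using s by simp
  obtain R where R: "0 < R" "\<And>x. R < \<bar>x\<bar> \<Longrightarrow> \<psi> x = 0" using test_function_interval[OF \<psi>] by blast
  obtain C where C: "0 \<le> C" "\<And>x. \<bar>\<psi> x\<bar> \<le> C" using test_function_bounded[OF \<psi>] by blast
  define \<xi> where "\<xi> = plateau (-R - 1) R 1"
  have \<xi>: "\<xi> \<in> test_functions UNIV" unfolding \<xi>_def using R by (intro plateau_test_function) auto
  have \<xi>0: "0 \<le> \<xi> x" for x unfolding \<xi>_def using R by (intro plateau_range) auto
  have pos: "0 \<le> \<psi> x + C * \<xi> x" for x
  proof (cases "\<bar>x\<bar> \<le> R")
    case True
    then have "\<xi> x = 1" unfolding \<xi>_def by (intro plateau_inside) auto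
    then show ?thesis using C(2)[of x] by simp
  next
    case False
    then show ?thesis using R(2)[of x] C(1) \<xi>0[of x] by simp
  qed
  have d: "deriv (\<lambda>x. \<psi> x + C * \<xi> x) = (\<lambda>x. deriv \<psi> x + C * deriv \<xi> x)"
    by (rule ext, rule DERIV_imp_deriv)
      (auto intro!: derivative_eq_intros test_function_DERIV[OF \<psi>] test_function_DERIV[OF \<xi>])
  note sT = s(1) st s(3)
  note \<psi>' = test_function_deriv[OF \<psi>] and \<xi>' = test_function_deriv[OF \<xi>]
  have "pairing (\<lambda>x. \<psi> x + C * \<xi> x) t - pairing (\<lambda>x. \<psi> x + C * \<xi> x) s
      = integral {s..t} (\<lambda>\<tau>. a \<tau> * pairing (\<lambda>x. deriv \<psi> x + C * deriv \<xi> x) \<tau>)"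
    using pairing_increment_nonneg[OF sT test_function_add_scaled[OF \<psi> \<xi>] pos] d by simp
  also have "\<dots> = integral {s..t} (\<lambda>\<tau>. a \<tau> * pairing (deriv \<psi>) \<tau> + C * (a \<tau> * pairing (deriv \<xi>) \<tau>))"
    using s by (intro Henstock_Kurzweil_Integration.integral_cong) (simp add: pairing_add_scaled[OF \<psi>' \<xi>'] algebra_simps)
  also have "\<dots> = integral {s..t} (\<lambda>\<tau>. a \<tau> * pairing (deriv \<psi>) \<tau>) + C * integral {s..t} (\<lambda>\<tau>. a \<tau> * pairing (deriv \<xi>) \<tau>)"
    using speed_pairing_integrable_on[OF s(1,3) \<psi>'] speed_pairing_integrable_on[OF s(1,3) \<xi>']
    by (subst Henstock_Kurzweil_Integration.integral_add) (auto intro: integrable_on_mult_right)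
  also have "integral {s..t} (\<lambda>\<tau>. a \<tau> * pairing (deriv \<xi>) \<tau>) = pairing \<xi> t - pairing \<xi> s"
    by (rule pairing_increment_nonneg[OF sT \<xi> \<xi>0, symmetric])
  finally show ?thesis
    using pairing_add_scaled[OF \<psi> \<xi>, of t C] pairing_add_scaled[OF \<psi> \<xi>, of s C] s by (simp add: algebra_simps)
qed simp

text \<open>For positive times the pairing is an indefinite integral. At time \<open>0\<close>, where the speed has not
  been shown to be integrable, right continuity of the solution is used instead.\<close>

lemma pairing_continuous:
  assumes \<psi>: "\<psi> \<in> test_functions UNIV"
  shows "continuous_on {0..<T'} (pairing \<psi>)"
  unfolding continuous_on_eq_continuous_within
proof
  fix t assume t: "t \<in> {0..<T'}"
  show "continuous (at t within {0..<T'}) (pairing \<psi>)"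
  proof (cases "t = 0")
    case True
    have "(pairing \<psi> \<longlongrightarrow> pairing \<psi> 0) (at_right 0)" using pairing_right_continuous[OF _ \<psi>] t True by simp
    moreover have "at 0 within {0..<T'} = at_right 0"
      using t by (intro at_within_nhd[of _ "{..<T'}"]) auto
    ultimately show ?thesis unfolding continuous_within True by simp
  next
    case False
    define s where "s = t / 2" define t1 where "t1 = (t + T') / 2"
    have *: "0 < s" "s < t" "t < t1" "t1 < T'" using t False by (auto simp: s_def t1_def)
    have "continuous_on {s..t1} (\<lambda>x. pairing \<psi> s + integral {s..x} (\<lambda>\<tau>. a \<tau> * pairing (deriv \<psi>) \<tau>))"
      using speed_pairing_integrable_on[OF *(1,4) test_function_deriv[OF \<psi>]]
      by (intro continuous_intros indefinite_integral_continuous_1)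
    moreover have "pairing \<psi> s + integral {s..x} (\<lambda>\<tau>. a \<tau> * pairing (deriv \<psi>) \<tau>) = pairing \<psi> x" if "x \<in> {s..t1}" for x
      using pairing_increment[OF *(1) _ _ \<psi>, of x] that * by simp
    ultimately have "continuous_on {s..t1} (pairing \<psi>)" by (rule continuous_on_eq)
    then have "isCont (pairing \<psi>) t"
      by (rule continuous_on_interior) (use * in auto)
    then show ?thesis by (rule continuous_at_imp_continuous_at_within)
  qed
qed

text \<open>As the solution is bounded, replacing the indicator function of \<open>[p,q]\<close> by a plateau costs at most
  \<open>2 M e\<close>, uniformly in time. In the nonlinear problem this lemma makes the speed continuous.\<close>

lemma interval_mass_continuous:
  assumes "p \<le> q"
  shows "continuous_on {0..<T'} (\<lambda>t. LINT x:{p..q}|lebesgue. u t x)"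
proof (rule uniform_limit_theorem)
  define e where "e n = inverse (real (Suc n))" for n
  have e0: "0 < e n" for n by (simp add: e_def)
  have el: "e \<longlonglongrightarrow> 0" unfolding e_def[abs_def] by (rule LIMSEQ_inverse_real_of_nat)
  define \<psi> where "\<psi> n = plateau p q (e n)" for n
  have \<psi>: "\<psi> n \<in> test_functions UNIV" for n unfolding \<psi>_def using e0 assms by (intro plateau_test_function) auto
  show "\<forall>\<^sub>F n in sequentially. continuous_on {0..<T'} (pairing (\<psi> n))" using pairing_continuous[OF \<psi>] by simp
  have bound: "\<bar>pairing (\<psi> n) t - (LINT x:{p..q}|lebesgue. u t x)\<bar> \<le> 2 * M * e n" if t: "t \<in> {0..<T'}" for n t
  proof -
    let ?I = "\<lambda>x. M * (indicator {p..p + e n} x + indicator {q..q + e n} x) :: real"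
    have i1: "integrable lebesgue (\<lambda>x. u t x * \<psi> n x)" by (rule u_mult_test_integrable[OF t \<psi>])
    have i2: "integrable lebesgue (\<lambda>x. u t x * indicator {p..q} x)"
    proof (rule u_mult_integrable[OF t])
      show "\<bar>indicator {p..q} x :: real\<bar> \<le> 1" for x by (simp add: indicator_def)
    qed (simp add: borel_measurable_indicator)
    have i3: "integrable lebesgue ?I"
      by (intro integrable_mult_right Bochner_Integration.integrable_add integrable_real_indicator)
        (use e0[of n] in \<open>auto simp: emeasure_lborel_Icc_eq\<close>)
    have "pairing (\<psi> n) t - (LINT x:{p..q}|lebesgue. u t x) = (LINT x|lebesgue. u t x * \<psi> n x - u t x * indicator {p..q} x)"
      unfolding pairing_def set_lebesgue_integral_def
      using Bochner_Integration.integral_diff[OF i1 i2] by (simp add: mult.commute)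
    also have "\<bar>\<dots>\<bar> \<le> (LINT x|lebesgue. \<bar>u t x * \<psi> n x - u t x * indicator {p..q} x\<bar>)"
      by (rule integral_abs_bound)
    also have "\<dots> \<le> (LINT x|lebesgue. ?I x)"
    proof (rule integral_mono)
      fix x
      have "\<bar>\<psi> n x - indicator {p..q} x\<bar> \<le> indicator {p..p + e n} x + indicator {q..q + e n} x"
      proof (cases "x \<in> {p..p + e n} \<or> x \<in> {q..q + e n}")
        case True
        have "\<bar>\<psi> n x - indicator {p..q} x\<bar> \<le> 1"
          using plateau_range(1)[OF e0 assms, of n x] plateau_range(2)[of p q "e n" x] by (auto simp: \<psi>_def indicator_def)
        then show ?thesis using True by (auto simp: indicator_def)
      next
        case False
        then have "\<psi> n x = indicator {p..q} x"
          using plateau_outside[OF e0 assms, of x n] plateau_inside[OF e0, of p n x q] assms e0[of n]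
          by (cases "x < p"; cases "q < x"; auto simp: \<psi>_def)
        then show ?thesis by simp
      qed
      then show "\<bar>u t x * \<psi> n x - u t x * indicator {p..q} x\<bar> \<le> ?I x"
        using u_bound[OF t, of x] M_nonneg
        by (auto simp: abs_mult simp flip: right_diff_distrib intro!: mult_mono)
    next
      show "integrable lebesgue (\<lambda>x. \<bar>u t x * \<psi> n x - u t x * indicator {p..q} x\<bar>)"
        using i1 i2 by (intro integrable_abs Bochner_Integration.integrable_diff)
    qed (rule i3)
    also have "\<dots> = 2 * M * e n" using e0[of n] by simp
    finally show ?thesis .
  qed
  show "uniform_limit {0..<T'} (\<lambda>n. pairing (\<psi> n)) (\<lambda>t. LINT x:{p..q}|lebesgue. u t x) sequentially"
  proof (rule uniform_limitI)
    fix r :: real assume "0 < r"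
    have "(\<lambda>n. 2 * M * e n) \<longlonglongrightarrow> 2 * M * 0" by (intro tendsto_intros el)
    then have "\<forall>\<^sub>F n in sequentially. 2 * M * e n < r" using \<open>0 < r\<close> by (intro order_tendstoD) auto
    then show "\<forall>\<^sub>F n in sequentially. \<forall>t\<in>{0..<T'}. dist (pairing (\<psi> n) t) (LINT x:{p..q}|lebesgue. u t x) < r"
      by eventually_elim (auto simp: dist_real_def intro!: le_less_trans[OF bound])
  qed
qed simp

end

section \<open>Solutions are transported along characteristics\<close>

locale kruzkov_transport_continuous = kruzkov_transport +
  assumes a_continuous: "continuous_on {0..<T'} a"
begin

definition travel :: "real \<Rightarrow> real" where "travel t = integral {0..t} a"

lemma a_integrable_on: "0 \<le> s \<Longrightarrow> t < T' \<Longrightarrow> a integrable_on {s..t}"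
  by (intro integrable_continuous_interval continuous_on_subset[OF a_continuous]) auto

lemma travel_diff: "0 \<le> s \<Longrightarrow> s \<le> t \<Longrightarrow> t < T' \<Longrightarrow> travel t - travel s = integral {s..t} a"
  using Henstock_Kurzweil_Integration.integral_combine[of 0 s t a] a_integrable_on[of 0 t] by (simp add: travel_def)

lemma a_bounded:
  assumes "t < T'"
  obtains A where "0 \<le> A" "\<And>\<tau>. \<tau> \<in> {0..t} \<Longrightarrow> \<bar>a \<tau>\<bar> \<le> A"
proof -
  have "bounded (a ` {0..t})"
    using assms by (intro compact_imp_bounded compact_continuous_image continuous_on_subset[OF a_continuous]) auto
  then show thesis using that unfolding bounded_pos by (metis imageI less_imp_le real_norm_def)
qed

lemma integral_bound_by_length:
  assumes "(f::real \<Rightarrow> real) integrable_on {s..t}" "s \<le> t" "\<And>\<tau>. \<tau> \<in> {s..t} \<Longrightarrow> \<bar>f \<tau>\<bar> \<le> B"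
  shows "\<bar>integral {s..t} f\<bar> \<le> B * (t - s)"
proof -
  have "(\<lambda>_. B) integrable_on {s..t}" by (intro integrable_continuous_interval continuous_on_const)
  then show ?thesis
    using integral_norm_bound_integral[of f "{s..t}" "\<lambda>_. B"] assms by (simp add: mult.commute)
qed

text \<open>The solution changes at first order by \<open>a \<langle>u, \<psi>'\<rangle>\<close> per unit of time and the shift of the test
  function contributes \<open>- a \<langle>u, \<psi>'\<rangle>\<close>. These terms cancel, and the remainders are quadratic because
  \<open>\<psi>''\<close> and \<open>a\<close> are bounded.\<close>

lemma moving_pairing_quadratic:
  assumes T1: "T1 < T'" and \<psi>: "\<psi> \<in> test_functions UNIV"
  obtains K where "\<And>s t. s \<in> {0<..T1} \<Longrightarrow> t \<in> {0<..T1} \<Longrightarrow> s \<le> t \<Longrightarrow>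
    \<bar>pairing (\<lambda>x. \<psi> (x - travel t)) t - pairing (\<lambda>x. \<psi> (x - travel s)) s\<bar> \<le> K * (t - s)\<^sup>2"
proof -
  note \<psi>' = test_function_deriv[OF \<psi>]
  note \<psi>'' = test_function_deriv[OF \<psi>']
  obtain A where A: "0 \<le> A" "\<And>\<tau>. \<tau> \<in> {0..T1} \<Longrightarrow> \<bar>a \<tau>\<bar> \<le> A" using a_bounded[OF T1] by blast
  obtain C where C: "0 \<le> C" "\<And>x. \<bar>deriv (deriv \<psi>) x\<bar> \<le> C" using test_function_bounded[OF \<psi>''] by blast
  have "\<bar>pairing (\<lambda>x. \<psi> (x - travel t)) t - pairing (\<lambda>x. \<psi> (x - travel s)) s\<bar> \<le> (2 * A * A * (L * C)) * (t - s)\<^sup>2"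
    if st: "s \<in> {0<..T1}" "t \<in> {0<..T1}" "s \<le> t" for s t
  proof -
    have sT: "0 < s" "t < T'" "s \<in> {0..<T'}" "t \<in> {0..<T'}" using st T1 by auto
    let ?y = "travel t" and ?z = "travel s"
    define \<phi> where "\<phi> x = \<psi> (x - ?y)" for x
    have \<phi>: "\<phi> \<in> test_functions UNIV" "deriv \<phi> = (\<lambda>x. deriv \<psi> (x - ?y))"
      unfolding \<phi>_def[abs_def] using test_function_shift[OF \<psi>] by auto
    have \<phi>': "deriv \<phi> \<in> test_functions UNIV" "deriv (deriv \<phi>) = (\<lambda>x. deriv (deriv \<psi>) (x - ?y))"
      using test_function_deriv[OF \<phi>(1)] test_function_shift(2)[OF \<psi>', of ?y] \<phi>(2) by auto
    note \<phi>'' = test_function_deriv[OF \<phi>'(1)]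
    define F where "F \<tau> = pairing (deriv \<phi>) \<tau>" for \<tau>
    have aF: "(\<lambda>\<tau>. a \<tau> * F \<tau>) integrable_on {s..t}"
      unfolding F_def using speed_pairing_integrable_on[OF sT(1,2) \<phi>'(1)] .
    have ai: "a integrable_on {s..t}" using a_integrable_on[of s t] sT by auto
    have I: "?y - ?z = integral {s..t} a" using travel_diff[of s t] sT st by auto
    have Ib: "\<bar>?y - ?z\<bar> \<le> A * (t - s)"
      unfolding I using st A(2) by (intro integral_bound_by_length ai) auto
    have Fl: "\<bar>F \<tau> - F s\<bar> \<le> A * (L * C) * (t - s)" if \<tau>: "\<tau> \<in> {s..t}" for \<tau>
    proof -
      have "F \<tau> - F s = integral {s..\<tau>} (\<lambda>r. a r * pairing (deriv (deriv \<phi>)) r)"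
        unfolding F_def using \<tau> sT by (intro pairing_increment[OF _ _ _ \<phi>'(1)]) auto
      also have "\<bar>\<dots>\<bar> \<le> A * (L * C) * (\<tau> - s)"
      proof (rule integral_bound_by_length)
        show "(\<lambda>r. a r * pairing (deriv (deriv \<phi>)) r) integrable_on {s..\<tau>}"
          using \<tau> sT by (intro speed_pairing_integrable_on \<phi>'') auto
        fix r assume r: "r \<in> {s..\<tau>}"
        then have "\<bar>pairing (deriv (deriv \<phi>)) r\<bar> \<le> L * C"
          using \<tau> sT C by (intro pairing_bound[OF _ \<phi>'']) (auto simp: \<phi>'(2))
        moreover have "\<bar>a r\<bar> \<le> A" using r \<tau> st by (intro A(2)) auto
        ultimately show "\<bar>a r * pairing (deriv (deriv \<phi>)) r\<bar> \<le> A * (L * C)"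
          unfolding abs_mult using A(1) by (intro mult_mono) auto
      qed (use \<tau> in auto)
      also have "\<dots> \<le> A * (L * C) * (t - s)"
        using \<tau> A(1) C(1) L_nonneg by (intro mult_left_mono) auto
      finally show ?thesis .
    qed
    have "pairing \<phi> t - pairing \<phi> s - (?y - ?z) * F s = integral {s..t} (\<lambda>\<tau>. a \<tau> * F \<tau> - a \<tau> * F s)"
      using pairing_increment[OF sT(1) st(3) sT(2) \<phi>(1)] aF ai
      by (subst Henstock_Kurzweil_Integration.integral_diff)
        (auto simp: I F_def intro: integrable_on_mult_left)
    also have "\<bar>\<dots>\<bar> \<le> A * (A * (L * C) * (t - s)) * (t - s)"
    proof (rule integral_bound_by_length)
      show "(\<lambda>\<tau>. a \<tau> * F \<tau> - a \<tau> * F s) integrable_on {s..t}"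
        using aF ai by (intro Henstock_Kurzweil_Integration.integrable_diff integrable_on_mult_left)
      fix \<tau> assume \<tau>: "\<tau> \<in> {s..t}"
      have "\<bar>a \<tau>\<bar> \<le> A" using \<tau> st by (intro A(2)) auto
      then show "\<bar>a \<tau> * F \<tau> - a \<tau> * F s\<bar> \<le> A * (A * (L * C) * (t - s))"
        unfolding right_diff_distrib[symmetric] abs_mult using Fl[OF \<tau>] A(1) by (intro mult_mono) auto
    qed (use st in auto)
    finally have 1: "\<bar>pairing \<phi> t - pairing \<phi> s - (?y - ?z) * F s\<bar> \<le> A * A * (L * C) * (t - s)\<^sup>2"
      by (simp add: power2_eq_square mult_ac)
    define \<zeta> where "\<zeta> x = \<psi> (x - ?y) - \<psi> (x - ?z) + (?y - ?z) * deriv \<psi> (x - ?y)" for x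
    have "pairing \<phi> s - pairing (\<lambda>x. \<psi> (x - ?z)) s + (?y - ?z) * F s = (LINT x|lebesgue. u s x * \<zeta> x)"
    proof -
      have "(LINT x|lebesgue. u s x * \<zeta> x)
        = (LINT x|lebesgue. u s x * \<phi> x - u s x * \<psi> (x - ?z) + (?y - ?z) * (u s x * deriv \<phi> x))"
        by (simp add: \<zeta>_def \<phi>_def[abs_def] \<phi>(2)[unfolded \<phi>_def[abs_def]] algebra_simps)
      then show ?thesis
        using u_mult_test_integrable[OF sT(3) \<phi>(1)] u_mult_test_integrable[OF sT(3) \<phi>'(1)]
          u_mult_test_integrable[OF sT(3) test_function_shift(1)[OF \<psi>, of ?z]]
        by (simp add: pairing_def F_def)
    qed
    also have "\<bar>\<dots>\<bar> \<le> L * (C * (?y - ?z)\<^sup>2)"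
    proof (rule u_mult_bound[OF sT(3)])
      show "\<zeta> \<in> borel_measurable lebesgue" unfolding \<zeta>_def[abs_def]
        using test_function_continuous[OF test_function_shift(1)[OF \<psi>]]
          test_function_continuous[OF test_function_shift(1)[OF \<psi>']]
        by (intro borel_measurable_lebesgue_continuous continuous_intros)
      show "\<bar>\<zeta> x\<bar> \<le> C * (?y - ?z)\<^sup>2" for x
        using first_order_Taylor_bound[OF \<psi> C(2), of "x - ?y" "x - ?z"] by (simp add: \<zeta>_def)
    qed
    also have "\<dots> \<le> L * (C * (A * (t - s))\<^sup>2)"
      using Ib C(1) L_nonneg power_mono[OF Ib abs_ge_zero, of 2] by (intro mult_left_mono) auto
    finally have 2: "\<bar>pairing \<phi> s - pairing (\<lambda>x. \<psi> (x - ?z)) s + (?y - ?z) * F s\<bar> \<le> A * A * (L * C) * (t - s)\<^sup>2"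
      by (simp add: power2_eq_square mult_ac)
    from 1 2 show ?thesis unfolding \<phi>_def[abs_def] by (simp add: abs_le_iff)
  qed
  then show thesis by (rule that)
qed

text \<open>The shift of the test function tends to \<open>0\<close> since the speed is bounded near \<open>0\<close>. The initial
  condition controls the solution only on bounded intervals, which is enough for a compactly
  supported \<open>\<psi>\<close>.\<close>

lemma initial_limit:
  assumes T0: "0 < T'" and u0: "integrable lebesgue u0" and \<psi>: "\<psi> \<in> test_functions UNIV"
  shows "((\<lambda>s. pairing (\<lambda>x. \<psi> (x - travel s)) s) \<longlongrightarrow> (LINT x|lebesgue. u0 x * \<psi> x)) (at_right 0)"
proof -
  note \<psi>' = test_function_deriv[OF \<psi>]
  obtain C where C: "0 \<le> C" "\<And>x. \<bar>\<psi> x\<bar> \<le> C" using test_function_bounded[OF \<psi>] by blast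
  obtain C1 where C1: "0 \<le> C1" "\<And>x. \<bar>deriv \<psi> x\<bar> \<le> C1" using test_function_bounded[OF \<psi>'] by blast
  obtain R where R: "0 < R" "\<And>x. R < \<bar>x\<bar> \<Longrightarrow> \<psi> x = 0" using test_function_interval[OF \<psi>] by blast
  obtain A where A: "0 \<le> A" "\<And>\<tau>. \<tau> \<in> {0..T'/2} \<Longrightarrow> \<bar>a \<tau>\<bar> \<le> A" using a_bounded[of "T'/2"] T0 by auto
  have ini: "((\<lambda>t. LINT x:{-R..R}|lebesgue. \<bar>u t x - u0 x\<bar>) \<longlongrightarrow> 0) (at_right 0)"
    using kruzkov R(1) unfolding kruzkov_solution_def by blast
  have lip: "\<bar>\<psi> x - \<psi> y\<bar> \<le> C1 * \<bar>x - y\<bar>" for x y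
    using field_differentiable_bound[of UNIV \<psi> "deriv \<psi>" C1 x y] C1 test_function_DERIV[OF \<psi>] by auto
  have "((\<lambda>s. pairing (\<lambda>x. \<psi> (x - travel s)) s - (LINT x|lebesgue. u0 x * \<psi> x)) \<longlongrightarrow> 0) (at_right 0)"
  proof (rule Lim_null_comparison)
    have "((\<lambda>s. L * (C1 * (A * s)) + C * (LINT x:{-R..R}|lebesgue. \<bar>u s x - u0 x\<bar>)) \<longlongrightarrow> L * (C1 * (A * 0)) + C * 0) (at_right 0)"
      by (intro tendsto_intros ini)
    then show "((\<lambda>s. L * (C1 * (A * s)) + C * (LINT x:{-R..R}|lebesgue. \<bar>u s x - u0 x\<bar>)) \<longlongrightarrow> 0) (at_right 0)" by simp
    have "\<forall>\<^sub>F s in at_right 0. s \<in> {0<..<T'/2}"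
      using T0 by (auto simp: eventually_at_right_field intro!: exI[of _ "T'/2"])
    then show "\<forall>\<^sub>F s in at_right 0. norm (pairing (\<lambda>x. \<psi> (x - travel s)) s - (LINT x|lebesgue. u0 x * \<psi> x))
        \<le> L * (C1 * (A * s)) + C * (LINT x:{-R..R}|lebesgue. \<bar>u s x - u0 x\<bar>)"
    proof eventually_elim
      case (elim s)
      then have s: "s \<in> {0..<T'}" "0 \<le> s" "s < T'" by auto
      have Xs: "\<bar>travel s\<bar> \<le> A * s"
        unfolding travel_def using integral_bound_by_length[OF a_integrable_on[of 0 s], of A] A(2) elim by auto
      note i1 = u_mult_test_integrable[OF s(1) test_function_shift(1)[OF \<psi>, of "travel s"]]
      note i2 = u_mult_test_integrable[OF s(1) \<psi>]
      have i3: "integrable lebesgue (\<lambda>x. u0 x * \<psi> x)"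
        by (rule integrable_mult_bounded_lebesgue[OF u0 borel_measurable_lebesgue_continuous[OF test_function_continuous[OF \<psi>]] C(2)])
      have "pairing (\<lambda>x. \<psi> (x - travel s)) s - pairing \<psi> s = (LINT x|lebesgue. u s x * (\<psi> (x - travel s) - \<psi> x))"
        using i1 i2 by (simp add: pairing_def right_diff_distrib)
      also have "\<bar>\<dots>\<bar> \<le> L * (C1 * (A * s))"
      proof (rule u_mult_bound[OF s(1)])
        show "(\<lambda>x. \<psi> (x - travel s) - \<psi> x) \<in> borel_measurable lebesgue"
          using test_function_continuous[OF test_function_shift(1)[OF \<psi>]] test_function_continuous[OF \<psi>]
          by (intro borel_measurable_lebesgue_continuous continuous_intros)
        show "\<bar>\<psi> (x - travel s) - \<psi> x\<bar> \<le> C1 * (A * s)" for x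
          using lip[of "x - travel s" x] mult_left_mono[OF Xs C1(1)] by simp
      qed
      finally have 1: "\<bar>pairing (\<lambda>x. \<psi> (x - travel s)) s - pairing \<psi> s\<bar> \<le> L * (C1 * (A * s))" .
      have "pairing \<psi> s - (LINT x|lebesgue. u0 x * \<psi> x) = (LINT x|lebesgue. (u s x - u0 x) * \<psi> x)"
        using i2 i3 by (simp add: pairing_def left_diff_distrib)
      also have "\<bar>\<dots>\<bar> \<le> (LINT x|lebesgue. \<bar>(u s x - u0 x) * \<psi> x\<bar>)" by (rule integral_abs_bound)
      also have "\<dots> \<le> (LINT x|lebesgue. C * (indicator {-R..R} x * \<bar>u s x - u0 x\<bar>))"
      proof (rule integral_mono)
        show "integrable lebesgue (\<lambda>x. \<bar>(u s x - u0 x) * \<psi> x\<bar>)"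
          using i2 i3 by (intro integrable_abs) (simp add: left_diff_distrib)
        have "integrable lebesgue (\<lambda>x. \<bar>u s x - u0 x\<bar> * indicator {-R..R} x)"
        proof (rule integrable_mult_bounded_lebesgue)
          show "integrable lebesgue (\<lambda>x. \<bar>u s x - u0 x\<bar>)" using u_integrable[OF s(1)] u0 by simp
          show "(indicator {-R..R} :: real \<Rightarrow> real) \<in> borel_measurable lebesgue" by (rule borel_measurable_indicator) simp
          show "\<bar>indicator {-R..R} x :: real\<bar> \<le> 1" for x by (simp add: indicator_def)
        qed
        then show "integrable lebesgue (\<lambda>x. C * (indicator {-R..R} x * \<bar>u s x - u0 x\<bar>))" by (simp add: mult.commute)
        show "\<bar>(u s x - u0 x) * \<psi> x\<bar> \<le> C * (indicator {-R..R} x * \<bar>u s x - u0 x\<bar>)" for x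
          using R(2)[of x] C(2)[of x] by (cases "\<bar>x\<bar> \<le> R") (auto simp: abs_mult indicator_def mult.commute[of C] intro: mult_left_mono)
      qed
      also have "\<dots> = C * (LINT x:{-R..R}|lebesgue. \<bar>u s x - u0 x\<bar>)"
        by (simp add: set_lebesgue_integral_def)
      finally show ?case using 1 by simp
    qed
  qed
  then show ?thesis by (simp add: LIM_zero_iff)
qed

text \<open>The pairing with the moving test function is constant for positive times, by the quadratic bound,
  and its limit at \<open>0\<close> is the pairing of the datum.\<close>

lemma transported_along_characteristics:
  assumes u0: "integrable lebesgue u0" and t: "0 < t" "t < T'"
  shows "AE x in lebesgue. u t x = u0 (x - travel t)"
proof -
  have *: "pairing (\<lambda>x. \<psi> (x - travel t)) t = (LINT x|lebesgue. u0 x * \<psi> x)" if \<psi>: "\<psi> \<in> test_functions UNIV" for \<psi>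
  proof -
    obtain K where K: "\<And>s t'. s \<in> {0<..t} \<Longrightarrow> t' \<in> {0<..t} \<Longrightarrow> s \<le> t' \<Longrightarrow>
      \<bar>pairing (\<lambda>x. \<psi> (x - travel t')) t' - pairing (\<lambda>x. \<psi> (x - travel s)) s\<bar> \<le> K * (t' - s)\<^sup>2"
      using moving_pairing_quadratic[OF t(2) \<psi>] by blast
    have c: "pairing (\<lambda>x. \<psi> (x - travel s)) s = pairing (\<lambda>x. \<psi> (x - travel t)) t" if "s \<in> {0<..t}" for s
    proof (rule constant_if_quadratic_modulus[where H = "\<lambda>s. pairing (\<lambda>x. \<psi> (x - travel s)) s"])
      show "convex {0<..t}" by simp
    qed (use that t in \<open>auto intro: K\<close>)
    have "\<forall>\<^sub>F s in at_right 0. pairing (\<lambda>x. \<psi> (x - travel t)) t = pairing (\<lambda>x. \<psi> (x - travel s)) s"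
      unfolding eventually_at_right_field
      by (intro exI[of _ t] conjI allI impI c[symmetric]) (use t in auto)
    then have "((\<lambda>s. pairing (\<lambda>x. \<psi> (x - travel s)) s) \<longlongrightarrow> pairing (\<lambda>x. \<psi> (x - travel t)) t) (at_right 0)"
      by (rule Lim_transform_eventually[OF tendsto_const])
    then show ?thesis
      by (rule tendsto_unique[rotated, OF _ initial_limit[OF _ u0 \<psi>]]) (use t in auto)
  qed
  have u0': "integrable lebesgue (\<lambda>x. u0 (x - travel t))"
    using lebesgue_integrable_real_affine[OF u0, of 1 "- travel t"] by simp
  have tt: "t \<in> {0..<T'}" using t by simp
  have "AE x in lebesgue. u t x - u0 (x - travel t) = 0"
  proof (rule AE_zero_if_orthogonal_test_functions)
    show "integrable lebesgue (\<lambda>x. u t x - u0 (x - travel t))" using u0' u_integrable[OF tt] by simp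
    fix \<psi> assume \<psi>: "\<psi> \<in> test_functions (UNIV :: real set)"
    define \<phi> where "\<phi> x = \<psi> (x + travel t)" for x
    have \<phi>: "\<phi> \<in> test_functions UNIV" using test_function_shift(1)[OF \<psi>, of "- travel t"] by (simp add: \<phi>_def[abs_def])
    obtain C where C: "\<And>x. \<bar>\<psi> x\<bar> \<le> C" using test_function_bounded[OF \<psi>] by blast
    have i: "integrable lebesgue (\<lambda>x. u0 (x - travel t) * \<psi> x)"
      by (rule integrable_mult_bounded_lebesgue[OF u0' borel_measurable_lebesgue_continuous[OF test_function_continuous[OF \<psi>]] C])
    have "(LINT x|lebesgue. u t x * \<psi> x) = (LINT x|lebesgue. u0 x * \<phi> x)"
      using *[OF \<phi>] by (simp add: \<phi>_def[abs_def] pairing_def)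
    also have "\<dots> = (LINT x|lebesgue. u0 (x - travel t) * \<psi> x)"
      using lebesgue_integral_real_affine[of 1 "\<lambda>x. u0 x * \<phi> x" "- travel t"] by (simp add: \<phi>_def)
    finally show "(LINT x|lebesgue. (u t x - u0 (x - travel t)) * \<psi> x) = 0"
      using i u_mult_test_integrable[OF tt \<psi>] by (simp add: left_diff_distrib)
  qed
  then show ?thesis by simp
qed

end

section \<open>Sobolev regularity of compactly supported functions\<close>

lemma integrable_imp_locally_integrable:
  "integrable lebesgue f \<Longrightarrow> f locally_integrable_on \<Omega>"
  unfolding locally_integrable_on_def set_integrable_def
  by (intro allI impI integrable_mult_indicator sets_completionI_sets) (auto intro: borel_compact)

lemma frechet_derivative_real_test_function:
  fixes \<phi> :: "real \<Rightarrow> real"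
  assumes "\<phi> \<in> test_functions \<Omega>"
  shows "frechet_derivative \<phi> (at x) 1 = deriv \<phi> x"
  using frechet_derivative_at[OF test_function_DERIV[OF assms, unfolded has_field_derivative_def], of x, symmetric]
  by simp

lemma weak_derivative_on_compact_support:
  fixes f f' :: "real \<Rightarrow> real"
  assumes d: "\<And>x. (f has_real_derivative f' x) (at x)" and c: "continuous_on UNIV f'"
    and s: "\<And>x. B < \<bar>x\<bar> \<Longrightarrow> f x = 0"
  shows "weak_derivative_on UNIV 1 f f'"
  unfolding weak_derivative_on_def
proof (intro conjI ballI)
  have cf: "continuous_on UNIV f" using d by (auto intro!: continuous_at_imp_continuous_on DERIV_isCont)
  have fK: "f x = 0" if "x \<notin> {-B..B}" for x using that by (intro s) auto
  have f'K: "f' x = 0" if "x \<notin> {-B..B}" for x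
    by (rule deriv_outside_support[OF d closed_atLeastAtMost fK that])
  show "f locally_integrable_on UNIV"
    by (intro integrable_imp_locally_integrable integrable_lebesgue_compact_support[OF cf compact_Icc fK])
  show "f' locally_integrable_on UNIV"
    by (intro integrable_imp_locally_integrable integrable_lebesgue_compact_support[OF c compact_Icc f'K])
  fix \<phi> :: "real \<Rightarrow> real" assume \<phi>: "\<phi> \<in> test_functions UNIV"
  note c\<phi> = test_function_continuous[OF \<phi>] and c\<phi>' = test_function_continuous[OF test_function_deriv[OF \<phi>]]
  have c1: "continuous_on UNIV (\<lambda>x. f x * deriv \<phi> x)" and c2: "continuous_on UNIV (\<lambda>x. f' x * \<phi> x)"
    by (intro continuous_intros cf c c\<phi> c\<phi>')+
  have z1: "f x * deriv \<phi> x = 0" and z2: "f' x * \<phi> x = 0" if "x \<notin> {-B..B}" for x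
    using fK[OF that] f'K[OF that] by simp_all
  have i1: "integrable lborel (\<lambda>x. f x * deriv \<phi> x)"
    by (rule integrable_lborel_compact_support[OF c1 compact_Icc z1])
  have i2: "integrable lborel (\<lambda>x. f' x * \<phi> x)"
    by (rule integrable_lborel_compact_support[OF c2 compact_Icc z2])
  have "(LINT x|lborel. f x * deriv \<phi> x + f' x * \<phi> x) = 0"
  proof (rule integral_deriv_compact_support)
    show "((\<lambda>x. f x * \<phi> x) has_real_derivative f x * deriv \<phi> x + f' x * \<phi> x) (at x)" for x
      using DERIV_mult[OF d test_function_DERIV[OF \<phi>]] by (simp add: add.commute mult.commute)
    show "f x * \<phi> x = 0" if "B < \<bar>x\<bar>" for x using s[OF that] by simp
  qed (intro continuous_on_add c1 c2)
  then have "(LINT x|lborel. f x * deriv \<phi> x) = - (LINT x|lborel. f' x * \<phi> x)"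
    using i1 i2 by simp
  then show "(LINT x:UNIV|lebesgue. f x * frechet_derivative \<phi> (at x) 1) = - (LINT x:UNIV|lebesgue. f' x * \<phi> x)"
    by (simp add: set_lebesgue_integral_def frechet_derivative_real_test_function[OF \<phi>]
        integral_lebesgue_eq_lborel[OF c1] integral_lebesgue_eq_lborel[OF c2])
qed

lemma C2_compact_support_in_Sobolev:
  fixes f f' f'' :: "real \<Rightarrow> real"
  assumes d: "\<And>x. (f has_real_derivative f' x) (at x)" and d': "\<And>x. (f' has_real_derivative f'' x) (at x)"
    and c: "continuous_on UNIV f''" and s: "\<And>x. B < \<bar>x\<bar> \<Longrightarrow> f x = 0"
  shows "f \<in> W_1_infty \<inter> W_2_1"
proof -
  have cf: "continuous_on UNIV f" using d by (auto intro!: continuous_at_imp_continuous_on DERIV_isCont)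
  have cf': "continuous_on UNIV f'" using d' by (auto intro!: continuous_at_imp_continuous_on DERIV_isCont)
  have fK: "f x = 0" if "x \<notin> {-B..B}" for x using that by (intro s) auto
  have f'K: "f' x = 0" if "x \<notin> {-B..B}" for x
    by (rule deriv_outside_support[OF d closed_atLeastAtMost fK that])
  have f''K: "f'' x = 0" if "x \<notin> {-B..B}" for x
    by (rule deriv_outside_support[OF d' closed_atLeastAtMost f'K that])
  have s': "f' x = 0" if "B < \<bar>x\<bar>" for x using that by (intro f'K) auto
  obtain C where C: "\<And>x. \<bar>f x\<bar> \<le> C" using compact_support_bounded[OF cf compact_Icc fK] by blast
  obtain C' where C': "\<And>x. \<bar>f' x\<bar> \<le> C'" using compact_support_bounded[OF cf' compact_Icc f'K] by blast
  have L: "f \<in> Linfty" "f' \<in> Linfty"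
    using C C' borel_measurable_lebesgue_continuous[OF cf] borel_measurable_lebesgue_continuous[OF cf']
    by (auto simp: Linfty_def)
  note w = weak_derivative_on_compact_support[OF d cf' s] weak_derivative_on_compact_support[OF d' c s']
  note i = integrable_lebesgue_compact_support[OF cf compact_Icc fK]
    integrable_lebesgue_compact_support[OF cf' compact_Icc f'K]
    integrable_lebesgue_compact_support[OF c compact_Icc f''K]
  have "f \<in> W_1_infty"
    unfolding W_1_infty_def by (intro CollectI conjI bexI[of _ f'] L) (rule w(1))
  moreover have "f \<in> W_2_1"
    unfolding W_2_1_def by (intro CollectI conjI exI[of _ f'] exI[of _ f''] i w)
  ultimately show ?thesis by blast
qed

section \<open>Travelling waves\<close>

lemma test_function_frechet:
  assumes \<phi>: "\<phi> \<in> test_functions (\<Omega> :: 'a::euclidean_space set)"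
  shows "(\<phi> has_derivative frechet_derivative \<phi> (at p)) (at p)"
    and "continuous_on UNIV (\<lambda>p. frechet_derivative \<phi> (at p) h)"
proof -
  from test_function_smooth[OF \<phi>, of "Suc 0"] obtain f' where
    *: "\<And>x. (\<phi> has_derivative f' x) (at x)" "\<And>h. continuous_on UNIV (\<lambda>x. f' x h)"
    unfolding C_k_on.simps by auto
  have "frechet_derivative \<phi> (at p) = f' p" for p using frechet_derivative_at[OF *(1)] by simp
  then show "(\<phi> has_derivative frechet_derivative \<phi> (at p)) (at p)"
    "continuous_on UNIV (\<lambda>p. frechet_derivative \<phi> (at p) h)" using * by simp_all
qed

lemma test_function_frechet_outside:
  assumes "compact K" "\<And>x. x \<notin> K \<Longrightarrow> \<phi> x = 0" "p \<notin> K"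
  shows "frechet_derivative \<phi> (at p) h = (0::real)"
proof -
  have "(\<phi> has_derivative (\<lambda>h. 0)) (at p)"
    by (rule has_derivative_transform_within_open[of "\<lambda>_. 0" _ _ _ "- K"])
      (use assms in \<open>auto simp: compact_imp_closed open_Compl\<close>)
  from frechet_derivative_at[OF this, symmetric] show ?thesis by simp
qed

text \<open>In the coordinate \<open>y = x - c t\<close> the factor \<open>g\<close> does not depend on \<open>t\<close>, and \<open>\<partial>\<^sub>t + c \<partial>\<^sub>x\<close> becomes the
  derivative with respect to \<open>t\<close>, whose integral over the line is \<open>0\<close>.\<close>

lemma travelling_wave_weak_form:
  fixes g :: "real \<Rightarrow> real"
  assumes g: "continuous_on UNIV g" and \<phi>: "\<phi> \<in> test_functions (\<Omega> :: (real \<times> real) set)"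
  shows "(LINT p|lebesgue. g (snd p - c * fst p) *
      (frechet_derivative \<phi> (at p) (1, 0) + c * frechet_derivative \<phi> (at p) (0, 1))) = 0"
proof -
  define D where "D p = frechet_derivative \<phi> (at p) (1, c)" for p
  have Dsplit: "frechet_derivative \<phi> (at p) (1, 0) + c * frechet_derivative \<phi> (at p) (0, 1) = D p" for p
  proof -
    have l: "linear (frechet_derivative \<phi> (at p))"
      using test_function_frechet(1)[OF \<phi>] by (rule has_derivative_linear)
    have "(1, c) = (1, 0) + c *\<^sub>R (0, 1 :: real)" by simp
    then have "D p = frechet_derivative \<phi> (at p) ((1, 0) + c *\<^sub>R (0, 1))"
      unfolding D_def by (rule arg_cong)
    then show ?thesis by (simp only: linear_add[OF l] linear_cmul[OF l] real_scaleR_def)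
  qed
  obtain K where K: "compact K" "\<And>x. x \<notin> K \<Longrightarrow> \<phi> x = 0" using test_function_support[OF \<phi>] by metis
  obtain R where R: "0 < R" "\<And>p. p \<in> K \<Longrightarrow> norm p \<le> R" using compact_imp_bounded[OF K(1)] by (auto simp: bounded_pos)
  have Kz: "\<phi> p = 0" if "R < norm p" for p using R(2)[of p] K(2)[of p] that by force
  have Dz: "D p = 0" if "R < norm p" for p
    unfolding D_def using test_function_frechet_outside[OF K, where p = p] R(2)[of p] that by force
  have Dc: "continuous_on UNIV D" unfolding D_def[abs_def] by (rule test_function_frechet(2)[OF \<phi>])
  define f where "f p = g (snd p - c * fst p) * D p" for p
  define h where "h q = g (snd q) * D (fst q, snd q + c * fst q)" for q
  have fc: "continuous_on UNIV f" unfolding f_def[abs_def]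
    by (intro continuous_intros continuous_on_compose2[OF g] Dc) auto
  have hc: "continuous_on UNIV h" unfolding h_def[abs_def]
    by (intro continuous_intros continuous_on_compose2[OF g] continuous_on_compose2[OF Dc]) auto
  have fi: "integrable lborel f"
    by (rule integrable_lborel_compact_support[OF fc compact_cball[of 0 R]]) (auto simp: f_def Dz)
  have hi: "integrable lborel h"
  proof (rule integrable_lborel_compact_support[OF hc])
    show "compact ({-R..R} \<times> {- (R + \<bar>c\<bar> * R)..R + \<bar>c\<bar> * R})" by (intro compact_Times compact_Icc)
    fix q assume q: "q \<notin> {-R..R} \<times> {- (R + \<bar>c\<bar> * R)..R + \<bar>c\<bar> * R}"
    have "R < norm (fst q, snd q + c * fst q)"
    proof (rule ccontr)
      assume "\<not> ?thesis"
      then have "\<bar>fst q\<bar> \<le> R" "\<bar>snd q + c * fst q\<bar> \<le> R"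
        using norm_fst_le[of "fst q" "snd q + c * fst q"] norm_snd_le[of "snd q + c * fst q" "fst q"] by auto
      moreover have "\<bar>c * fst q\<bar> \<le> \<bar>c\<bar> * R" unfolding abs_mult using calculation by (intro mult_left_mono) auto
      ultimately have "q \<in> {-R..R} \<times> {- (R + \<bar>c\<bar> * R)..R + \<bar>c\<bar> * R}" by (cases q) auto
      with q show False by simp
    qed
    then show "h q = 0" by (simp add: h_def Dz)
  qed
  have hz: "(LINT t|lborel. h (t, y)) = 0" for y
  proof -
    have "(LINT t|lborel. D (t, y + c * t)) = 0"
    proof (rule integral_deriv_compact_support)
      show "((\<lambda>t. \<phi> (t, y + c * t)) has_real_derivative D (t, y + c * t)) (at t)" for t
      proof -
        \<comment> \<open>the derivative in direction \<open>(1, c)\<close> is the derivative along the line \<open>x = y + c t\<close>\<close>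
        have 1: "((\<lambda>t. (t, y + c * t)) has_derivative (\<lambda>h. (h, c * h))) (at t)"
          by (auto intro!: derivative_eq_intros)
        have "((\<lambda>t. \<phi> (t, y + c * t)) has_derivative (\<lambda>h. frechet_derivative \<phi> (at (t, y + c * t)) (h, c * h))) (at t)"
          using has_derivative_compose[OF 1 test_function_frechet(1)[OF \<phi>]] .
        moreover have "frechet_derivative \<phi> (at (t, y + c * t)) (h, c * h) = D (t, y + c * t) * h" for h
          using linear_cmul[OF has_derivative_linear[OF test_function_frechet(1)[OF \<phi>]], of "(t, y + c * t)" h "(1, c)"]
          by (simp add: D_def mult.commute)
        ultimately show ?thesis by (simp add: has_field_derivative_def)
      qed
      show "continuous_on UNIV (\<lambda>t. D (t, y + c * t))"
        by (intro continuous_on_compose2[OF Dc] continuous_intros) auto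
      show "\<phi> (t, y + c * t) = 0" if "R < \<bar>t\<bar>" for t
        using norm_fst_le[of t "y + c * t"] that by (intro Kz) auto
    qed
    then show ?thesis by (simp add: h_def)
  qed
  have "(LINT p|lebesgue. f p) = (LINT p|(lborel \<Otimes>\<^sub>M lborel). f p)"
    unfolding lborel_prod by (rule integral_lebesgue_eq_lborel[OF fc])
  also have "\<dots> = (LINT t|lborel. LINT x|lborel. f (t, x))"
    using lborel_pair.integral_fst'[of f] fi by (simp add: lborel_prod)
  also have "\<dots> = (LINT t|lborel. LINT y|lborel. h (t, y))"
  proof (rule Bochner_Integration.integral_cong[OF refl])
    fix t
    show "(LINT x|lborel. f (t, x)) = (LINT y|lborel. h (t, y))"
      using lborel_integral_real_affine[of 1 "\<lambda>x. f (t, x)" "c * t"] by (simp add: f_def h_def add.commute)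
  qed
  also have "\<dots> = (LINT y|lborel. LINT t|lborel. h (t, y))"
    using lborel_pair.Fubini_integral[of "\<lambda>t y. h (t, y)"] hi by (simp add: lborel_prod)
  also have "\<dots> = 0" by (simp add: hz)
  finally show ?thesis by (simp add: f_def Dsplit)
qed

text \<open>Here \<open>k a\<close> does not depend on \<open>x\<close>, so its distributional derivative is \<open>0\<close>. The entropy expression is
  \<open>\<bar>w(x - c t) - k\<bar> (\<partial>\<^sub>t \<phi> + c \<partial>\<^sub>x \<phi>)\<close>, and the entropy inequality holds with equality.\<close>

lemma travelling_wave_kruzkov:
  fixes w w' :: "real \<Rightarrow> real"
  assumes T': "0 < T'" and a: "\<And>t. t \<in> {0..<T'} \<Longrightarrow> a t = c"
    and d: "\<And>x. (w has_real_derivative w' x) (at x)" and c': "continuous_on UNIV w'"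
    and s: "\<And>x. B < \<bar>x\<bar> \<Longrightarrow> w x = 0"
  shows "kruzkov_solution T' (\<lambda>t x. a t) (\<lambda>t x. 0) w (\<lambda>t x. w (x - c * t))"
proof -
  let ?u = "\<lambda>t x. w (x - c * t)"
  let ?\<Omega> = "{0<..<T'} \<times> (UNIV :: real set)"
  have cw: "continuous_on UNIV w" using d by (auto intro!: continuous_at_imp_continuous_on DERIV_isCont)
  have wK: "w x = 0" if "x \<notin> {-B..B}" for x using that by (intro s) auto
  have w'K: "w' x = 0" if "x \<notin> {-B..B}" for x
    by (rule deriv_outside_support[OF d closed_atLeastAtMost wK that])
  have wi: "integrable lebesgue w" by (rule integrable_lebesgue_compact_support[OF cw compact_Icc wK])
  obtain M where M: "\<And>x. \<bar>w x\<bar> \<le> M" using compact_support_bounded[OF cw compact_Icc wK] by metis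
  obtain M' where M': "0 \<le> M'" "\<And>x. \<bar>w' x\<bar> \<le> M'" using compact_support_bounded[OF c' compact_Icc w'K] by metis
  have lip: "\<bar>w x - w y\<bar> \<le> M' * \<bar>x - y\<bar>" for x y
    using field_differentiable_bound[of UNIV w w' M' x y] M' d by auto
  have ui: "integrable lebesgue (?u t)" for t
    using lebesgue_integrable_real_affine[OF wi, of 1 "- c * t"] by simp
  have uL1: "(LINT x|lebesgue. \<bar>?u t x\<bar>) = (LINT x|lebesgue. \<bar>w x\<bar>)" for t
    using lebesgue_integral_real_affine[of 1 "\<lambda>x. \<bar>w x\<bar>" "- c * t"] by simp
  have rc: "((\<lambda>s. LINT x|lebesgue. \<bar>?u s x - ?u t x\<bar>) \<longlongrightarrow> 0) (at_right t)" for t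
  proof (rule Lim_null_comparison)
    \<comment> \<open>both waves vanish outside \<open>[-R,R]\<close> as long as \<open>\<bar>r\<bar> \<le> \<bar>t\<bar> + 1\<close>\<close>
    define R where "R = \<bar>B\<bar> + \<bar>c\<bar> * (\<bar>t\<bar> + 1)"
    have R0: "0 \<le> R" by (simp add: R_def)
    have "((\<lambda>s. M' * (\<bar>c\<bar> * \<bar>s - t\<bar>) * (2 * R)) \<longlongrightarrow> M' * (\<bar>c\<bar> * \<bar>t - t\<bar>) * (2 * R)) (at_right t)"
      by (intro tendsto_intros)
    then show "((\<lambda>s. M' * (\<bar>c\<bar> * \<bar>s - t\<bar>) * (2 * R)) \<longlongrightarrow> 0) (at_right t)" by simp
    have "\<forall>\<^sub>F s in at_right t. s \<in> {t<..<t + 1}"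
      by (auto simp: eventually_at_right_field intro!: exI[of _ "t + 1"])
    then show "\<forall>\<^sub>F s in at_right t. norm (LINT x|lebesgue. \<bar>?u s x - ?u t x\<bar>) \<le> M' * (\<bar>c\<bar> * \<bar>s - t\<bar>) * (2 * R)"
    proof eventually_elim
      case (elim r)
      have "(LINT x|lebesgue. \<bar>?u r x - ?u t x\<bar>) \<le> (LINT x|lebesgue. M' * (\<bar>c\<bar> * \<bar>r - t\<bar>) * indicator {-R..R} x)"
      proof (rule integral_mono)
        show "integrable lebesgue (\<lambda>x. \<bar>?u r x - ?u t x\<bar>)"
          by (intro integrable_abs Bochner_Integration.integrable_diff ui)
        show "integrable lebesgue (\<lambda>x. M' * (\<bar>c\<bar> * \<bar>r - t\<bar>) * indicator {-R..R} x :: real)"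
          using R0 by (intro integrable_mult_right integrable_real_indicator) (auto simp: emeasure_lborel_Icc_eq)
        fix x
        show "\<bar>?u r x - ?u t x\<bar> \<le> M' * (\<bar>c\<bar> * \<bar>r - t\<bar>) * indicator {-R..R} x"
        proof (cases "x \<in> {-R..R}")
          case True
          have "(x - c * r) - (x - c * t) = c * (t - r)" by (simp add: algebra_simps)
          then show ?thesis using lip[of "x - c * r" "x - c * t"] True
            by (simp add: abs_mult abs_minus_commute[of t r])
        next
          case False
          have "B < \<bar>x - c * q\<bar>" if "\<bar>q\<bar> \<le> \<bar>t\<bar> + 1" for q
          proof -
            have "\<bar>c * q\<bar> \<le> \<bar>c\<bar> * (\<bar>t\<bar> + 1)" unfolding abs_mult using that by (intro mult_left_mono) auto
            then show ?thesis using False by (auto simp: R_def)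
          qed
          moreover have "\<bar>r\<bar> \<le> \<bar>t\<bar> + 1" using elim by auto
          ultimately have "B < \<bar>x - c * r\<bar>" "B < \<bar>x - c * t\<bar>" by auto
          then show ?thesis using False s by simp
        qed
      qed
      also have "\<dots> = M' * (\<bar>c\<bar> * \<bar>r - t\<bar>) * (2 * R)" using R0 by simp
      finally show ?case by simp
    qed
  qed
  have cu: "continuous_on UNIV (\<lambda>(t, x). ?u t x)"
    unfolding case_prod_beta by (intro continuous_on_compose2[OF cw] continuous_intros) auto
  have entropy: "\<exists>D. weak_derivative_on ?\<Omega> (0, 1) (\<lambda>(t, x). k * a t + 0) D \<and>
        (\<forall>\<phi>\<in>test_functions ?\<Omega>. (\<forall>p. 0 \<le> \<phi> p) \<longrightarrow>
           0 \<le> (LINT (t, x):?\<Omega>|lebesgue.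
                  ((?u t x - k) * frechet_derivative \<phi> (at (t, x)) (1, 0)
                   + (?u t x - k) * a t * frechet_derivative \<phi> (at (t, x)) (0, 1)
                   - D (t, x) * \<phi> (t, x)) * sgn (?u t x - k)))" for k
  proof (intro exI[of _ "\<lambda>_. 0"] conjI ballI impI)
    have out: "frechet_derivative \<phi> (at p) h = 0" if "\<phi> \<in> test_functions ?\<Omega>" "p \<notin> ?\<Omega>" for \<phi> p h
      using test_function_support[OF that(1)] test_function_frechet_outside that(2) by (metis subsetD)
    show "weak_derivative_on ?\<Omega> (0, 1) (\<lambda>(t, x). k * a t + 0) (\<lambda>_. 0)"
      unfolding weak_derivative_on_def
    proof (intro conjI ballI)
      show "(\<lambda>_. 0) locally_integrable_on ?\<Omega>" by (simp add: integrable_imp_locally_integrable)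
      show "(\<lambda>(t, x). k * a t + 0) locally_integrable_on ?\<Omega>"
        unfolding locally_integrable_on_def
      proof (intro allI impI)
        fix K assume K: "compact K \<and> K \<subseteq> ?\<Omega>"
        have "integrable lborel (\<lambda>p. indicator K p *\<^sub>R (k * c))"
          using K by (intro borel_integrable_compact) auto
        then have "integrable lebesgue (\<lambda>p. indicator K p *\<^sub>R (k * c))"
          by (subst integrable_completion) auto
        moreover have "indicator K p *\<^sub>R (case p of (t, x) \<Rightarrow> k * a t + 0) = indicator K p *\<^sub>R (k * c)" for p
          using K a by (cases p; cases "p \<in> K") auto
        ultimately show "(\<lambda>(t, x). k * a t + 0) absolutely_integrable_on K"
          by (simp only: set_integrable_def)
      qed
      fix \<phi> assume \<phi>: "\<phi> \<in> test_functions ?\<Omega>"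
      have c1: "continuous_on UNIV (\<lambda>p. frechet_derivative \<phi> (at p) (1, 0))" "continuous_on UNIV (\<lambda>p. frechet_derivative \<phi> (at p) (0, 1))"
        by (rule test_function_frechet(2)[OF \<phi>])+
      have i1: "integrable lebesgue (\<lambda>p. frechet_derivative \<phi> (at p) h)" for h
        using test_function_support[OF \<phi>] test_function_frechet_outside
          integrable_lebesgue_compact_support[OF test_function_frechet(2)[OF \<phi>]] by metis
      have "(LINT p|lebesgue. frechet_derivative \<phi> (at p) (0, 1)) = 0"
        using travelling_wave_weak_form[OF continuous_on_const[of UNIV 1] \<phi>, of 0]
          travelling_wave_weak_form[OF continuous_on_const[of UNIV 1] \<phi>, of 1] i1 by simp
      moreover have "(LINT p:?\<Omega>|lebesgue. (case p of (t, x) \<Rightarrow> k * a t + 0) * frechet_derivative \<phi> (at p) (0, 1))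
          = (LINT p|lebesgue. k * c * frechet_derivative \<phi> (at p) (0, 1))"
        unfolding set_lebesgue_integral_def
      proof (rule Bochner_Integration.integral_cong[OF refl])
        fix p :: "real \<times> real"
        show "indicator ?\<Omega> p *\<^sub>R ((case p of (t, x) \<Rightarrow> k * a t + 0) * frechet_derivative \<phi> (at p) (0, 1))
            = k * c * frechet_derivative \<phi> (at p) (0, 1)"
          using out[OF \<phi>, of p] a by (cases p; cases "p \<in> ?\<Omega>") auto
      qed
      ultimately show "(LINT p:?\<Omega>|lebesgue. (case p of (t, x) \<Rightarrow> k * a t + 0) * frechet_derivative \<phi> (at p) (0, 1))
          = - (LINT p:?\<Omega>|lebesgue. 0 * \<phi> p)" by (simp add: set_lebesgue_integral_def)
    qed
    fix \<phi> :: "real \<times> real \<Rightarrow> real" assume \<phi>: "\<phi> \<in> test_functions ?\<Omega>"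
    let ?L = "(LINT (t, x):?\<Omega>|lebesgue.
                  ((?u t x - k) * frechet_derivative \<phi> (at (t, x)) (1, 0)
                   + (?u t x - k) * a t * frechet_derivative \<phi> (at (t, x)) (0, 1)
                   - 0 * \<phi> (t, x)) * sgn (?u t x - k))"
    have "?L
       = (LINT p|lebesgue. \<bar>w (snd p - c * fst p) - k\<bar> *
          (frechet_derivative \<phi> (at p) (1, 0) + c * frechet_derivative \<phi> (at p) (0, 1)))"
      unfolding set_lebesgue_integral_def
    proof (rule Bochner_Integration.integral_cong[OF refl])
      fix p :: "real \<times> real"
      obtain t x where p: "p = (t, x)" by (cases p)
      show "indicator ?\<Omega> p *\<^sub>R (case p of (t, x) \<Rightarrow> ((?u t x - k) * frechet_derivative \<phi> (at (t, x)) (1, 0)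
                   + (?u t x - k) * a t * frechet_derivative \<phi> (at (t, x)) (0, 1)
                   - 0 * \<phi> (t, x)) * sgn (?u t x - k)) = \<bar>w (snd p - c * fst p) - k\<bar> *
          (frechet_derivative \<phi> (at p) (1, 0) + c * frechet_derivative \<phi> (at p) (0, 1))"
        using out[OF \<phi>, of p] a[of t] unfolding p
        by (cases "(t, x) \<in> ?\<Omega>") (auto simp: abs_sgn[of "w (x - c * t) - k"] algebra_simps)
    qed
    also have "\<dots> = 0"
      using travelling_wave_weak_form[OF _ \<phi>, of "\<lambda>y. \<bar>w y - k\<bar>" c] cw by (simp add: continuous_intros)
    finally show "0 \<le> ?L" by simp
  qed
  have initial: "((\<lambda>t. LINT x:{-\<delta>..\<delta>}|lebesgue. \<bar>?u t x - w x\<bar>) \<longlongrightarrow> 0) (at_right 0)" if "0 < \<delta>" for \<delta>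
  proof (rule Lim_null_comparison)
    show "((\<lambda>s. LINT x|lebesgue. \<bar>?u s x - ?u 0 x\<bar>) \<longlongrightarrow> 0) (at_right 0)" by (rule rc)
    show "\<forall>\<^sub>F t in at_right 0. norm (LINT x:{-\<delta>..\<delta>}|lebesgue. \<bar>?u t x - w x\<bar>) \<le> (LINT x|lebesgue. \<bar>?u t x - ?u 0 x\<bar>)"
    proof (intro always_eventually allI)
      fix t
      have i: "integrable lebesgue (\<lambda>x. \<bar>?u t x - w x\<bar>)"
        by (intro integrable_abs Bochner_Integration.integrable_diff ui wi)
      have "0 \<le> (LINT x:{-\<delta>..\<delta>}|lebesgue. \<bar>?u t x - w x\<bar>)"
        unfolding set_lebesgue_integral_def by (intro integral_nonneg_AE) simp
      moreover have "(LINT x:{-\<delta>..\<delta>}|lebesgue. \<bar>?u t x - w x\<bar>) \<le> (LINT x|lebesgue. \<bar>?u t x - w x\<bar>)"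
        unfolding set_lebesgue_integral_def using i
        by (intro integral_mono integrable_mult_indicator) (auto simp: indicator_def)
      ultimately show "norm (LINT x:{-\<delta>..\<delta>}|lebesgue. \<bar>?u t x - w x\<bar>) \<le> (LINT x|lebesgue. \<bar>?u t x - ?u 0 x\<bar>)"
        by simp
    qed
  qed
  show ?thesis
    unfolding kruzkov_solution_def
  proof (intro conjI allI ballI)
    show "\<exists>M. \<forall>t\<in>{0..<T'}. \<forall>x. \<bar>?u t x\<bar> \<le> M" using M by blast
    show "(\<lambda>(t, x). ?u t x) \<in> borel_measurable (lebesgue_on ({0..<T'} \<times> UNIV))"
      by (intro measurable_restrict_space1 borel_measurable_lebesgue_continuous cu)
    show "\<exists>M. \<forall>t\<in>{0..<T'}. (LINT x|lebesgue. \<bar>?u t x\<bar>) \<le> M"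
      by (intro exI[of _ "LINT x|lebesgue. \<bar>w x\<bar>"]) (simp add: uL1)
    show "w locally_integrable_on UNIV" by (rule integrable_imp_locally_integrable[OF wi])
  qed (use ui rc entropy initial in auto)
qed

section \<open>Every profile is reachable\<close>

text \<open>The sum of the translates of \<open>g\<close> by \<open>-N, ..., N\<close>. The cut-off keeps the support compact, and the
  function agrees with the periodic extension of a profile on \<open>]0,1[\<close> in the interval \<open>[-N, N + 1]\<close>.\<close>

definition periodization :: "nat \<Rightarrow> (real \<Rightarrow> real) \<Rightarrow> real \<Rightarrow> real" where
  "periodization N g x = (\<Sum>i<2 * N + 1. g (x + real N - real i))"

lemma periodization_DERIV:
  assumes "\<And>x. (g has_real_derivative g' x) (at x)"
  shows "(periodization N g has_real_derivative periodization N g' x) (at x)"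
  unfolding periodization_def[abs_def]
proof (intro DERIV_sum)
  fix i
  have "((\<lambda>x. x + real N - real i) has_real_derivative 1) (at x)" by (auto intro!: derivative_eq_intros)
  from DERIV_chain2[OF assms this]
  show "((\<lambda>x. g (x + real N - real i)) has_real_derivative g' (x + real N - real i)) (at x)" by simp
qed

lemma periodization_continuous:
  assumes "continuous_on UNIV g"
  shows "continuous_on UNIV (periodization N g)"
  unfolding periodization_def[abs_def]
  by (intro continuous_on_sum continuous_on_compose2[OF assms] continuous_intros) auto

lemma periodization_outside:
  assumes g: "\<And>x. x \<notin> {0<..<1} \<Longrightarrow> g x = 0" and x: "real N + 1 < \<bar>x\<bar>"
  shows "periodization N g x = 0"
  unfolding periodization_def
proof (intro sum.neutral ballI g)
  fix i assume "i \<in> {..<2 * N + 1}"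
  then have "real i \<le> 2 * real N" by auto
  then show "x + real N - real i \<notin> {0<..<1}" using x by auto
qed

lemma periodization_on_unit_interval:
  assumes g: "\<And>x. x \<notin> {0<..<1} \<Longrightarrow> g x = 0" and x: "x \<in> {0..1}"
  shows "periodization N g x = g x"
proof -
  have "periodization N g x = (\<Sum>i<2 * N + 1. if i = N then g x else 0)"
    unfolding periodization_def
  proof (rule sum.cong[OF refl])
    fix i
    have "x + real N - real i \<notin> {0<..<1}" if "i \<noteq> N"
    proof (cases "i < N")
      case True then have "real i + 1 \<le> real N" by linarith
      then show ?thesis using x by auto
    next
      case False then have "real N + 1 \<le> real i" using that by linarith
      then show ?thesis using x by auto
    qed
    then show "g (x + real N - real i) = (if i = N then g x else 0)" using g by auto
  qed
  then show ?thesis by simp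
qed

lemma mass01_continuous: "continuous_on UNIV f \<Longrightarrow> mass01 f = integral {0..1} f"
  unfolding mass01_def
  by (intro set_lebesgue_integral_eq_integral(2) absolutely_integrable_continuous_real) (auto intro: continuous_on_subset)

text \<open>The masses of the translates in the window are consecutive differences of a primitive of \<open>g\<close>. Their
  sum telescopes to the integral over an interval that contains \<open>[0,1]\<close>.\<close>

lemma periodization_window_mass:
  assumes c: "continuous_on UNIV g" and g: "\<And>x. x \<notin> {0<..<1} \<Longrightarrow> g x = 0" and s: "\<bar>s\<bar> \<le> real N"
  shows "mass01 (\<lambda>x. periodization N g (x - s)) = mass01 g"
proof -
  define K where "K = 2 * real N + 2"
  define Q where "Q z = integral {-K..z} g" for z
  have gi: "g integrable_on {a..b}" for a b
    using c by (intro integrable_continuous_interval) (auto intro: continuous_on_subset)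
  have Qd: "integral {y..z} g = Q z - Q y" if "-K \<le> y" "y \<le> z" for y z
    using Henstock_Kurzweil_Integration.integral_combine[OF that gi] by (simp add: Q_def)
  define f where "f i = Q (1 - s + real N - real i)" for i :: nat
  have shift: "integral {0..1} (\<lambda>x. g (x - s + real N - real i)) = f i - f (Suc i)" if i: "i < 2 * N + 1" for i
  proof -
    have "integral {0..1} (g \<circ> (\<lambda>x. x + (real N - real i - s))) = integral {0 + (real N - real i - s)..1 + (real N - real i - s)} g"
      by (rule integral_shift) (rule continuous_on_subset[OF c subset_UNIV])
    moreover have "\<dots> = Q (1 + (real N - real i - s)) - Q (0 + (real N - real i - s))"
      using i s by (intro Qd) (auto simp: K_def)
    moreover have "(g \<circ> (\<lambda>x. x + (real N - real i - s))) = (\<lambda>x. g (x - s + real N - real i))"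
      by (auto simp: o_def algebra_simps)
    ultimately show ?thesis by (simp add: f_def algebra_simps)
  qed
  have "mass01 (\<lambda>x. periodization N g (x - s)) = integral {0..1} (\<lambda>x. periodization N g (x - s))"
    by (intro mass01_continuous continuous_on_compose2[OF periodization_continuous[OF c]] continuous_intros) auto
  also have "\<dots> = (\<Sum>i<2 * N + 1. integral {0..1} (\<lambda>x. g (x - s + real N - real i)))"
    unfolding periodization_def
    by (intro integral_sum integrable_continuous_interval continuous_on_compose2[OF c] continuous_intros) auto
  also have "\<dots> = (\<Sum>i<2 * N + 1. f i - f (Suc i))" using shift by (intro sum.cong) auto
  also have "\<dots> = f 0 - f (2 * N + 1)" by (rule sum_lessThan_telescope')
  also have "\<dots> = integral {-s - real N - 1 + 1..1 - s + real N} g"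
    using s by (subst Qd) (auto simp: f_def K_def algebra_simps)
  also have "\<dots> = integral {0..1} g"
  proof -
    have "integral {-s - real N..1 - s + real N} g
        = integral {-s - real N..0} g + (integral {0..1} g + integral {1..1 - s + real N} g)"
      using s by (simp add: Henstock_Kurzweil_Integration.integral_combine gi)
    moreover have "integral {-s - real N..0} g = 0" "integral {1..1 - s + real N} g = 0"
      by (intro integral_unique has_integral_is_0 g; simp)+
    ultimately show ?thesis by simp
  qed
  finally show ?thesis using mass01_continuous[OF c] by simp
qed

lemma kruzkov_solution_bounds:
  assumes "kruzkov_solution T' a b u0 u"
  obtains M L where "0 \<le> M" "\<And>t x. t \<in> {0..<T'} \<Longrightarrow> \<bar>u t x\<bar> \<le> M"
    "0 \<le> L" "\<And>t. t \<in> {0..<T'} \<Longrightarrow> (LINT x|lebesgue. \<bar>u t x\<bar>) \<le> L"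
proof -
  note kr = assms[unfolded kruzkov_solution_def]
  from kr[THEN conjunct1] kr[THEN conjunct2, THEN conjunct2, THEN conjunct2, THEN conjunct1] obtain M L where "\<forall>t\<in>{0..<T'}. \<forall>x. \<bar>u t x\<bar> \<le> M" "\<forall>t\<in>{0..<T'}. (LINT x|lebesgue. \<bar>u t x\<bar>) \<le> L"
    by blast
  then show thesis using that[of "max 0 M" "max 0 L"] by (simp add: le_max_iff_disj)
qed

text \<open>A travelling wave solves the nonlinear equation for the periodized profile. The solution selected by
  the semigroup is some translate of the datum. Its window has mass \<open>m\<close>, and it moves with speed
  \<open>c\<close>, as long as the window stays in the periodic part. At the first time at which the displacement
  reaches \<open>\<bar>c\<bar>(T + 1) + 1\<close> it would have moved with speed \<open>c\<close> throughout, hence not that far.\<close>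

lemma unit_profile_reachable:
  fixes g g' g'' :: "real \<Rightarrow> real"
  assumes S: "generates_semigroup vmax S" and T: "0 < T"
    and d: "\<And>x. (g has_real_derivative g' x) (at x)" and d': "\<And>x. (g' has_real_derivative g'' x) (at x)"
    and c'': "continuous_on UNIV g''" and g0: "\<And>x. x \<notin> {0<..<1} \<Longrightarrow> g x = 0"
    and mass: "mass01 g \<noteq> -1"
  obtains \<sigma> where "\<sigma> \<in> W_1_infty \<inter> W_2_1" "\<exists>T'>T. \<exists>\<rho>. weak_entropy_solution vmax T' \<sigma> \<rho>"
    "AE x in lebesgue. x \<in> {0..1} \<longrightarrow> S T \<sigma> x = g x"
proof -
  define c where "c = speed vmax (mass01 g)"
  define N where "N = nat \<lceil>\<bar>c\<bar> * T + \<bar>c\<bar> * (T + 1) + 1\<rceil>"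
  \<comment> \<open>room for the initial offset \<open>c T\<close>, for the motion up to time \<open>T + 1\<close>, and for a margin of \<open>1\<close>\<close>
  have N: "\<bar>c\<bar> * T + \<bar>c\<bar> * (T + 1) + 1 \<le> real N" unfolding N_def by (rule real_nat_ceiling_ge)
  define P where "P = periodization N g"
  have cg: "continuous_on UNIV g" using d by (auto intro!: continuous_at_imp_continuous_on DERIV_isCont)
  have cg': "continuous_on UNIV g'" using d' by (auto intro!: continuous_at_imp_continuous_on DERIV_isCont)
  have dP: "(P has_real_derivative periodization N g' x) (at x)"
    and dP': "(periodization N g' has_real_derivative periodization N g'' x) (at x)" for x
    unfolding P_def by (rule periodization_DERIV[OF d] periodization_DERIV[OF d'])+
  have cP'': "continuous_on UNIV (periodization N g'')" and cP': "continuous_on UNIV (periodization N g')"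
    by (rule periodization_continuous[OF c''] periodization_continuous[OF cg'])+
  define \<sigma> where "\<sigma> x = P (x + c * T)" for x
  define \<sigma>1 where "\<sigma>1 x = periodization N g' (x + c * T)" for x
  define \<sigma>2 where "\<sigma>2 x = periodization N g'' (x + c * T)" for x
  have sh: "((\<lambda>x. x + c * T) has_real_derivative 1) (at x)" for x by (auto intro!: derivative_eq_intros)
  have d\<sigma>: "(\<sigma> has_real_derivative \<sigma>1 x) (at x)" "(\<sigma>1 has_real_derivative \<sigma>2 x) (at x)" for x
    using DERIV_chain2[OF dP sh] DERIV_chain2[OF dP' sh] by (simp_all add: \<sigma>_def[abs_def] \<sigma>1_def[abs_def] \<sigma>2_def)
  have c\<sigma>: "continuous_on UNIV \<sigma>1" "continuous_on UNIV \<sigma>2"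
    unfolding \<sigma>1_def[abs_def] \<sigma>2_def[abs_def]
    by (intro continuous_on_compose2[OF cP'] continuous_on_compose2[OF cP''] continuous_intros; simp)+
  have \<sigma>0: "\<sigma> x = 0" if "real N + 1 + \<bar>c * T\<bar> < \<bar>x\<bar>" for x
    unfolding \<sigma>_def P_def using that by (intro periodization_outside g0) auto
  have \<sigma>W: "\<sigma> \<in> W_1_infty \<inter> W_2_1"
    by (rule C2_compact_support_in_Sobolev[OF d\<sigma> c\<sigma>(2) \<sigma>0])
  have window: "mass01 (\<lambda>x. \<sigma> (x - y)) = mass01 g" if "\<bar>y\<bar> \<le> \<bar>c\<bar> * (T + 1) + 1" for y
  proof -
    have "\<bar>c * T\<bar> = \<bar>c\<bar> * T" using T by (simp add: abs_mult)
    then have "\<bar>y - c * T\<bar> \<le> real N" using that N by linarith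
    from periodization_window_mass[OF cg g0 this] show ?thesis
      by (simp add: \<sigma>_def P_def algebra_simps)
  qed
  have ct: "\<bar>c * t\<bar> \<le> \<bar>c\<bar> * (T + 1)" if "t \<in> {0..T + 1}" for t
    unfolding abs_mult using that by (intro mult_left_mono) auto
  have wes: "weak_entropy_solution vmax (T + 1) \<sigma> (\<lambda>t x. \<sigma> (x - c * t))"
    unfolding weak_entropy_solution_def
  proof (intro conjI ballI)
    have w: "mass01 (\<lambda>x. \<sigma> (x - c * t)) = mass01 g" if "t \<in> {0..<T + 1}" for t
      using ct[of t] that by (intro window) auto
    show "mass01 (\<lambda>x. \<sigma> (x - c * t)) \<noteq> -1" if "t \<in> {0..<T + 1}" for t using w[OF that] mass by simp
    show "kruzkov_solution (T + 1) (\<lambda>t x. speed vmax (mass01 (\<lambda>x. \<sigma> (x - c * t)))) (\<lambda>t x. 0) \<sigma> (\<lambda>t x. \<sigma> (x - c * t))"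
      by (rule travelling_wave_kruzkov[OF _ _ d\<sigma>(1) c\<sigma>(1) \<sigma>0]) (use T w in \<open>auto simp: c_def\<close>)
  qed
  define u where "u t = S t \<sigma>" for t
  define a where "a t = speed vmax (mass01 (u t))" for t
  have "weak_entropy_solution vmax (T + 1) \<sigma> u"
  proof -
    have "0 < T + 1" using T by simp
    with S wes have "weak_entropy_solution vmax (T + 1) \<sigma> (\<lambda>t. S t \<sigma>)"
      unfolding generates_semigroup_def by blast
    then show ?thesis by (simp add: u_def[abs_def])
  qed
  then have nz: "\<And>t. t \<in> {0..<T + 1} \<Longrightarrow> mass01 (u t) \<noteq> -1"
    and kr: "kruzkov_solution (T + 1) (\<lambda>t x. a t) (\<lambda>t x. 0) \<sigma> u"
    by (simp_all add: weak_entropy_solution_def a_def)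
  obtain M L where bd: "0 \<le> M" "\<And>t x. t \<in> {0..<T + 1} \<Longrightarrow> \<bar>u t x\<bar> \<le> M"
    "0 \<le> L" "\<And>t. t \<in> {0..<T + 1} \<Longrightarrow> (LINT x|lebesgue. \<bar>u t x\<bar>) \<le> L"
    using kruzkov_solution_bounds[OF kr] by blast
  interpret kruzkov_transport "T + 1" a \<sigma> u M L
    by unfold_locales (fact kr bd)+
  have cm: "continuous_on {0..<T + 1} (\<lambda>t. mass01 (u t))"
    unfolding mass01_def by (rule interval_mass_continuous) simp
  have ca: "continuous_on {0..<T + 1} a"
    unfolding a_def[abs_def] speed_def using cm nz by (intro continuous_intros) (auto simp: add_eq_0_iff)
  interpret kruzkov_transport_continuous "T + 1" a \<sigma> u M L
    by unfold_locales (rule ca)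
  have \<sigma>i: "integrable lebesgue \<sigma>" using \<sigma>W by (simp add: W_2_1_def)
  have at: "a t = c" if t: "0 < t" "t < T + 1" "\<bar>travel t\<bar> \<le> \<bar>c\<bar> * (T + 1) + 1" for t
  proof -
    have "mass01 (u t) = mass01 (\<lambda>x. \<sigma> (x - travel t))"
      unfolding mass01_def
    proof (rule set_lebesgue_integral_cong_AE)
      show "AE x\<in>{0..1} in lebesgue. u t x = \<sigma> (x - travel t)" using transported_along_characteristics[OF \<sigma>i t(1,2)] by eventually_elim simp
      show "u t \<in> borel_measurable lebesgue" using u_integrable[of t] t by auto
      show "(\<lambda>x. \<sigma> (x - travel t)) \<in> borel_measurable lebesgue"
        using lebesgue_integrable_real_affine[OF \<sigma>i, of 1 "- travel t"] by (simp add: borel_measurable_integrable)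
    qed auto
    then show ?thesis using window[OF t(3)] by (simp add: a_def c_def)
  qed
  have Xlin: "travel t = c * t" if t: "0 \<le> t" "t < T + 1" and s: "\<And>s. 0 < s \<Longrightarrow> s < t \<Longrightarrow> \<bar>travel s\<bar> \<le> \<bar>c\<bar> * (T + 1) + 1" for t
  proof -
    have "travel t = integral {0..t} (\<lambda>_. c)"
      unfolding travel_def
    proof (rule integral_spike[of "{0, t}"])
      fix x assume "x \<in> {0..t} - {0, t}"
      then show "c = a x" using at[of x] s[of x] t by auto
    qed simp
    then show ?thesis using t by simp
  qed
  have Xb: "\<bar>travel t\<bar> \<le> \<bar>c\<bar> * (T + 1) + 1" if t: "t \<in> {0..T}" for t
  proof (rule ccontr)
    let ?R = "\<bar>c\<bar> * (T + 1) + 1"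
    assume big: "\<not> \<bar>travel t\<bar> \<le> ?R"
    define B where "B = {t \<in> {0..T}. ?R \<le> \<bar>travel t\<bar>}"
    have "continuous_on {0..T} travel"
      unfolding travel_def[abs_def] by (intro indefinite_integral_continuous_1 a_integrable_on) auto
    then have "closed B" unfolding B_def by (intro continuous_on_closed_Collect_le continuous_intros) auto
    moreover have "B \<subseteq> {0..T}" by (auto simp: B_def)
    ultimately have "compact B" using compact_Int_closed[of "{0..T}" B] by (simp add: Int_absorb1)
    moreover have "B \<noteq> {}" using big t by (auto simp: B_def)
    ultimately have "\<exists>t1\<in>B. \<forall>s\<in>B. t1 \<le> s" by (rule compact_attains_inf)
    then obtain t1 where t1: "t1 \<in> B" "\<And>s. s \<in> B \<Longrightarrow> t1 \<le> s" by blast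
    have "travel t1 = c * t1"
    proof (rule Xlin)
      fix s assume "0 < s" "s < t1"
      then show "\<bar>travel s\<bar> \<le> ?R" using t1(2)[of s] t1(1) by (force simp: B_def)
    qed (use t1 in \<open>auto simp: B_def\<close>)
    then show False using t1(1) ct[of t1] by (auto simp: B_def)
  qed
  have "travel T = c * T" using T by (intro Xlin Xb) auto
  then have "AE x in lebesgue. u T x = P x"
    using transported_along_characteristics[OF \<sigma>i T] by (simp add: \<sigma>_def)
  then have "AE x in lebesgue. x \<in> {0..1} \<longrightarrow> S T \<sigma> x = g x"
    by eventually_elim (use periodization_on_unit_interval[OF g0] in \<open>auto simp: P_def u_def\<close>)
  moreover have "\<exists>T'>T. \<exists>\<rho>. weak_entropy_solution vmax T' \<sigma> \<rho>"
    using wes by (intro exI[of _ "T + 1"]) auto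
  ultimately show thesis using \<sigma>W by (intro that)
qed

section \<open>Density of the reachable profiles\<close>

text \<open>The exponent is at least \<open>2\<close>, so the two branches also have a common derivative at \<open>0\<close>.\<close>

lemma cut_power_DERIV:
  fixes s :: real
  shows "((\<lambda>s. (max 0 s) ^ Suc (Suc n)) has_real_derivative real (Suc (Suc n)) * (max 0 s) ^ Suc n) (at s)"
proof -
  consider "s < 0" | "s = 0" | "0 < s" by linarith
  then show ?thesis
  proof cases
    case 1
    have "((\<lambda>s. (max 0 s) ^ Suc (Suc n)) has_real_derivative 0) (at s)"
      by (rule has_field_derivative_transform_within_open[of "\<lambda>_. 0" _ _ "{..<0}"]) (use 1 in auto)
    then show ?thesis using 1 by simp
  next
    case 3
    have "((\<lambda>s. s ^ Suc (Suc n)) has_real_derivative real (Suc (Suc n)) * s ^ Suc n) (at s)"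
      using DERIV_pow[of "Suc (Suc n)" s] by simp
    then have "((\<lambda>s. (max 0 s) ^ Suc (Suc n)) has_real_derivative real (Suc (Suc n)) * s ^ Suc n) (at s)"
      by (rule has_field_derivative_transform_within_open[of _ _ _ "{0<..}"]) (use 3 in auto)
    then show ?thesis using 3 by simp
  next
    case 2
    have "((\<lambda>h. (max 0 h) ^ Suc (Suc n) / h) \<longlongrightarrow> 0) (at (0::real))"
    proof (rule Lim_null_comparison)
      show "\<forall>\<^sub>F h in at (0::real). norm ((max 0 h) ^ Suc (Suc n) / h) \<le> \<bar>h\<bar> ^ Suc n"
      proof (intro always_eventually allI)
        fix h :: real
        show "norm ((max 0 h) ^ Suc (Suc n) / h) \<le> \<bar>h\<bar> ^ Suc n"
        proof (cases "h \<le> 0")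
          case True
          then have "max 0 h = 0" by simp
          then have "norm ((max 0 h) ^ Suc (Suc n) / h) = 0" by simp
          then show ?thesis by (simp only: zero_le_power abs_ge_zero)
        qed simp
      qed
      have "((\<lambda>h::real. \<bar>h\<bar> ^ Suc n) \<longlongrightarrow> \<bar>0\<bar> ^ Suc n) (at 0)" by (intro tendsto_intros)
      then show "((\<lambda>h::real. \<bar>h\<bar> ^ Suc n) \<longlongrightarrow> 0) (at 0)" by simp
    qed
    then show ?thesis using 2 by (simp add: DERIV_def)
  qed
qed

text \<open>The third power is the smallest integer power for which the cut-off at \<open>0\<close> and \<open>1\<close> is twice continuously
  differentiable.\<close>

definition hump :: "real \<Rightarrow> real" where "hump x = (max 0 (x * (1 - x))) ^ 3"

lemma hump_outside: "x \<notin> {0<..<1} \<Longrightarrow> hump x = 0"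
proof -
  assume "x \<notin> {0<..<1}"
  then have "x * (1 - x) \<le> 0" by (auto simp: mult_le_0_iff)
  then show ?thesis by (simp add: hump_def)
qed

lemma hump_pos: "x \<in> {0<..<1} \<Longrightarrow> 0 < hump x" by (simp add: hump_def)

lemma hump_range: "0 \<le> hump x" "hump x \<le> 1"
proof -
  have "x * (1 - x) = 1/4 - (x - 1/2)\<^sup>2" by (simp add: power2_eq_square algebra_simps)
  moreover have "0 \<le> (x - 1/2)\<^sup>2" by simp
  ultimately have "x * (1 - x) \<le> 1" by linarith
  then have "max 0 (x * (1 - x)) \<le> 1" by simp
  then show "hump x \<le> 1" unfolding hump_def by (intro power_le_one) auto
qed (simp add: hump_def)

lemma hump_continuous: "continuous_on UNIV hump"
  unfolding hump_def[abs_def] by (intro continuous_intros)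

lemma hump_times_polynomial_C2:
  assumes p: "real_polynomial_function p"
  obtains g' g'' where "\<And>x. ((\<lambda>x. hump x * p x) has_real_derivative g' x) (at x)"
    "\<And>x. (g' has_real_derivative g'' x) (at x)" "continuous_on UNIV g''"
proof -
  have "\<exists>q'. real_polynomial_function q' \<and> (\<forall>x. (q has_real_derivative q' x) (at x))"
    if "real_polynomial_function q" for q
    using has_real_derivative_polynomial_function[OF that] by metis
  then obtain p' p'' where p': "real_polynomial_function p'" "\<And>x. (p has_real_derivative p' x) (at x)"
    and p'': "real_polynomial_function p''" "\<And>x. (p' has_real_derivative p'' x) (at x)"
    using p by metis
  define l where "l x = x * (1 - x)" for x :: real
  have l: "(l has_real_derivative 1 - 2 * x) (at x)" for x
    unfolding l_def[abs_def] by (auto intro!: derivative_eq_intros)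
  have q: "((\<lambda>x. (max 0 (l x)) ^ 3) has_real_derivative 3 * (max 0 (l x))\<^sup>2 * (1 - 2 * x)) (at x)" for x
    using DERIV_chain2[OF cut_power_DERIV[of 1 "l x"] l] by (simp add: numeral_eq_Suc)
  have q': "((\<lambda>x. (max 0 (l x))\<^sup>2) has_real_derivative 2 * max 0 (l x) * (1 - 2 * x)) (at x)" for x
    using DERIV_chain2[OF cut_power_DERIV[of 0 "l x"] l] by (simp add: numeral_eq_Suc)
  have cl: "continuous_on UNIV l" unfolding l_def[abs_def] by (intro continuous_intros)
  have cp: "continuous_on UNIV r" if "real_polynomial_function r" for r :: "real \<Rightarrow> real"
    using that by (intro continuous_on_polymonial_function) (simp add: real_polynomial_function_eq)
  define g' where "g' x = (max 0 (l x)) ^ 3 * p' x + 3 * (max 0 (l x))\<^sup>2 * (1 - 2 * x) * p x" for x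
  define g'' where "g'' x = (max 0 (l x)) ^ 3 * p'' x + 3 * (max 0 (l x))\<^sup>2 * (1 - 2 * x) * p' x +
     (3 * ((max 0 (l x))\<^sup>2 * ((1 - 2 * x) * p' x + (- 2) * p x) + 2 * max 0 (l x) * (1 - 2 * x) * ((1 - 2 * x) * p x)))" for x
  show thesis
  proof (rule that[of g' g''])
    show "((\<lambda>x. hump x * p x) has_real_derivative g' x) (at x)" for x
      using DERIV_mult[OF q p'(2), of x] by (simp add: hump_def l_def g'_def algebra_simps)
    have m: "((\<lambda>x. 1 - 2 * x) has_real_derivative (- 2)) (at x)" for x :: real by (auto intro!: derivative_eq_intros)
    show "(g' has_real_derivative g'' x) (at x)" for x
      using DERIV_add[OF DERIV_mult[OF q p''(2)] DERIV_cmult[OF DERIV_mult[OF q' DERIV_mult[OF m p'(2)]], of 3], of x]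
      by (simp add: g'_def[abs_def] g''_def algebra_simps)
    show "continuous_on UNIV g''" unfolding g''_def[abs_def]
      by (intro continuous_intros cl cp p p' p'')
  qed
qed

lemma square_diff_le: "(x - z)\<^sup>2 \<le> 2 * (x - y)\<^sup>2 + 2 * (y - z)\<^sup>2" for x y z :: real
proof -
  have "2 * (x - y)\<^sup>2 + 2 * (y - z)\<^sup>2 - (x - z)\<^sup>2 = ((x - y) - (y - z))\<^sup>2"
    by (simp add: power2_eq_square algebra_simps)
  then show ?thesis using zero_le_power2[of "(x - y) - (y - z)"] by linarith
qed

lemma truncation_L2_approximation:
  fixes D :: "real \<Rightarrow> real"
  assumes D: "D \<in> borel_measurable lebesgue" "integrable lebesgue (\<lambda>x. (D x)\<^sup>2)" and e: "0 < e"
  obtains n :: nat where "integrable lebesgue (\<lambda>x. (D x - max (- real n) (min (real n) (D x)))\<^sup>2)"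
    "(LINT x|lebesgue. (D x - max (- real n) (min (real n) (D x)))\<^sup>2) < e"
proof -
  define s where "s n x = (D x - max (- real n) (min (real n) (D x)))\<^sup>2" for n x
  have sm: "s n \<in> borel_measurable lebesgue" for n unfolding s_def[abs_def] using D(1) by measurable
  have sb: "\<bar>s n x\<bar> \<le> (D x)\<^sup>2" for n x
  proof -
    have "\<bar>D x - max (- real n) (min (real n) (D x))\<bar> \<le> \<bar>D x\<bar>" by (auto simp: max_def min_def abs_if)
    then show ?thesis unfolding s_def by (simp add: abs_le_square_iff)
  qed
  have "(\<lambda>n. LINT x|lebesgue. s n x) \<longlonglongrightarrow> (LINT x|(lebesgue :: real measure). (0::real))"
  proof (rule integral_dominated_convergence[where s=s and f="\<lambda>_. 0" and w="\<lambda>x. (D x)\<^sup>2"])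
    show "AE x in lebesgue. (\<lambda>n. s n x) \<longlonglongrightarrow> 0"
    proof (intro AE_I2 tendsto_eventually)
      fix x
      obtain N where "\<bar>D x\<bar> < real N" using reals_Archimedean2 by blast
      then have "s n x = 0" if "N \<le> n" for n
      proof -
        have "\<bar>D x\<bar> < real n" using that \<open>\<bar>D x\<bar> < real N\<close> by linarith
        then have "max (- real n) (min (real n) (D x)) = D x" by auto
        then show ?thesis by (simp add: s_def)
      qed
      then show "\<forall>\<^sub>F n in sequentially. s n x = 0" by (auto simp: eventually_sequentially)
    qed
  qed (use D sm sb in auto)
  then have "\<forall>\<^sub>F n in sequentially. (LINT x|lebesgue. s n x) < e" using e by (intro order_tendstoD) auto
  then obtain n where "(LINT x|lebesgue. s n x) < e" by (auto simp: eventually_sequentially)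
  moreover have "integrable lebesgue (s n)"
    by (rule Bochner_Integration.integrable_bound[OF D(2) sm]) (use sb in auto)
  ultimately show thesis using that[of n] by (simp add: s_def[abs_def])
qed

text \<open>A measurable function is almost everywhere a limit of continuous functions \<open>h\<^sub>k\<close>, which may be
  truncated. The quotients \<open>h\<^sub>k / (hump + 1/(k+1))\<close> are continuous although the hump vanishes at the
  end points, and multiplied by the hump they still converge in \<open>]0,1[\<close>.\<close>

lemma bounded_hump_approximation:
  fixes B :: "real \<Rightarrow> real"
  assumes B: "B \<in> borel_measurable lebesgue" "\<And>x. \<bar>B x\<bar> \<le> n" and e: "0 < e"
  obtains F where "continuous_on UNIV F"
    "(LINT x|lebesgue. indicator {0..1} x * (B x - hump x * F x)\<^sup>2) < e"
proof -
  have n0: "0 \<le> n" using B(2)[of 0] by linarith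
  have "B measurable_on UNIV" using lebesgue_measurable_imp_measurable_on_real[OF B(1), of UNIV] by simp
  then obtain N h where N: "negligible N" and h: "\<And>k. continuous_on UNIV (h k)"
    "\<And>x. x \<notin> N \<Longrightarrow> (\<lambda>k. h k x) \<longlonglongrightarrow> B x"
    unfolding measurable_on_def by auto
  define cl where "cl y = max (- n) (min n y)" for y
  define F where "F k x = cl (h k x) / (hump x + 1 / (real k + 1))" for k x
  have den: "0 < hump x + 1 / (real k + 1)" for k x
    using hump_range(1)[of x] by (intro add_nonneg_pos) auto
  have Fc: "continuous_on UNIV (F k)" for k
    unfolding F_def[abs_def] cl_def using den[of _ k]
    by (intro continuous_intros h hump_continuous) (auto simp: less_imp_neq[symmetric])
  have clb: "\<bar>cl y\<bar> \<le> n" for y using n0 by (auto simp: cl_def)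
  have clB: "cl (B x) = B x" for x using B(2)[of x] by (auto simp: cl_def)
  have hFb: "\<bar>hump x * F k x\<bar> \<le> n" for k x
  proof -
    have "\<bar>hump x / (hump x + 1 / (real k + 1))\<bar> \<le> 1"
      using hump_range(1)[of x] den[of x k] by (simp add: divide_le_eq)
    from mult_mono[OF this clb[of "h k x"]] show ?thesis
      by (simp add: F_def abs_mult mult.commute)
  qed
  define s where "s k x = indicator {0..1} x * (B x - hump x * F k x)\<^sup>2" for k x
  have sm: "s k \<in> borel_measurable lebesgue" for k
    unfolding s_def[abs_def] using B(1) borel_measurable_lebesgue_continuous[OF Fc] borel_measurable_lebesgue_continuous[OF hump_continuous]
    by (intro borel_measurable_times borel_measurable_indicator borel_measurable_power borel_measurable_diff) auto
  have "(\<lambda>k. LINT x|lebesgue. s k x) \<longlonglongrightarrow> (LINT x|(lebesgue :: real measure). (0::real))"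
  proof (rule integral_dominated_convergence[where w="\<lambda>x. indicator {0..1} x * (2 * n)\<^sup>2"])
    show "integrable lebesgue (\<lambda>x. indicator {0..1::real} x * (2 * n)\<^sup>2)"
      by (intro integrable_mult_left integrable_real_indicator) auto
    show "AE x in lebesgue. norm (s k x) \<le> indicator {0..1} x * (2 * n)\<^sup>2" for k
    proof (intro AE_I2)
      fix x
      have "\<bar>B x - hump x * F k x\<bar> \<le> \<bar>2 * n\<bar>" using B(2)[of x] hFb[of x k] by linarith
      then have "(B x - hump x * F k x)\<^sup>2 \<le> (2 * n)\<^sup>2" by (simp only: abs_le_square_iff)
      then show "norm (s k x) \<le> indicator {0..1} x * (2 * n)\<^sup>2" by (simp add: s_def indicator_def)
    qed
    have "AE x in lebesgue. x \<noteq> (0::real)" "AE x in lebesgue. x \<noteq> (1::real)"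
      by (intro AE_completion AE_lborel_singleton)+
    moreover have "AE x in lebesgue. x \<notin> N"
      using N by (simp add: negligible_iff_null_sets AE_not_in)
    ultimately show "AE x in lebesgue. (\<lambda>k. s k x) \<longlonglongrightarrow> 0"
    proof eventually_elim
      case (elim x)
      show ?case
      proof (cases "x \<in> {0..1}")
        case True
        then have hp: "0 < hump x" using elim by (intro hump_pos) auto
        have "(\<lambda>k. 1 / (real k + 1)) \<longlonglongrightarrow> 0" using LIMSEQ_inverse_real_of_nat by (simp add: divide_inverse add.commute)
        then have "(\<lambda>k. (B x - hump x * (cl (h k x) / (hump x + 1 / (real k + 1))))\<^sup>2)
            \<longlonglongrightarrow> (B x - hump x * (cl (B x) / (hump x + 0)))\<^sup>2"
          unfolding cl_def using hp h(2)[OF elim(3)] by (intro tendsto_intros) auto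
        then show ?thesis using True hp by (simp add: s_def F_def clB)
      qed (simp add: s_def)
    qed
  qed (use sm in auto)
  then have "\<forall>\<^sub>F k in sequentially. (LINT x|lebesgue. s k x) < e" using e by (intro order_tendstoD) auto
  then obtain k where "(LINT x|lebesgue. s k x) < e" by (auto simp: eventually_sequentially)
  then show thesis using that[OF Fc[of k]] by (simp add: s_def)
qed

lemma integrable_unit_continuous:
  fixes f :: "real \<Rightarrow> real"
  assumes "continuous_on UNIV f"
  shows "integrable lebesgue (\<lambda>x. indicator {0..1} x * f x)"
proof -
  have "set_integrable lebesgue {0..1} f"
    using assms by (intro absolutely_integrable_continuous_real) (auto intro: continuous_on_subset)
  then show ?thesis by (simp add: set_integrable_def)
qed

lemma polynomial_continuous:
  "real_polynomial_function p \<Longrightarrow> continuous_on UNIV (p :: real \<Rightarrow> real)"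
  by (intro continuous_on_polymonial_function) (simp add: real_polynomial_function_eq)

text \<open>Three errors are added: from \<open>d\<close> to a bounded truncation, from there to a continuous multiple of the
  hump, and from the continuous factor to a polynomial, by the theorem of Weierstrass.\<close>

lemma L2_hump_polynomial_approximation:
  fixes d :: "real \<Rightarrow> real"
  assumes m: "set_borel_measurable lebesgue {0..1} d"
    and i: "set_integrable lebesgue {0..1} (\<lambda>x. (d x)\<^sup>2)" and e: "0 < e"
  obtains p where "real_polynomial_function p"
    "(LINT x:{0..1}|lebesgue. (d x - hump x * p x)\<^sup>2) < e"
proof -
  define D where "D x = indicator {0..1} x * d x" for x :: real
  have Dm: "D \<in> borel_measurable lebesgue" using m by (simp add: D_def[abs_def] set_borel_measurable_def)
  have D2: "(D x)\<^sup>2 = indicator {0..1} x *\<^sub>R (d x)\<^sup>2" for x by (simp add: D_def indicator_def)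
  have Di: "integrable lebesgue (\<lambda>x. (D x)\<^sup>2)" using i by (simp add: D2 set_integrable_def)
  obtain n :: nat where n: "integrable lebesgue (\<lambda>x. (D x - max (- real n) (min (real n) (D x)))\<^sup>2)"
    "(LINT x|lebesgue. (D x - max (- real n) (min (real n) (D x)))\<^sup>2) < e / 8"
    using truncation_L2_approximation[OF Dm Di, of "e / 8"] e by auto
  define B where "B x = max (- real n) (min (real n) (D x))" for x
  have Bm: "B \<in> borel_measurable lebesgue" unfolding B_def[abs_def] using Dm by measurable
  have Bb: "\<bar>B x\<bar> \<le> real n" for x by (auto simp: B_def)
  obtain F where F: "continuous_on UNIV F" "(LINT x|lebesgue. indicator {0..1} x * (B x - hump x * F x)\<^sup>2) < e / 16"
    using bounded_hump_approximation[OF Bm Bb, of "e / 16"] e by auto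
  define \<delta> where "\<delta> = min 1 (e / 16)"
  have \<delta>: "0 < \<delta>" "\<delta>\<^sup>2 \<le> e / 16"
  proof -
    show d0: "0 < \<delta>" using e by (simp add: \<delta>_def)
    have "\<delta>\<^sup>2 \<le> 1 * \<delta>" unfolding power2_eq_square using d0 by (intro mult_right_mono) (auto simp: \<delta>_def)
    then show "\<delta>\<^sup>2 \<le> e / 16" by (auto simp: \<delta>_def)
  qed
  obtain p where p: "real_polynomial_function p" "\<And>x. x \<in> {0..1} \<Longrightarrow> \<bar>F x - p x\<bar> < \<delta>"
    using Stone_Weierstrass_real_polynomial_function[OF compact_Icc continuous_on_subset[OF F(1) subset_UNIV] \<delta>(1)] by metis
  note pc = polynomial_continuous[OF p(1)]
  let ?I = "indicator {0..1} :: real \<Rightarrow> real"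
  have iB: "integrable lebesgue (\<lambda>x. ?I x * (B x - hump x * F x)\<^sup>2)"
  proof -
    have Bi: "integrable lebesgue (\<lambda>x. ?I x * B x * B x)"
    proof (rule Bochner_Integration.integrable_bound)
      show "integrable lebesgue (\<lambda>x. ?I x * (real n * real n))"
        by (intro integrable_mult_left integrable_real_indicator) auto
      show "(\<lambda>x. ?I x * B x * B x) \<in> borel_measurable lebesgue"
        using Bm by (intro borel_measurable_times borel_measurable_indicator) auto
      show "AE x in lebesgue. norm (?I x * B x * B x) \<le> norm (?I x * (real n * real n))"
      proof (intro AE_I2)
        fix x
        have "\<bar>B x\<bar> * \<bar>B x\<bar> \<le> real n * real n" by (intro mult_mono Bb) auto
        then show "norm (?I x * B x * B x) \<le> norm (?I x * (real n * real n))"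
          by (simp add: abs_mult indicator_def)
      qed
    qed
    have hF: "continuous_on UNIV (\<lambda>x. hump x * F x)" by (intro continuous_intros hump_continuous F)
    have c: "integrable lebesgue (\<lambda>x. ?I x * (hump x * F x))" "integrable lebesgue (\<lambda>x. ?I x * (hump x * F x)\<^sup>2)"
      by (intro integrable_unit_continuous continuous_intros hF)+
    have "integrable lebesgue (\<lambda>x. ?I x * (hump x * F x) * B x)"
      by (rule integrable_mult_bounded_lebesgue[OF c(1) Bm Bb])
    then have "integrable lebesgue (\<lambda>x. ?I x * B x * B x - 2 * (?I x * (hump x * F x) * B x) + ?I x * (hump x * F x)\<^sup>2)"
      using Bi c(2) by (intro Bochner_Integration.integrable_add Bochner_Integration.integrable_diff integrable_mult_right)
    moreover have "?I x * B x * B x - 2 * (?I x * (hump x * F x) * B x) + ?I x * (hump x * F x)\<^sup>2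
        = ?I x * (B x - hump x * F x)\<^sup>2" for x
      by (simp add: power2_eq_square algebra_simps)
    ultimately show ?thesis by (simp only:)
  qed
  have "(LINT x:{0..1}|lebesgue. (d x - hump x * p x)\<^sup>2)
      \<le> (LINT x|lebesgue. 2 * (D x - B x)\<^sup>2 + (4 * (?I x * (B x - hump x * F x)\<^sup>2) + ?I x * (4 * \<delta>\<^sup>2)))"
    unfolding set_lebesgue_integral_def
  proof (rule integral_mono_AE')
    show "integrable lebesgue (\<lambda>x. 2 * (D x - B x)\<^sup>2 + (4 * (?I x * (B x - hump x * F x)\<^sup>2) + ?I x * (4 * \<delta>\<^sup>2)))"
      using n(1) iB unfolding B_def
      by (intro Bochner_Integration.integrable_add integrable_mult_right
          integrable_mult_left integrable_real_indicator) auto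
    show "AE x in lebesgue. indicator {0..1} x *\<^sub>R (d x - hump x * p x)\<^sup>2
        \<le> 2 * (D x - B x)\<^sup>2 + (4 * (?I x * (B x - hump x * F x)\<^sup>2) + ?I x * (4 * \<delta>\<^sup>2))"
    proof (intro AE_I2)
      fix x
      show "indicator {0..1} x *\<^sub>R (d x - hump x * p x)\<^sup>2
        \<le> 2 * (D x - B x)\<^sup>2 + (4 * (?I x * (B x - hump x * F x)\<^sup>2) + ?I x * (4 * \<delta>\<^sup>2))"
      proof (cases "x \<in> {0..1}")
        case True
        have "\<bar>hump x * F x - hump x * p x\<bar> \<le> 1 * \<delta>"
          unfolding right_diff_distrib[symmetric] abs_mult using hump_range[of x] p(2)[OF True]
          by (intro mult_mono) auto
        then have "(hump x * F x - hump x * p x)\<^sup>2 \<le> \<delta>\<^sup>2"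
          using power_mono[of "\<bar>hump x * F x - hump x * p x\<bar>" \<delta> 2] by simp
        then show ?thesis
          using True square_diff_le[of "d x" "hump x * p x" "B x"] square_diff_le[of "B x" "hump x * p x" "hump x * F x"]
          by (simp add: D_def)
      qed simp
    qed
  qed simp
  also have "\<dots> = 2 * (LINT x|lebesgue. (D x - B x)\<^sup>2) + (4 * (LINT x|lebesgue. ?I x * (B x - hump x * F x)\<^sup>2) + 4 * \<delta>\<^sup>2)"
  proof -
    have "integrable lebesgue (\<lambda>x. ?I x * (4 * \<delta>\<^sup>2))"
      by (intro integrable_mult_left integrable_real_indicator) auto
    then show ?thesis using n(1) iB by (simp add: B_def)
  qed
  also have "\<dots> < e" using n(2)[folded B_def] F(2) \<delta>(2) e by linarith
  finally show thesis using that[OF p(1)] by simp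
qed

text \<open>If the mass of the approximation happens to be \<open>-1\<close>, multiplication by a number slightly larger
  than \<open>1\<close> changes it.\<close>

lemma L2_hump_polynomial_approximation_mass:
  fixes d :: "real \<Rightarrow> real"
  assumes m: "set_borel_measurable lebesgue {0..1} d"
    and i: "set_integrable lebesgue {0..1} (\<lambda>x. (d x)\<^sup>2)" and e: "0 < e"
  obtains p where "real_polynomial_function p" "mass01 (\<lambda>x. hump x * p x) \<noteq> -1"
    "(LINT x:{0..1}|lebesgue. (d x - hump x * p x)\<^sup>2) < e"
proof -
  obtain p where p: "real_polynomial_function p"
    "(LINT x:{0..1}|lebesgue. (d x - hump x * p x)\<^sup>2) < e / 4"
    using L2_hump_polynomial_approximation[OF m i, of "e / 4"] e by auto
  let ?I = "indicator {0..1} :: real \<Rightarrow> real"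
  define Q where "Q = (LINT x|lebesgue. ?I x * (hump x * p x)\<^sup>2)"
  define \<delta> where "\<delta> = min 1 (e / (8 * (\<bar>Q\<bar> + 1)))"
  have cg: "continuous_on UNIV (\<lambda>x. hump x * p x)"
    by (intro continuous_intros hump_continuous polynomial_continuous p)
  show thesis
  proof (cases "mass01 (\<lambda>x. hump x * p x) = -1")
    case False
    then show thesis using that[OF p(1)] p(2) e by simp
  next
    case True
    have \<delta>0: "0 < \<delta>" using e by (simp add: \<delta>_def)
    define q where "q x = (1 + \<delta>) * p x" for x
    have q: "real_polynomial_function q" unfolding q_def[abs_def] using p(1) by (intro real_polynomial_function.intros(4) real_polynomial_function.intros(2))
    have "mass01 (\<lambda>x. hump x * q x) = (1 + \<delta>) * mass01 (\<lambda>x. hump x * p x)"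
      by (simp add: mass01_def set_lebesgue_integral_def q_def mult.left_commute[of _ "1 + \<delta>"])
    then have mq: "mass01 (\<lambda>x. hump x * q x) \<noteq> -1" using True \<delta>0 by simp
    have iP: "integrable lebesgue (\<lambda>x. ?I x * (d x - hump x * p x)\<^sup>2)"
    proof (rule Bochner_Integration.integrable_bound)
      have "integrable lebesgue (\<lambda>x. ?I x * (d x)\<^sup>2)" using i by (simp add: set_integrable_def)
      then show "integrable lebesgue (\<lambda>x. 2 * (?I x * (d x)\<^sup>2) + 2 * (?I x * (hump x * p x)\<^sup>2))"
        by (intro Bochner_Integration.integrable_add integrable_mult_right
          integrable_unit_continuous[OF continuous_on_power[OF cg]])
      have "(\<lambda>x. (?I x * d x - ?I x * (hump x * p x))\<^sup>2) \<in> borel_measurable lebesgue"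
        using m borel_measurable_integrable[OF integrable_unit_continuous[OF cg]]
        by (intro borel_measurable_power borel_measurable_diff) (simp_all add: set_borel_measurable_def)
      moreover have "(?I x * d x - ?I x * (hump x * p x))\<^sup>2 = ?I x * (d x - hump x * p x)\<^sup>2" for x
        by (simp add: indicator_def)
      ultimately show "(\<lambda>x. ?I x * (d x - hump x * p x)\<^sup>2) \<in> borel_measurable lebesgue" by (simp only:)
      show "AE x in lebesgue. norm (?I x * (d x - hump x * p x)\<^sup>2)
          \<le> norm (2 * (?I x * (d x)\<^sup>2) + 2 * (?I x * (hump x * p x)\<^sup>2))"
        using square_diff_le[of _ _ 0] by (intro AE_I2) (auto simp: indicator_def)
    qed
    have iQ: "integrable lebesgue (\<lambda>x. ?I x * (hump x * p x)\<^sup>2)"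
      by (intro integrable_unit_continuous continuous_intros cg)
    have "(LINT x:{0..1}|lebesgue. (d x - hump x * q x)\<^sup>2)
      \<le> (LINT x|lebesgue. 2 * (?I x * (d x - hump x * p x)\<^sup>2) + 2 * \<delta>\<^sup>2 * (?I x * (hump x * p x)\<^sup>2))"
      unfolding set_lebesgue_integral_def
    proof (rule integral_mono_AE')
      show "integrable lebesgue (\<lambda>x. 2 * (?I x * (d x - hump x * p x)\<^sup>2) + 2 * \<delta>\<^sup>2 * (?I x * (hump x * p x)\<^sup>2))"
        by (intro Bochner_Integration.integrable_add integrable_mult_right iP iQ)
      show "AE x in lebesgue. indicator {0..1} x *\<^sub>R (d x - hump x * q x)\<^sup>2
          \<le> 2 * (?I x * (d x - hump x * p x)\<^sup>2) + 2 * \<delta>\<^sup>2 * (?I x * (hump x * p x)\<^sup>2)"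
      proof (intro AE_I2)
        fix x
        have "(hump x * p x - hump x * q x)\<^sup>2 = \<delta>\<^sup>2 * (hump x * p x)\<^sup>2"
          by (simp add: q_def power2_eq_square algebra_simps)
        then show "indicator {0..1} x *\<^sub>R (d x - hump x * q x)\<^sup>2
          \<le> 2 * (?I x * (d x - hump x * p x)\<^sup>2) + 2 * \<delta>\<^sup>2 * (?I x * (hump x * p x)\<^sup>2)"
          using square_diff_le[of "d x" "hump x * q x" "hump x * p x"] by (auto simp: indicator_def)
      qed
    qed simp
    also have "\<dots> = 2 * (LINT x|lebesgue. ?I x * (d x - hump x * p x)\<^sup>2) + 2 * \<delta>\<^sup>2 * Q"
      using iP iQ by (simp add: Q_def)
    also have "\<dots> < e"
    proof -
      have "(LINT x|lebesgue. ?I x * (d x - hump x * p x)\<^sup>2) < e / 4"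
        using p(2) by (simp add: set_lebesgue_integral_def)
      moreover have "\<delta>\<^sup>2 * Q \<le> e / 8"
      proof -
        have "\<delta>\<^sup>2 * Q \<le> \<delta>\<^sup>2 * (\<bar>Q\<bar> + 1)" by (intro mult_left_mono) auto
        also have "\<dots> \<le> (1 * \<delta>) * (\<bar>Q\<bar> + 1)"
          unfolding power2_eq_square using \<delta>0 by (intro mult_right_mono) (auto simp: \<delta>_def)
        also have "\<dots> \<le> (e / (8 * (\<bar>Q\<bar> + 1))) * (\<bar>Q\<bar> + 1)"
          by (intro mult_right_mono) (auto simp: \<delta>_def)
        also have "\<dots> = e / 8" by (simp add: field_simps)
        finally show ?thesis .
      qed
      ultimately show ?thesis using e by linarith
    qed
    finally show thesis using that[OF q mq] by simp
  qed
qed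

section \<open>Minimizers reach the target\<close>

text \<open>Measurability of the profile at time \<open>T\<close> is inherited from \<open>g\<close>, since Lebesgue measure is complete.\<close>

lemma J1_cong_AE:
  assumes d: "set_borel_measurable lebesgue {0..1} d" and g: "g \<in> borel_measurable lebesgue"
    and ae: "AE x in lebesgue. x \<in> {0..1} \<longrightarrow> S T \<sigma> x = g x"
  shows "J1 d S T \<sigma> = 1/2 * (LINT x:{0..1}|lebesgue. (d x - g x)\<^sup>2)"
proof -
  let ?I = "indicator {0..1} :: real \<Rightarrow> real"
  have dm: "(\<lambda>x. ?I x * d x) \<in> borel_measurable lebesgue" using d by (simp add: set_borel_measurable_def)
  have "(\<lambda>x. (?I x * d x - ?I x * g x)\<^sup>2) \<in> borel_measurable lebesgue"
    by (intro borel_measurable_power borel_measurable_diff dm borel_measurable_times[OF borel_measurable_indicator g]) simp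
  then have m: "(\<lambda>x. ?I x *\<^sub>R (d x - g x)\<^sup>2) \<in> borel_measurable lebesgue"
    by (rule measurable_cong[THEN iffD1, rotated]) (simp add: indicator_def)
  have ae': "AE x in lebesgue. ?I x *\<^sub>R (d x - g x)\<^sup>2 = ?I x *\<^sub>R (d x - S T \<sigma> x)\<^sup>2"
    using ae by eventually_elim (auto simp: indicator_def)
  have m': "(\<lambda>x. ?I x *\<^sub>R (d x - S T \<sigma> x)\<^sup>2) \<in> borel_measurable lebesgue"
    by (rule borel_measurable_AE[OF m ae'])
  show ?thesis
    unfolding J1_def set_lebesgue_integral_def using integral_cong_AE[OF m m' ae'] by simp
qed

text \<open>Every profile \<open>hump p\<close> whose mass is not \<open>-1\<close> is attained by a competitor, so the minimal value is
  at most half of its squared distance to \<open>d\<close>, which can be made arbitrarily small.\<close>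

lemma minimal_J1_eq_0:
  assumes T: "0 < T" and dm: "set_borel_measurable lebesgue {0..1} d"
    and d2: "set_integrable lebesgue {0..1} (\<lambda>x. (d x)\<^sup>2)"
    and S: "generates_semigroup vmax S" and min: "minimizes_J1 vmax d S T \<rho>o"
  shows "J1 d S T \<rho>o = 0"
proof -
  have "J1 d S T \<rho>o \<le> 0 + e" if e: "0 < e" for e
  proof -
    obtain p where p: "real_polynomial_function p" "mass01 (\<lambda>x. hump x * p x) \<noteq> -1"
      "(LINT x:{0..1}|lebesgue. (d x - hump x * p x)\<^sup>2) < e"
      using L2_hump_polynomial_approximation_mass[OF dm d2 e] by blast
    obtain g' g'' where g: "\<And>x. ((\<lambda>x. hump x * p x) has_real_derivative g' x) (at x)"
      "\<And>x. (g' has_real_derivative g'' x) (at x)" "continuous_on UNIV g''"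
      using hump_times_polynomial_C2[OF p(1)] by blast
    have g0: "hump x * p x = 0" if "x \<notin> {0<..<1}" for x using hump_outside[OF that] by simp
    obtain \<sigma> where \<sigma>: "\<sigma> \<in> W_1_infty \<inter> W_2_1" "\<exists>T'>T. \<exists>\<rho>. weak_entropy_solution vmax T' \<sigma> \<rho>"
      "AE x in lebesgue. x \<in> {0..1} \<longrightarrow> S T \<sigma> x = hump x * p x"
      by (rule unit_profile_reachable[OF S T g g0 p(2)])
    have "\<not> J1 d S T \<sigma> < J1 d S T \<rho>o"
      using min \<sigma>(1,2) unfolding minimizes_J1_def is_arg_min_def by blast
    moreover have "J1 d S T \<sigma> = 1/2 * (LINT x:{0..1}|lebesgue. (d x - hump x * p x)\<^sup>2)"
      by (intro J1_cong_AE dm \<sigma>(3) borel_measurable_lebesgue_continuous continuous_intros hump_continuous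
          polynomial_continuous p(1))
    ultimately show ?thesis using p(3) e by simp
  qed
  then have "J1 d S T \<rho>o \<le> 0" by (rule field_le_epsilon)
  moreover have "0 \<le> J1 d S T \<rho>o"
    unfolding J1_def set_lebesgue_integral_def by (intro mult_nonneg_nonneg integral_nonneg_AE) auto
  ultimately show ?thesis by simp
qed

theorem theorem3p2:
  fixes T T' vmax :: real
    and d \<rho>o ro :: "real \<Rightarrow> real"
    and S :: "real \<Rightarrow> (real \<Rightarrow> real) \<Rightarrow> real \<Rightarrow> real"
    and \<rho> r :: "real \<Rightarrow> real \<Rightarrow> real"
  assumes "0 < T"
    and "C_k_on 1 {0..1} (speed vmax)"
    and "C_k_on 2 {0..1} (speed vmax)"
    and "set_borel_measurable lebesgue {0..1} d"
    and "set_integrable lebesgue {0..1} (\<lambda>x. (d x)\<^sup>2)"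
    and "generates_semigroup vmax S"
    and "\<rho>o \<in> W_1_infty \<inter> W_2_1"
    and "minimizes_J1 vmax d S T \<rho>o"
    and "\<And>t. \<rho> t = S t \<rho>o"
    and "T < T'"
    and "weak_entropy_solution vmax T' \<rho>o \<rho>"
    and "ro \<in> W_1_infty \<inter> W_2_1"
    and "kruzkov_solution T'
           (\<lambda>t x. vmax * mass01 (\<rho> t) / (1 + mass01 (\<rho> t))\<^sup>2)
           (\<lambda>t x. vmax * \<rho> t x * mass01 (r t) / (1 + mass01 (\<rho> t))\<^sup>2) ro r"
  shows "(LINT x:{0..1}|lebesgue. (d x - \<rho> T x) * r T x) = 0"
proof -
  let ?I = "indicator {0..1} :: real \<Rightarrow> real"
  have T: "T \<in> {0..<T'}" using assms(1,10) by simp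
  have kr: "kruzkov_solution T' (\<lambda>t x. speed vmax (mass01 (\<rho> t))) (\<lambda>t x. 0) \<rho>o \<rho>"
    using assms(11) by (simp add: weak_entropy_solution_def)
  obtain M where M: "\<And>x. \<bar>\<rho> T x\<bar> \<le> M" using kruzkov_solution_bounds[OF kr] T by metis
  have "\<forall>t\<in>{0..<T'}. integrable lebesgue (\<rho> t)" using kr unfolding kruzkov_solution_def by (elim conjE)
  then have \<rho>i: "integrable lebesgue (\<rho> T)" using T by blast
  have dm: "(\<lambda>x. ?I x * d x) \<in> borel_measurable lebesgue"
    using assms(4) by (simp add: set_borel_measurable_def)
  define f where "f x = (?I x * d x - ?I x * \<rho> T x)\<^sup>2" for x
  have f: "f x = ?I x * (d x - \<rho> T x)\<^sup>2" for x by (simp add: f_def indicator_def)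
  have fi: "integrable lebesgue f"
  proof (rule Bochner_Integration.integrable_bound)
    have "integrable lebesgue (\<lambda>x. ?I x * (d x)\<^sup>2)" using assms(5) by (simp add: set_integrable_def)
    then show "integrable lebesgue (\<lambda>x. 2 * (?I x * (d x)\<^sup>2) + 2 * (?I x * M\<^sup>2))"
      by (intro Bochner_Integration.integrable_add integrable_mult_right
          integrable_unit_continuous[OF continuous_on_const])
    show "f \<in> borel_measurable lebesgue" unfolding f_def[abs_def]
      by (intro borel_measurable_power borel_measurable_diff dm
          borel_measurable_times[OF borel_measurable_indicator borel_measurable_integrable[OF \<rho>i]]) simp
    show "AE x in lebesgue. norm (f x) \<le> norm (2 * (?I x * (d x)\<^sup>2) + 2 * (?I x * M\<^sup>2))"
    proof (intro AE_I2)
      fix x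
      have "(\<rho> T x)\<^sup>2 \<le> M\<^sup>2" using power_mono[OF M[of x], of 2] by simp
      then have "(d x - \<rho> T x)\<^sup>2 \<le> 2 * (d x)\<^sup>2 + 2 * M\<^sup>2" using square_diff_le[of "d x" "\<rho> T x" 0] by simp
      then show "norm (f x) \<le> norm (2 * (?I x * (d x)\<^sup>2) + 2 * (?I x * M\<^sup>2))"
        by (auto simp: f indicator_def)
    qed
  qed
  have "J1 d S T \<rho>o = 0" by (rule minimal_J1_eq_0[OF assms(1,4,5,6,8)])
  then have "(LINT x|lebesgue. f x) = 0"
    unfolding f by (simp add: J1_def set_lebesgue_integral_def assms(9)[symmetric])
  moreover have "AE x in lebesgue. 0 \<le> f x" by (simp add: f_def)
  ultimately have "AE x in lebesgue. f x = 0"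
    using integral_nonneg_eq_0_iff_AE[OF fi] by blast
  then have "AE x in lebesgue. ?I x *\<^sub>R ((d x - \<rho> T x) * r T x) = 0"
    by eventually_elim (auto simp: f)
  then show ?thesis
    unfolding set_lebesgue_integral_def by (rule integral_eq_zero_AE)
qed

end
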